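(* Let $A$ be an artin algebra, let $Q$ be an $A$-module with $\operatorname{pd}Q\le1$ and $\operatorname{Ext}_A^1(Q,Q)=0$, and let $n\ge0$ be an integer. Then the following statements hold. (1) Let $$0\to A\xrightarrow{f^0}Q^0\xrightarrow{f^1}Q^1\to\cdots\xrightarrow{f^n}Q^n$$ be an exact sequence with $0\ne Q^i\in\mathsf{add}\,Q$ for each $0\le i\le n$. Let $A^0:=A$ and $A^d:=\operatorname{Cok}f^{d-1}$ for $1\le d\le n+1$. Assume that the inclusion $\iota^i:A^i\to Q^i$ (induced by $f^i$) is a minimal left $\mathsf{add}\,Q$-approximation for each $0\le i\le n$ and that $f^n$ is not an epimorphism. Then for each $1\le d\le n+1$, the module $\mathbf{T}^d:=A^d\oplus Q$ is a $d$-tilting module which is contained in $\mathsf{Fac}_d(Q)$. In particular, for $1\le d\le n$, $\mathbf{T}^{d+1}$ is a mutation of $\mathbf{T}^d$ with respect to $A^d$. (2) Assume that $T\in\mathsf{Fac}_d(Q)$ is a $d$-tilting $A$-module with $Q\in\mathsf{add}\,T$ for some integer $1\le d\le n+1$. Then there exists an exact sequence $$0\to A\to Q^0\to Q^1\to\cdots\to Q^{d-1}\to T^d\to0$$ such that $0\ne Q^i\in\mathsf{add}\,Q$ for each $0\le i\le d-1$ and $0\ne T^d\in\mathsf{add}\,T$. In particular, $A\in\mathsf{Sub}^d(Q)$.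
   Context: Throughout, $A$ is a basic, non-semisimple artin algebra; modules are finitely generated right modules; $\mathsf{add}\,Q$ is the full subcategory of direct summands of finite direct sums of $Q$; $\operatorname{pd}$ denotes projective dimension. A morphism $f:X\to Y$ is left minimal if every $g:Y\to Y$ with $gf=f$ is an automorphism; it is a left $\mathsf{add}\,Q$-approximation if $Y\in\mathsf{add}\,Q$ and $\operatorname{Hom}_A(f,Q)$ is surjective; it is a minimal left $\mathsf{add}\,Q$-approximation if both hold. For $m\ge 1$, $\mathsf{Sub}^{m}(Q)$ is the full subcategory of modules $X$ for which there is an exact sequence $0\to X\to Q^0\to\cdots\to Q^{m-1}$ with all $Q^i\in\mathsf{add}\,Q$; $\mathsf{Fac}_{m}(Q)$ is the full subcategory of modules $Y$ for which there is an exact sequence $Q_{m-1}\to\cdots\to Q_0\to Y\to 0$ with all $Q_i\in\mathsf{add}\,Q$. A module $T$ is tilting if $\operatorname{pd}T<\infty$, $\operatorname{Ext}_A^i(T,T)=0$ for all $i\ge1$, and there is an exact sequence $0\to A\to T^0\to\cdots\to T^r\to 0$ for some $r\ge 0$ with all $T^i\in\mathsf{add}\,T$; it is $d$-tilting if moreover $\operatorname{pd}T=d$. Mutation: let $T=X\oplus U$ with $X\ne0$ and let $f:X\to\overline{U}$ be a minimal left $\mathsf{add}\,U$-approximation of $X$. Then $\mu_X(T):=\operatorname{Cok}f\oplus U$ is the mutation of $T$ with respect to $X$. *)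

theory Defs
  imports "HOL-Algebra.Module" "HOL-Algebra.Ideal" "HOL-Algebra.Elementary_Groups"
    "HOL-Library.Extended_Nat"
begin

section \<open>Right modules\<close>

text \<open>
  Right modules reuse the record of \<^theory>\<open>HOL-Algebra.Module\<close> (whose locale \<^locale>\<open>module\<close>
  requires a commutative ring).  The term \<open>a \<odot>\<^bsub>M\<^esub> x\<close> stands for the right action \<open>x \<cdot> a\<close>, hence the
  order of the factors in the associativity law below.  The fields \<open>mult\<close> and \<open>one\<close> of the record
  are never used for a module.
\<close>

locale right_module = A?: ring A + M?: abelian_group M
  for A :: "('a, 'b) ring_scheme" (structure) and M :: "('a, 'm) module" (structure) +
  assumes smult_closed:
      "\<lbrakk> a \<in> carrier A; x \<in> carrier M \<rbrakk> \<Longrightarrow> a \<odot>\<^bsub>M\<^esub> x \<in> carrier M"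
    and smult_ring_distr:
      "\<lbrakk> a \<in> carrier A; b \<in> carrier A; x \<in> carrier M \<rbrakk> \<Longrightarrow>
        (a \<oplus> b) \<odot>\<^bsub>M\<^esub> x = a \<odot>\<^bsub>M\<^esub> x \<oplus>\<^bsub>M\<^esub> b \<odot>\<^bsub>M\<^esub> x"
    and smult_module_distr:
      "\<lbrakk> a \<in> carrier A; x \<in> carrier M; y \<in> carrier M \<rbrakk> \<Longrightarrow>
        a \<odot>\<^bsub>M\<^esub> (x \<oplus>\<^bsub>M\<^esub> y) = a \<odot>\<^bsub>M\<^esub> x \<oplus>\<^bsub>M\<^esub> a \<odot>\<^bsub>M\<^esub> y"
    and smult_assoc:
      "\<lbrakk> a \<in> carrier A; b \<in> carrier A; x \<in> carrier M \<rbrakk> \<Longrightarrow>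
        (a \<otimes> b) \<odot>\<^bsub>M\<^esub> x = b \<odot>\<^bsub>M\<^esub> (a \<odot>\<^bsub>M\<^esub> x)"
    and smult_one:
      "x \<in> carrier M \<Longrightarrow> \<one> \<odot>\<^bsub>M\<^esub> x = x"

text \<open>Submodules are those of the library locale \<^locale>\<open>submodule\<close>, which does not assume
  commutativity; \<open>N\<close> as a module in its own right is \<open>M\<lparr>carrier := N\<rparr>\<close>.\<close>

definition fin_gen :: "('a, 'b) ring_scheme \<Rightarrow> ('a, 'm) module \<Rightarrow> bool" where
  "fin_gen A M \<longleftrightarrow> (\<exists>S. finite S \<and> S \<subseteq> carrier M \<and>
     (\<forall>N. submodule N A M \<and> S \<subseteq> N \<longrightarrow> N = carrier M))"

definition fg_module :: "('a, 'b) ring_scheme \<Rightarrow> ('a, 'm) module \<Rightarrow> bool" where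
  "fg_module A M \<longleftrightarrow> right_module A M \<and> fin_gen A M"

definition zero_module :: "('a, 'm) module \<Rightarrow> bool" where
  "zero_module M \<longleftrightarrow> carrier M = {\<zero>\<^bsub>M\<^esub>}"

definition regular_module :: "('a, 'b) ring_scheme \<Rightarrow> ('a, 'a) module" where
  "regular_module A = \<lparr>carrier = carrier A, monoid.mult = monoid.mult A, monoid.one = monoid.one A, ring.zero = ring.zero A, ring.add = ring.add A,
     smult = (\<lambda>a x. x \<otimes>\<^bsub>A\<^esub> a)\<rparr>"

definition direct_sum ::
    "('a, 'm) module \<Rightarrow> ('a, 'n) module \<Rightarrow> ('a, 'm \<times> 'n) module" where
  "direct_sum M N = \<lparr>carrier = carrier M \<times> carrier N, monoid.mult = undefined, monoid.one = undefined,
     ring.zero = (\<zero>\<^bsub>M\<^esub>, \<zero>\<^bsub>N\<^esub>),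
     ring.add = (\<lambda>(x, y) (x', y'). (x \<oplus>\<^bsub>M\<^esub> x', y \<oplus>\<^bsub>N\<^esub> y')),
     smult = (\<lambda>a (x, y). (a \<odot>\<^bsub>M\<^esub> x, a \<odot>\<^bsub>N\<^esub> y))\<rparr>"

definition power_module :: "('a, 'm) module \<Rightarrow> nat \<Rightarrow> ('a, nat \<Rightarrow> 'm) module" where
  "power_module M k = \<lparr>carrier = {..<k} \<rightarrow>\<^sub>E carrier M, monoid.mult = undefined, monoid.one = undefined,
     ring.zero = (\<lambda>i\<in>{..<k}. \<zero>\<^bsub>M\<^esub>),
     ring.add = (\<lambda>x y. \<lambda>i\<in>{..<k}. x i \<oplus>\<^bsub>M\<^esub> y i),
     smult = (\<lambda>a x. \<lambda>i\<in>{..<k}. a \<odot>\<^bsub>M\<^esub> x i)\<rparr>"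

definition quotient_module :: "('a, 'm) module \<Rightarrow> 'm set \<Rightarrow> ('a, 'm set) module" where
  "quotient_module M N = \<lparr>carrier = a_rcosets\<^bsub>M\<^esub> N, monoid.mult = undefined, monoid.one = undefined,
     ring.zero = N,
     ring.add = (\<lambda>C D. C <+>\<^bsub>M\<^esub> D),
     smult = (\<lambda>a C. \<Union>x\<in>C. N +>\<^bsub>M\<^esub> (a \<odot>\<^bsub>M\<^esub> x))\<rparr>"

text \<open>Homomorphisms are compared on the carrier of their domain only.\<close>

definition mod_hom ::
    "('a, 'b) ring_scheme \<Rightarrow> ('a, 'm) module \<Rightarrow> ('a, 'n) module \<Rightarrow> ('m \<Rightarrow> 'n) set" where
  "mod_hom A M N = {f \<in> carrier M \<rightarrow> carrier N.
     (\<forall>x\<in>carrier M. \<forall>y\<in>carrier M. f (x \<oplus>\<^bsub>M\<^esub> y) = f x \<oplus>\<^bsub>N\<^esub> f y) \<and>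
     (\<forall>a\<in>carrier A. \<forall>x\<in>carrier M. f (a \<odot>\<^bsub>M\<^esub> x) = a \<odot>\<^bsub>N\<^esub> f x)}"

definition mod_iso ::
    "('a, 'b) ring_scheme \<Rightarrow> ('a, 'm) module \<Rightarrow> ('a, 'n) module \<Rightarrow> bool" where
  "mod_iso A M N \<longleftrightarrow> (\<exists>f\<in>mod_hom A M N. bij_betw f (carrier M) (carrier N))"

definition complementary ::
    "('a, 'b) ring_scheme \<Rightarrow> ('a, 'm) module \<Rightarrow> 'm set \<Rightarrow> 'm set \<Rightarrow> bool" where
  "complementary A M N N' \<longleftrightarrow> submodule N A M \<and> submodule N' A M \<and>
     N \<inter> N' = {\<zero>\<^bsub>M\<^esub>} \<and> N <+>\<^bsub>M\<^esub> N' = carrier M"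

definition in_add ::
    "('a, 'b) ring_scheme \<Rightarrow> ('a, 'q) module \<Rightarrow> ('a, 'm) module \<Rightarrow> bool" where
  "in_add A Q X \<longleftrightarrow> fg_module A X \<and>
     (\<exists>k N N'. complementary A (power_module Q k) N N' \<and>
        mod_iso A X ((power_module Q k)\<lparr>carrier := N\<rparr>))"


section \<open>Basic, non-semisimple artin algebras\<close>

text \<open>\<open>A\<close> is an algebra over the commutative artinian ring \<open>R\<close> via the structure map \<open>\<phi>\<close>.\<close>

locale artin_algebra = R: cring R + A: ring A
  for R :: "('r, 's) ring_scheme" and A :: "('a, 'b) ring_scheme" and \<phi> :: "'r \<Rightarrow> 'a" +
  assumes dcc: "\<lbrakk> \<And>k. ideal (I k) R; \<And>k. I (Suc k) \<subseteq> I k \<rbrakk> \<Longrightarrow> \<exists>k::nat. \<forall>l\<ge>k. I l = I k"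
    and hom: "\<phi> \<in> ring_hom R A"
    and central: "\<lbrakk> r \<in> carrier R; a \<in> carrier A \<rbrakk> \<Longrightarrow> \<phi> r \<otimes>\<^bsub>A\<^esub> a = a \<otimes>\<^bsub>A\<^esub> \<phi> r"
    and fin_gen: "fin_gen R \<lparr>carrier = carrier A, monoid.mult = monoid.mult A, monoid.one = monoid.one A, ring.zero = ring.zero A,
      ring.add = ring.add A, smult = (\<lambda>r x. \<phi> r \<otimes>\<^bsub>A\<^esub> x)\<rparr>"

definition internal_direct_sum ::
    "('a, 'b) ring_scheme \<Rightarrow> ('a, 'm) module \<Rightarrow> nat \<Rightarrow> (nat \<Rightarrow> 'm set) \<Rightarrow> bool" where
  "internal_direct_sum A M k P \<longleftrightarrow> (\<forall>i<k. submodule (P i) A M) \<and>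
     (\<forall>x\<in>carrier M. \<exists>!y. y \<in> (\<Pi>\<^sub>E i\<in>{..<k}. P i) \<and> x = finsum M y {..<k})"

definition indecomposable :: "('a, 'b) ring_scheme \<Rightarrow> ('a, 'm) module \<Rightarrow> bool" where
  "indecomposable A M \<longleftrightarrow> \<not> zero_module M \<and>
     (\<forall>N N'. complementary A M N N' \<longrightarrow> N = {\<zero>\<^bsub>M\<^esub>} \<or> N' = {\<zero>\<^bsub>M\<^esub>})"

definition simple_module :: "('a, 'b) ring_scheme \<Rightarrow> ('a, 'm) module \<Rightarrow> bool" where
  "simple_module A M \<longleftrightarrow> \<not> zero_module M \<and>
     (\<forall>N. submodule N A M \<longrightarrow> N = {\<zero>\<^bsub>M\<^esub>} \<or> N = carrier M)"

definition basic_algebra :: "('a, 'b) ring_scheme \<Rightarrow> bool" where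
  "basic_algebra A \<longleftrightarrow> (\<exists>k P. internal_direct_sum A (regular_module A) k P \<and>
     (\<forall>i<k. indecomposable A ((regular_module A)\<lparr>carrier := P i\<rparr>)) \<and>
     (\<forall>i<k. \<forall>j<k. i \<noteq> j \<longrightarrow> \<not> mod_iso A ((regular_module A)\<lparr>carrier := P i\<rparr>)
                                       ((regular_module A)\<lparr>carrier := P j\<rparr>)))"

definition semisimple_algebra :: "('a, 'b) ring_scheme \<Rightarrow> bool" where
  "semisimple_algebra A \<longleftrightarrow> (\<exists>k P. internal_direct_sum A (regular_module A) k P \<and>
     (\<forall>i<k. simple_module A ((regular_module A)\<lparr>carrier := P i\<rparr>)))"


section \<open>Exact sequences\<close>

text \<open>
  For a sequence \<open>0 \<rightarrow> X \<rightarrow> Y\<^sup>0 \<rightarrow> Y\<^sup>1 \<rightarrow> \<dots>\<close>, the map \<open>X \<rightarrow> Y\<^sup>0\<close> is \<open>f0\<close> and the map \<open>Y\<^sup>i \<rightarrow> Y\<^sup>i\<^sup>+\<^sup>1\<close> is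
  \<open>f (Suc i)\<close>; the value \<open>f 0\<close> is not used.  (\<open>f0\<close> is separate because the carrier of \<open>X\<close> may have
  a different type from the carriers of the \<open>Y\<^sup>i\<close>.)  The image of the map into \<open>Y\<^sup>i\<close> is
  \<open>image_into X Y f0 f i\<close>, and its cokernel is \<open>cokernel X Y f0 f (Suc i)\<close>.
\<close>

fun image_into :: "('a, 'x) module \<Rightarrow> (nat \<Rightarrow> ('a, 'm) module) \<Rightarrow> ('x \<Rightarrow> 'm) \<Rightarrow>
    (nat \<Rightarrow> 'm \<Rightarrow> 'm) \<Rightarrow> nat \<Rightarrow> 'm set" where
  "image_into X Y f0 f 0 = f0 ` carrier X"
| "image_into X Y f0 f (Suc i) = f (Suc i) ` carrier (Y i)"

definition cokernel :: "('a, 'x) module \<Rightarrow> (nat \<Rightarrow> ('a, 'm) module) \<Rightarrow> ('x \<Rightarrow> 'm) \<Rightarrow>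
    (nat \<Rightarrow> 'm \<Rightarrow> 'm) \<Rightarrow> nat \<Rightarrow> ('a, 'm set) module" where
  "cokernel X Y f0 f d = quotient_module (Y (d - 1)) (image_into X Y f0 f (d - 1))"

text \<open>Exactness of \<open>0 \<rightarrow> X \<rightarrow> Y\<^sup>0 \<rightarrow> \<dots> \<rightarrow> Y\<^sup>m\<close>; nothing is required at the right-hand end \<open>Y\<^sup>m\<close>.\<close>

definition exact_right :: "('a, 'b) ring_scheme \<Rightarrow> ('a, 'x) module \<Rightarrow>
    (nat \<Rightarrow> ('a, 'm) module) \<Rightarrow> ('x \<Rightarrow> 'm) \<Rightarrow> (nat \<Rightarrow> 'm \<Rightarrow> 'm) \<Rightarrow> nat \<Rightarrow> bool" where
  "exact_right A X Y f0 f m \<longleftrightarrow>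
     f0 \<in> mod_hom A X (Y 0) \<and> inj_on f0 (carrier X) \<and>
     (\<forall>i<m. f (Suc i) \<in> mod_hom A (Y i) (Y (Suc i)) \<and>
            image_into X Y f0 f i = a_kernel (Y i) (Y (Suc i)) (f (Suc i)))"

text \<open>
  Dually, in \<open>\<dots> \<rightarrow> P\<^sub>1 \<rightarrow> P\<^sub>0 \<rightarrow> X \<rightarrow> 0\<close> the map \<open>P\<^sub>0 \<rightarrow> X\<close> is \<open>e\<close> and the map \<open>P\<^sub>i\<^sub>+\<^sub>1 \<rightarrow> P\<^sub>i\<close> is
  \<open>d (Suc i)\<close>.
\<close>

fun kernel_from :: "('a, 'x) module \<Rightarrow> (nat \<Rightarrow> ('a, 'm) module) \<Rightarrow> ('m \<Rightarrow> 'x) \<Rightarrow>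
    (nat \<Rightarrow> 'm \<Rightarrow> 'm) \<Rightarrow> nat \<Rightarrow> 'm set" where
  "kernel_from X P e d 0 = a_kernel (P 0) X e"
| "kernel_from X P e d (Suc i) = a_kernel (P (Suc i)) (P i) (d (Suc i))"

text \<open>Exactness of \<open>P\<^sub>m \<rightarrow> \<dots> \<rightarrow> P\<^sub>0 \<rightarrow> X \<rightarrow> 0\<close>; nothing is required at the left-hand end \<open>P\<^sub>m\<close>.\<close>

definition exact_left :: "('a, 'b) ring_scheme \<Rightarrow> ('a, 'x) module \<Rightarrow>
    (nat \<Rightarrow> ('a, 'm) module) \<Rightarrow> ('m \<Rightarrow> 'x) \<Rightarrow> (nat \<Rightarrow> 'm \<Rightarrow> 'm) \<Rightarrow> nat \<Rightarrow> bool" where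
  "exact_left A X P e d m \<longleftrightarrow>
     e \<in> mod_hom A (P 0) X \<and> e ` carrier (P 0) = carrier X \<and>
     (\<forall>i<m. d (Suc i) \<in> mod_hom A (P (Suc i)) (P i) \<and>
            d (Suc i) ` carrier (P (Suc i)) = kernel_from X P e d i)"

text \<open>
  Every member of \<open>add Q\<close> is isomorphic to a module whose carrier is a set of functions
  \<open>nat \<Rightarrow> 'q\<close>, namely a summand of some \<open>power_module Q k\<close>.  Therefore existential quantification
  over members of \<open>add Q\<close> loses no generality when restricted to modules on that type, as is
  done from here on.
\<close>

definition in_Sub ::
    "('a, 'b) ring_scheme \<Rightarrow> ('a, 'q) module \<Rightarrow> nat \<Rightarrow> ('a, 'm) module \<Rightarrow> bool" where
  "in_Sub A Q m X \<longleftrightarrow> 1 \<le> m \<and> fg_module A X \<and>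
     (\<exists>(Y :: nat \<Rightarrow> ('a, nat \<Rightarrow> 'q) module) f0 f.
        (\<forall>i<m. in_add A Q (Y i)) \<and> exact_right A X Y f0 f (m - 1))"

definition in_Fac ::
    "('a, 'b) ring_scheme \<Rightarrow> ('a, 'q) module \<Rightarrow> nat \<Rightarrow> ('a, 'm) module \<Rightarrow> bool" where
  "in_Fac A Q m X \<longleftrightarrow> 1 \<le> m \<and> fg_module A X \<and>
     (\<exists>(P :: nat \<Rightarrow> ('a, nat \<Rightarrow> 'q) module) e d.
        (\<forall>i<m. in_add A Q (P i)) \<and> exact_left A X P e d (m - 1))"


section \<open>Projective dimension and Ext\<close>

text \<open>A finitely generated module is projective iff it is a direct summand of some \<open>A\<^sup>k\<close>.\<close>

abbreviation fg_projective :: "('a, 'b) ring_scheme \<Rightarrow> ('a, 'm) module \<Rightarrow> bool" where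
  "fg_projective A P \<equiv> in_add A (regular_module A) P"

definition proj_resolution :: "('a, 'b) ring_scheme \<Rightarrow> ('a, 'm) module \<Rightarrow>
    (nat \<Rightarrow> ('a, nat \<Rightarrow> 'a) module) \<Rightarrow> ((nat \<Rightarrow> 'a) \<Rightarrow> 'm) \<Rightarrow>
    (nat \<Rightarrow> (nat \<Rightarrow> 'a) \<Rightarrow> (nat \<Rightarrow> 'a)) \<Rightarrow> bool" where
  "proj_resolution A M P e d \<longleftrightarrow> (\<forall>i. fg_projective A (P i)) \<and> (\<forall>m. exact_left A M P e d m)"

text \<open>The infimum of the empty set is \<open>\<infinity>\<close>; the zero module gets projective dimension \<open>0\<close>.\<close>

definition pd :: "('a, 'b) ring_scheme \<Rightarrow> ('a, 'm) module \<Rightarrow> enat" where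
  "pd A M = Inf {enat n | n. \<exists>P e d. proj_resolution A M P e d \<and> (\<forall>i>n. zero_module (P i))}"

text \<open>The elements of the group \<open>Hom\<^sub>A(M, N)\<close> are normalised to be \<open>undefined\<close> outside the carrier
  of \<open>M\<close>, so that equality of elements is equality on the carrier.\<close>

definition hom_group ::
    "('a, 'b) ring_scheme \<Rightarrow> ('a, 'm) module \<Rightarrow> ('a, 'n) module \<Rightarrow> ('m \<Rightarrow> 'n) monoid" where
  "hom_group A M N = \<lparr>carrier = mod_hom A M N \<inter> extensional (carrier M),
     monoid.mult = (\<lambda>f g. \<lambda>x\<in>carrier M. f x \<oplus>\<^bsub>N\<^esub> g x),
     monoid.one = (\<lambda>x\<in>carrier M. \<zero>\<^bsub>N\<^esub>)\<rparr>"

definition cocycles :: "('a, 'b) ring_scheme \<Rightarrow> (nat \<Rightarrow> ('a, 'p) module) \<Rightarrow>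
    (nat \<Rightarrow> 'p \<Rightarrow> 'p) \<Rightarrow> ('a, 'n) module \<Rightarrow> nat \<Rightarrow> ('p \<Rightarrow> 'n) set" where
  "cocycles A P d N i = {f \<in> carrier (hom_group A (P i) N).
     \<forall>x\<in>carrier (P (Suc i)). f (d (Suc i) x) = \<zero>\<^bsub>N\<^esub>}"

fun coboundaries :: "('a, 'b) ring_scheme \<Rightarrow> (nat \<Rightarrow> ('a, 'p) module) \<Rightarrow>
    (nat \<Rightarrow> 'p \<Rightarrow> 'p) \<Rightarrow> ('a, 'n) module \<Rightarrow> nat \<Rightarrow> ('p \<Rightarrow> 'n) set" where
  "coboundaries A P d N 0 = {\<one>\<^bsub>hom_group A (P 0) N\<^esub>}"
| "coboundaries A P d N (Suc i) =
     (\<lambda>g. compose (carrier (P (Suc i))) g (d (Suc i))) ` carrier (hom_group A (P i) N)"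

text \<open>\<open>Ext A i M N\<close> is the \<open>i\<close>-th cohomology group of \<open>Hom\<^sub>A(P\<^sub>\<bullet>, N)\<close>, where \<open>P\<^sub>\<bullet>\<close> is a
  chosen projective resolution of \<open>M\<close>; up to isomorphism it does not depend on the choice.\<close>

definition Ext :: "('a, 'b) ring_scheme \<Rightarrow> nat \<Rightarrow> ('a, 'm) module \<Rightarrow> ('a, 'n) module \<Rightarrow>
    ((nat \<Rightarrow> 'a) \<Rightarrow> 'n) set monoid" where
  "Ext A i M N =
     (let (P, e, d) = (SOME (P, e, d). proj_resolution A M P e d)
      in (hom_group A (P i) N)\<lparr>carrier := cocycles A P d N i\<rparr> Mod coboundaries A P d N i)"


section \<open>Tilting modules, approximations and mutation\<close>

definition tilting :: "('a, 'b) ring_scheme \<Rightarrow> ('a, 't) module \<Rightarrow> bool" where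
  "tilting A T \<longleftrightarrow> fg_module A T \<and> pd A T < \<infinity> \<and> (\<forall>i\<ge>1. trivial_group (Ext A i T T)) \<and>
     (\<exists>r (Y :: nat \<Rightarrow> ('a, nat \<Rightarrow> 't) module) f0 f.
        (\<forall>i\<le>r. in_add A T (Y i)) \<and> exact_right A (regular_module A) Y f0 f r \<and>
        image_into (regular_module A) Y f0 f r = carrier (Y r))"

definition d_tilting :: "('a, 'b) ring_scheme \<Rightarrow> nat \<Rightarrow> ('a, 't) module \<Rightarrow> bool" where
  "d_tilting A d T \<longleftrightarrow> tilting A T \<and> pd A T = enat d"

definition left_minimal ::
    "('a, 'b) ring_scheme \<Rightarrow> ('a, 'm) module \<Rightarrow> ('a, 'n) module \<Rightarrow> ('m \<Rightarrow> 'n) \<Rightarrow> bool" where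
  "left_minimal A X Y f \<longleftrightarrow> f \<in> mod_hom A X Y \<and>
     (\<forall>g\<in>mod_hom A Y Y. (\<forall>x\<in>carrier X. g (f x) = f x) \<longrightarrow> bij_betw g (carrier Y) (carrier Y))"

definition left_approx :: "('a, 'b) ring_scheme \<Rightarrow> ('a, 'q) module \<Rightarrow>
    ('a, 'm) module \<Rightarrow> ('a, 'n) module \<Rightarrow> ('m \<Rightarrow> 'n) \<Rightarrow> bool" where
  "left_approx A Q X Y f \<longleftrightarrow> f \<in> mod_hom A X Y \<and> in_add A Q Y \<and>
     (\<forall>h\<in>mod_hom A X Q. \<exists>g\<in>mod_hom A Y Q. \<forall>x\<in>carrier X. g (f x) = h x)"

definition minimal_left_approx :: "('a, 'b) ring_scheme \<Rightarrow> ('a, 'q) module \<Rightarrow>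
    ('a, 'm) module \<Rightarrow> ('a, 'n) module \<Rightarrow> ('m \<Rightarrow> 'n) \<Rightarrow> bool" where
  "minimal_left_approx A Q X Y f \<longleftrightarrow> left_approx A Q X Y f \<and> left_minimal A X Y f"

text \<open>\<open>T'\<close> is (up to isomorphism) the mutation \<open>\<mu>\<^sub>X(T)\<close>, formed from the decomposition
  \<open>T \<cong> X \<oplus> U\<close>.\<close>

definition is_mutation :: "('a, 'b) ring_scheme \<Rightarrow> ('a, 't) module \<Rightarrow>
    ('a, 'm) module \<Rightarrow> ('a, 'u) module \<Rightarrow> ('a, 'n) module \<Rightarrow> bool" where
  "is_mutation A T X U T' \<longleftrightarrow> mod_iso A T (direct_sum X U) \<and> \<not> zero_module X \<and>
     (\<exists>(V :: ('a, nat \<Rightarrow> 'u) module) f. minimal_left_approx A U X V f \<and>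
        mod_iso A T' (direct_sum (quotient_module V (f ` carrier X)) U))"

end

theory Submission
  imports Defs
begin

text \<open>
  Everything rests on a relation \<open>pp n M N\<close>, read off from syzygies: \<open>pd M \<le> n\<close> and
  \<open>Ext\<^sup>j(M, N) = 0\<close> for all \<open>j \<ge> 1\<close>.  It satisfies the two-out-of-three rules of the long exact
  sequences, and by dimension shifting \<open>pp m M Q\<close> implies \<open>pp m M N\<close> for every \<open>N\<close> in \<open>Fac\<^sub>m(Q)\<close>.

  (1) The approximation property gives \<open>pp d A\<^sup>d Q\<close> by induction on \<open>d\<close>.  As \<open>T\<^sup>d = A\<^sup>d \<oplus> Q\<close> lies in
  \<open>Fac\<^sub>d(Q)\<close>, dimension shifting yields \<open>pp d T\<^sup>d T\<^sup>d\<close>.  If \<open>pd A\<^sup>d\<close> were at most \<open>d - 1\<close>, then also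
  \<open>Ext\<^sup>1(A\<^sup>d, A\<^sup>d\<^sup>-\<^sup>1) = 0\<close>, because \<open>A\<^sup>d\<^sup>-\<^sup>1\<close> lies in \<open>Fac\<^sub>d\<^sub>-\<^sub>1(Q)\<close>; the approximation of \<open>A\<^sup>d\<^sup>-\<^sup>1\<close> would split
  and, by minimality, \<open>A\<^sup>d\<close> would vanish.

  (2) Let \<open>B\<^sup>i\<close> be the cosyzygies of \<open>A\<close> in a coresolution by \<open>add T\<close>.  Starting from \<open>A\<^sup>0 = A\<close>, one
  constructs modules \<open>A\<^sup>i\<close> with \<open>pp i A\<^sup>i Q\<close> whose identity factors through \<open>B\<^sup>i\<close> modulo maps through
  \<open>add T\<close>.  Then \<open>A\<^sup>i\<close> embeds into a module \<open>W\<close> along a map that factors through \<open>add T\<close>.  For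
  \<open>i < d\<close> every map \<open>A\<^sup>i \<rightarrow> T\<close> lifts along the \<open>Q\<close>-presentation of \<open>T\<close>, so the embedding factors through
  some \<open>Q\<^sup>k\<close>; the resulting monomorphism \<open>A\<^sup>i \<rightarrow> Q\<^sup>k\<close> is a left approximation, and its cokernel is \<open>A\<^sup>i\<^sup>+\<^sup>1\<close>.
  Finally \<open>B\<^sup>d\<close> lies in \<open>add T\<close>, hence so does \<open>A\<^sup>d\<close>.
\<close>

text \<open>Two obstacles shape the proof: \<open>Ext\<close> is read off one chosen resolution, and
  syzygies, cokernels and sums live on different carrier types. The first is met by conditions on a
  single cover and its kernel: by a stable form of Schanuel's lemma (\<open>syz_core\<close>) they
  hold for one cover iff they hold for all, so resolutions are never compared degree by degree. The
  second explains the lemmas ending in \<open>_U\<close>: an induction runs over syzygies on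
  \<open>'a fmodule\<close>, and one last step enters this type from an arbitrary one. Both
  conditions are merged in \<open>pp\<close> because dimension shifting uses them together: along a
  presentation with m terms, Ext^j(M, N) becomes Ext^(j+m) of M with coefficients in the last
  kernel, which is 0 once pd M is at most m. Hence one number bounds pd M and is the length of the
  presentation. In (2) the cosyzygies of A in two coresolutions are compared in one direction only
  and modulo maps through add T; this takes the place of a Krull-Schmidt argument.\<close>

type_synonym 'a fmodule = "('a, nat \<Rightarrow> 'a) module"

locale ring_modules = A: ring A for A :: "('a, 'b) ring_scheme"
begin

abbreviation rm :: "('a, 'm) module \<Rightarrow> bool" where "rm M \<equiv> right_module A M"
abbreviation Hom :: "('a, 'm) module \<Rightarrow> ('a, 'n) module \<Rightarrow> ('m \<Rightarrow> 'n) set" where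
  "Hom M N \<equiv> mod_hom A M N"
abbreviation reg :: "('a, 'a) module" where "reg \<equiv> regular_module A"

text \<open>The negative is taken through the action, so that it does not depend on the carrier of \<open>M\<close>
  and is inherited by submodules and preserved by homomorphisms without further argument.\<close>

definition neg :: "('a, 'm) module \<Rightarrow> 'm \<Rightarrow> 'm" where
  "neg M x = (\<ominus>\<^bsub>A\<^esub> \<one>\<^bsub>A\<^esub>) \<odot>\<^bsub>M\<^esub> x"

section \<open>Right modules\<close>

lemma rm_abelian_group: "rm M \<Longrightarrow> abelian_group M"
  by (simp add: right_module_def)

lemma rm_closed [simp]:
  assumes "rm M"
  shows "\<zero>\<^bsub>M\<^esub> \<in> carrier M"
    and "x \<in> carrier M \<Longrightarrow> y \<in> carrier M \<Longrightarrow> x \<oplus>\<^bsub>M\<^esub> y \<in> carrier M"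
    and "a \<in> carrier A \<Longrightarrow> x \<in> carrier M \<Longrightarrow> a \<odot>\<^bsub>M\<^esub> x \<in> carrier M"
    and "x \<in> carrier M \<Longrightarrow> neg M x \<in> carrier M"
proof -
  interpret right_module A M by fact
  show "\<zero>\<^bsub>M\<^esub> \<in> carrier M"
    and "x \<in> carrier M \<Longrightarrow> y \<in> carrier M \<Longrightarrow> x \<oplus>\<^bsub>M\<^esub> y \<in> carrier M"
    and "a \<in> carrier A \<Longrightarrow> x \<in> carrier M \<Longrightarrow> a \<odot>\<^bsub>M\<^esub> x \<in> carrier M"
    and "x \<in> carrier M \<Longrightarrow> neg M x \<in> carrier M"
    by (simp_all add: smult_closed neg_def)
qed

lemma rm_add:
  assumes "rm M" "x \<in> carrier M"
  shows "\<zero>\<^bsub>M\<^esub> \<oplus>\<^bsub>M\<^esub> x = x" and "x \<oplus>\<^bsub>M\<^esub> \<zero>\<^bsub>M\<^esub> = x"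
    and "y \<in> carrier M \<Longrightarrow> x \<oplus>\<^bsub>M\<^esub> y = y \<oplus>\<^bsub>M\<^esub> x"
    and "y \<in> carrier M \<Longrightarrow> z \<in> carrier M \<Longrightarrow> (x \<oplus>\<^bsub>M\<^esub> y) \<oplus>\<^bsub>M\<^esub> z = x \<oplus>\<^bsub>M\<^esub> (y \<oplus>\<^bsub>M\<^esub> z)"
    and "y \<in> carrier M \<Longrightarrow> z \<in> carrier M \<Longrightarrow> y \<oplus>\<^bsub>M\<^esub> (x \<oplus>\<^bsub>M\<^esub> z) = x \<oplus>\<^bsub>M\<^esub> (y \<oplus>\<^bsub>M\<^esub> z)"
proof -
  interpret right_module A M by fact
  show "\<zero>\<^bsub>M\<^esub> \<oplus>\<^bsub>M\<^esub> x = x" and "x \<oplus>\<^bsub>M\<^esub> \<zero>\<^bsub>M\<^esub> = x"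
    and "y \<in> carrier M \<Longrightarrow> x \<oplus>\<^bsub>M\<^esub> y = y \<oplus>\<^bsub>M\<^esub> x"
    and "y \<in> carrier M \<Longrightarrow> z \<in> carrier M \<Longrightarrow> (x \<oplus>\<^bsub>M\<^esub> y) \<oplus>\<^bsub>M\<^esub> z = x \<oplus>\<^bsub>M\<^esub> (y \<oplus>\<^bsub>M\<^esub> z)"
    and "y \<in> carrier M \<Longrightarrow> z \<in> carrier M \<Longrightarrow> y \<oplus>\<^bsub>M\<^esub> (x \<oplus>\<^bsub>M\<^esub> z) = x \<oplus>\<^bsub>M\<^esub> (y \<oplus>\<^bsub>M\<^esub> z)"
    using assms(2) by (simp_all add: M.a_ac)
qed

lemmas rm_zero_add [simp] = rm_add(1,2)
lemmas rm_ac = rm_add(3,4,5)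

lemma rm_smult:
  assumes "rm M" "x \<in> carrier M" "a \<in> carrier A"
  shows "b \<in> carrier A \<Longrightarrow> (a \<oplus>\<^bsub>A\<^esub> b) \<odot>\<^bsub>M\<^esub> x = a \<odot>\<^bsub>M\<^esub> x \<oplus>\<^bsub>M\<^esub> b \<odot>\<^bsub>M\<^esub> x"
    and "y \<in> carrier M \<Longrightarrow> a \<odot>\<^bsub>M\<^esub> (x \<oplus>\<^bsub>M\<^esub> y) = a \<odot>\<^bsub>M\<^esub> x \<oplus>\<^bsub>M\<^esub> a \<odot>\<^bsub>M\<^esub> y"
    and "b \<in> carrier A \<Longrightarrow> (a \<otimes>\<^bsub>A\<^esub> b) \<odot>\<^bsub>M\<^esub> x = b \<odot>\<^bsub>M\<^esub> (a \<odot>\<^bsub>M\<^esub> x)"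
  using right_module.smult_ring_distr[OF assms(1) assms(3) _ assms(2)]
    right_module.smult_module_distr[OF assms(1,3,2)]
    right_module.smult_assoc[OF assms(1,3) _ assms(2)] by auto

lemma rm_smult_one [simp]: "rm M \<Longrightarrow> x \<in> carrier M \<Longrightarrow> \<one>\<^bsub>A\<^esub> \<odot>\<^bsub>M\<^esub> x = x"
  by (rule right_module.smult_one)

lemma rm_smult_zero [simp]:
  assumes M: "rm M"
  shows "x \<in> carrier M \<Longrightarrow> \<zero>\<^bsub>A\<^esub> \<odot>\<^bsub>M\<^esub> x = \<zero>\<^bsub>M\<^esub>" and "a \<in> carrier A \<Longrightarrow> a \<odot>\<^bsub>M\<^esub> \<zero>\<^bsub>M\<^esub> = \<zero>\<^bsub>M\<^esub>"
proof -
  interpret right_module A M by fact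
  { assume x: "x \<in> carrier M"
    have "\<zero>\<^bsub>A\<^esub> \<odot>\<^bsub>M\<^esub> x \<oplus>\<^bsub>M\<^esub> \<zero>\<^bsub>A\<^esub> \<odot>\<^bsub>M\<^esub> x = \<zero>\<^bsub>A\<^esub> \<odot>\<^bsub>M\<^esub> x"
      using rm_smult(1)[OF M x, of "\<zero>\<^bsub>A\<^esub>" "\<zero>\<^bsub>A\<^esub>"] by simp
    thus "\<zero>\<^bsub>A\<^esub> \<odot>\<^bsub>M\<^esub> x = \<zero>\<^bsub>M\<^esub>" 
      using M.add.l_cancel_one[of "\<zero>\<^bsub>A\<^esub> \<odot>\<^bsub>M\<^esub> x" "\<zero>\<^bsub>A\<^esub> \<odot>\<^bsub>M\<^esub> x"] x M by simp }
  { assume a: "a \<in> carrier A"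
    have "a \<odot>\<^bsub>M\<^esub> \<zero>\<^bsub>M\<^esub> \<oplus>\<^bsub>M\<^esub> a \<odot>\<^bsub>M\<^esub> \<zero>\<^bsub>M\<^esub> = a \<odot>\<^bsub>M\<^esub> \<zero>\<^bsub>M\<^esub>"
      using rm_smult(2)[OF M, of "\<zero>\<^bsub>M\<^esub>" a "\<zero>\<^bsub>M\<^esub>"] a M by simp
    thus "a \<odot>\<^bsub>M\<^esub> \<zero>\<^bsub>M\<^esub> = \<zero>\<^bsub>M\<^esub>" 
      using M.add.l_cancel_one[of "a \<odot>\<^bsub>M\<^esub> \<zero>\<^bsub>M\<^esub>" "a \<odot>\<^bsub>M\<^esub> \<zero>\<^bsub>M\<^esub>"] a M by simp }
qed

lemma rm_neg [simp]:
  assumes "rm M" "x \<in> carrier M"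
  shows "x \<oplus>\<^bsub>M\<^esub> neg M x = \<zero>\<^bsub>M\<^esub>" and "neg M x \<oplus>\<^bsub>M\<^esub> x = \<zero>\<^bsub>M\<^esub>"
    and "y \<in> carrier M \<Longrightarrow> x \<oplus>\<^bsub>M\<^esub> (neg M x \<oplus>\<^bsub>M\<^esub> y) = y"
    and "y \<in> carrier M \<Longrightarrow> neg M x \<oplus>\<^bsub>M\<^esub> (x \<oplus>\<^bsub>M\<^esub> y) = y"
proof -
  show 1: "x \<oplus>\<^bsub>M\<^esub> neg M x = \<zero>\<^bsub>M\<^esub>"
    using rm_smult(1)[OF assms, of "\<one>\<^bsub>A\<^esub>" "\<ominus>\<^bsub>A\<^esub> \<one>\<^bsub>A\<^esub>"] assms by (simp add: neg_def A.r_neg)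
  show 2: "neg M x \<oplus>\<^bsub>M\<^esub> x = \<zero>\<^bsub>M\<^esub>"
    using 1 assms by (simp add: rm_add(3))
  show "y \<in> carrier M \<Longrightarrow> x \<oplus>\<^bsub>M\<^esub> (neg M x \<oplus>\<^bsub>M\<^esub> y) = y"
    and "y \<in> carrier M \<Longrightarrow> neg M x \<oplus>\<^bsub>M\<^esub> (x \<oplus>\<^bsub>M\<^esub> y) = y"
    using rm_add(4)[OF assms, of "neg M x" y] rm_add(4)[OF assms(1) _ assms(2), of "neg M x" y]
      1 2 assms by simp_all
qed

lemma rm_neg_add [simp]:
  assumes "rm M" "x \<in> carrier M" "y \<in> carrier M"
  shows "neg M (x \<oplus>\<^bsub>M\<^esub> y) = neg M x \<oplus>\<^bsub>M\<^esub> neg M y"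
  using assms by (simp add: neg_def rm_smult)

lemma rm_neg_zero [simp]: "rm M \<Longrightarrow> neg M \<zero>\<^bsub>M\<^esub> = \<zero>\<^bsub>M\<^esub>"
  by (simp add: neg_def)

lemma rm_smult_neg:
  assumes "rm M" "x \<in> carrier M" "a \<in> carrier A"
  shows "a \<odot>\<^bsub>M\<^esub> neg M x = neg M (a \<odot>\<^bsub>M\<^esub> x)"
  using assms
  by (simp add: neg_def rm_smult(3)[symmetric] A.l_minus A.r_minus)

lemma rm_sub_eq_zero_iff [simp]:
  assumes "rm M" "x \<in> carrier M" "y \<in> carrier M"
  shows "x \<oplus>\<^bsub>M\<^esub> neg M y = \<zero>\<^bsub>M\<^esub> \<longleftrightarrow> x = y"
proof
  assume *: "x \<oplus>\<^bsub>M\<^esub> neg M y = \<zero>\<^bsub>M\<^esub>"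
  have "x = (x \<oplus>\<^bsub>M\<^esub> neg M y) \<oplus>\<^bsub>M\<^esub> y" using assms by (simp add: rm_add(4))
  thus "x = y" using * assms by simp
qed (use assms in simp)

lemma rm_neg_unique:
  assumes "rm M" "x \<in> carrier M" "y \<in> carrier M" "y \<oplus>\<^bsub>M\<^esub> x = \<zero>\<^bsub>M\<^esub>"
  shows "y = neg M x"
proof -
  have "y = (y \<oplus>\<^bsub>M\<^esub> x) \<oplus>\<^bsub>M\<^esub> neg M x" using assms(1-3) by (simp add: rm_add(4))
  thus ?thesis using assms by simp
qed

lemma rm_a_inv: "rm M \<Longrightarrow> x \<in> carrier M \<Longrightarrow> \<ominus>\<^bsub>M\<^esub> x = neg M x"
  by (meson abelian_group.a_inv_closed abelian_group.l_neg rm_abelian_group rm_neg_unique)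

lemma rmI:
  assumes "\<zero>\<^bsub>M\<^esub> \<in> carrier M"
    and "\<And>x y. x \<in> carrier M \<Longrightarrow> y \<in> carrier M \<Longrightarrow> x \<oplus>\<^bsub>M\<^esub> y \<in> carrier M"
    and "\<And>x. x \<in> carrier M \<Longrightarrow> \<zero>\<^bsub>M\<^esub> \<oplus>\<^bsub>M\<^esub> x = x"
    and "\<And>x y. x \<in> carrier M \<Longrightarrow> y \<in> carrier M \<Longrightarrow> x \<oplus>\<^bsub>M\<^esub> y = y \<oplus>\<^bsub>M\<^esub> x"
    and "\<And>x y z. x \<in> carrier M \<Longrightarrow> y \<in> carrier M \<Longrightarrow> z \<in> carrier M \<Longrightarrow>
      (x \<oplus>\<^bsub>M\<^esub> y) \<oplus>\<^bsub>M\<^esub> z = x \<oplus>\<^bsub>M\<^esub> (y \<oplus>\<^bsub>M\<^esub> z)"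
    and "\<And>x. x \<in> carrier M \<Longrightarrow> \<exists>y\<in>carrier M. y \<oplus>\<^bsub>M\<^esub> x = \<zero>\<^bsub>M\<^esub>"
    and "\<And>a x. a \<in> carrier A \<Longrightarrow> x \<in> carrier M \<Longrightarrow> a \<odot>\<^bsub>M\<^esub> x \<in> carrier M"
    and "\<And>a b x. a \<in> carrier A \<Longrightarrow> b \<in> carrier A \<Longrightarrow> x \<in> carrier M \<Longrightarrow>
      (a \<oplus>\<^bsub>A\<^esub> b) \<odot>\<^bsub>M\<^esub> x = a \<odot>\<^bsub>M\<^esub> x \<oplus>\<^bsub>M\<^esub> b \<odot>\<^bsub>M\<^esub> x"
    and "\<And>a x y. a \<in> carrier A \<Longrightarrow> x \<in> carrier M \<Longrightarrow> y \<in> carrier M \<Longrightarrow>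
      a \<odot>\<^bsub>M\<^esub> (x \<oplus>\<^bsub>M\<^esub> y) = a \<odot>\<^bsub>M\<^esub> x \<oplus>\<^bsub>M\<^esub> a \<odot>\<^bsub>M\<^esub> y"
    and "\<And>a b x. a \<in> carrier A \<Longrightarrow> b \<in> carrier A \<Longrightarrow> x \<in> carrier M \<Longrightarrow>
      (a \<otimes>\<^bsub>A\<^esub> b) \<odot>\<^bsub>M\<^esub> x = b \<odot>\<^bsub>M\<^esub> (a \<odot>\<^bsub>M\<^esub> x)"
    and "\<And>x. x \<in> carrier M \<Longrightarrow> \<one>\<^bsub>A\<^esub> \<odot>\<^bsub>M\<^esub> x = x"
  shows "rm M"
proof -
  have "abelian_group M"
    by (rule abelian_groupI) (use assms in auto)
  thus ?thesis
    unfolding right_module_def right_module_axioms_def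
    using assms A.ring_axioms by auto
qed

section \<open>Homomorphisms\<close>

lemma homI:
  assumes "\<And>x. x \<in> carrier M \<Longrightarrow> f x \<in> carrier N"
    and "\<And>x y. x \<in> carrier M \<Longrightarrow> y \<in> carrier M \<Longrightarrow> f (x \<oplus>\<^bsub>M\<^esub> y) = f x \<oplus>\<^bsub>N\<^esub> f y"
    and "\<And>a x. a \<in> carrier A \<Longrightarrow> x \<in> carrier M \<Longrightarrow> f (a \<odot>\<^bsub>M\<^esub> x) = a \<odot>\<^bsub>N\<^esub> f x"
  shows "f \<in> Hom M N"
  using assms by (auto simp: mod_hom_def)

lemma homD:
  assumes "f \<in> Hom M N" "x \<in> carrier M"
  shows "f x \<in> carrier N"
    and "y \<in> carrier M \<Longrightarrow> f (x \<oplus>\<^bsub>M\<^esub> y) = f x \<oplus>\<^bsub>N\<^esub> f y"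
    and "a \<in> carrier A \<Longrightarrow> f (a \<odot>\<^bsub>M\<^esub> x) = a \<odot>\<^bsub>N\<^esub> f x"
    and "f (neg M x) = neg N (f x)"
  using assms by (auto simp: mod_hom_def neg_def)

lemma hom_zero:
  assumes "f \<in> Hom M N" "rm M" "rm N"
  shows "f \<zero>\<^bsub>M\<^esub> = \<zero>\<^bsub>N\<^esub>"
  using homD(3)[OF assms(1), of "\<zero>\<^bsub>M\<^esub>" "\<zero>\<^bsub>A\<^esub>"] homD(1)[OF assms(1)] assms(2,3) by simp

lemma hom_cong:
  assumes "f \<in> Hom M N" "rm M" "\<And>x. x \<in> carrier M \<Longrightarrow> g x = f x"
  shows "g \<in> Hom M N"
  by (rule homI) (use assms in \<open>auto simp: homD\<close>)

lemma hom_id: "(\<lambda>x. x) \<in> Hom M M"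
  by (rule homI) auto

lemma hom_comp: "f \<in> Hom L M \<Longrightarrow> g \<in> Hom M N \<Longrightarrow> (\<lambda>x. g (f x)) \<in> Hom L N"
  by (auto simp: mod_hom_def Pi_iff)

lemma hom_const_zero: "rm N \<Longrightarrow> (\<lambda>x. \<zero>\<^bsub>N\<^esub>) \<in> Hom M N"
  by (rule homI) auto

lemma hom_add:
  assumes "f \<in> Hom M N" "g \<in> Hom M N" "rm N"
  shows "(\<lambda>x. f x \<oplus>\<^bsub>N\<^esub> g x) \<in> Hom M N"
  by (rule homI) (use assms in \<open>auto simp: homD[OF assms(1)] homD[OF assms(2)] rm_ac rm_smult\<close>)

lemma hom_neg:
  assumes "f \<in> Hom M N" "rm N"
  shows "(\<lambda>x. neg N (f x)) \<in> Hom M N"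
  by (rule homI) (use assms in \<open>auto simp: homD[OF assms(1)] rm_smult_neg\<close>)

lemma hom_sub:
  assumes "f \<in> Hom M N" "g \<in> Hom M N" "rm N"
  shows "(\<lambda>x. f x \<oplus>\<^bsub>N\<^esub> neg N (g x)) \<in> Hom M N"
  using assms hom_add hom_neg by blast

lemma hom_restrict:
  "f \<in> Hom M N \<Longrightarrow> S \<subseteq> carrier M \<Longrightarrow> f \<in> Hom (M\<lparr>carrier := S\<rparr>) N"
  by (auto simp: mod_hom_def subset_iff)

lemma hom_corestrict:
  "f \<in> Hom M N \<Longrightarrow> f ` carrier M \<subseteq> S \<Longrightarrow> f \<in> Hom M (N\<lparr>carrier := S\<rparr>)"
  by (auto simp: mod_hom_def)

lemma hom_uncorestrict:
  "f \<in> Hom M (N\<lparr>carrier := S\<rparr>) \<Longrightarrow> S \<subseteq> carrier N \<Longrightarrow> f \<in> Hom M N"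
  by (auto simp: mod_hom_def Pi_iff)

text \<open>The universal property of a cokernel, stated for any surjection so that no quotient has
  to be formed: the induced map is \<open>f\<close> after a set-theoretic section of
  \<open>p\<close>, and it is linear because \<open>f x\<close> depends on \<open>p x\<close>
  only.\<close>

lemma factor_surj:
  assumes rm: "rm M" "rm N" "rm L" and p: "p \<in> Hom M L" "p ` carrier M = carrier L"
    and f: "f \<in> Hom M N" and ker: "\<And>x. x \<in> carrier M \<Longrightarrow> p x = \<zero>\<^bsub>L\<^esub> \<Longrightarrow> f x = \<zero>\<^bsub>N\<^esub>"
  obtains g where "g \<in> Hom L N" "\<And>x. x \<in> carrier M \<Longrightarrow> g (p x) = f x"
proof -
  define s where "s = inv_into (carrier M) p"
  have s: "s y \<in> carrier M" "p (s y) = y" if "y \<in> carrier L" for y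
    using that p(2) by (auto simp: s_def f_inv_into_f intro!: inv_into_into)
  have eq: "f x = f y" if "x \<in> carrier M" "y \<in> carrier M" "p x = p y" for x y
  proof -
    have "f (x \<oplus>\<^bsub>M\<^esub> neg M y) = \<zero>\<^bsub>N\<^esub>"
      by (rule ker) (use that rm in \<open>auto simp: homD[OF p(1)]\<close>)
    thus ?thesis using that rm by (simp add: homD[OF f])
  qed
  have *: "f (s (p x)) = f x" if "x \<in> carrier M" for x
    using that by (intro eq s) (auto simp: homD[OF p(1)])
  show thesis
  proof
    show "(\<lambda>y. f (s y)) \<in> Hom L N"
    proof (rule homI)
      show "f (s y) \<in> carrier N" if "y \<in> carrier L" for y
        using s that by (simp add: homD[OF f])
      show "f (s (x \<oplus>\<^bsub>L\<^esub> y)) = f (s x) \<oplus>\<^bsub>N\<^esub> f (s y)" if "x \<in> carrier L" "y \<in> carrier L" for x y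
        using *[of "s x \<oplus>\<^bsub>M\<^esub> s y"] s that rm by (simp add: homD[OF f] homD[OF p(1)])
      show "f (s (a \<odot>\<^bsub>L\<^esub> y)) = a \<odot>\<^bsub>N\<^esub> f (s y)" if "a \<in> carrier A" "y \<in> carrier L" for a y
        using *[of "a \<odot>\<^bsub>M\<^esub> s y"] s that rm by (simp add: homD[OF f] homD[OF p(1)])
    qed
  qed (use * in auto)
qed

lemma factor_inj:
  assumes rm: "rm M" "rm N" "rm L" and i: "i \<in> Hom L N" "inj_on i (carrier L)"
    and f: "f \<in> Hom M N" and im: "f ` carrier M \<subseteq> i ` carrier L"
  obtains g where "g \<in> Hom M L" "\<And>x. x \<in> carrier M \<Longrightarrow> i (g x) = f x"
proof -
  define g where "g x = inv_into (carrier L) i (f x)" for x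
  have g: "g x \<in> carrier L" "i (g x) = f x" if "x \<in> carrier M" for x
    using that im by (auto simp: g_def f_inv_into_f image_subset_iff intro: inv_into_into)
  have "g \<in> Hom M L"
  proof (rule homI)
    show "g (x \<oplus>\<^bsub>M\<^esub> y) = g x \<oplus>\<^bsub>L\<^esub> g y" if "x \<in> carrier M" "y \<in> carrier M" for x y
      by (rule inj_onD[OF i(2)]) (use that g rm in \<open>auto simp: homD[OF f] homD[OF i(1)]\<close>)
    show "g (a \<odot>\<^bsub>M\<^esub> x) = a \<odot>\<^bsub>L\<^esub> g x" if "a \<in> carrier A" "x \<in> carrier M" for a x
      by (rule inj_onD[OF i(2)]) (use that g rm in \<open>auto simp: homD[OF f] homD[OF i(1)]\<close>)
  qed (use g in auto)
  thus thesis using g that by blast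
qed

lemma hom_inj_iff:
  assumes "rm M" "rm N" "f \<in> Hom M N"
  shows "inj_on f (carrier M) \<longleftrightarrow> (\<forall>x\<in>carrier M. f x = \<zero>\<^bsub>N\<^esub> \<longrightarrow> x = \<zero>\<^bsub>M\<^esub>)" (is "?L \<longleftrightarrow> ?R")
proof
  show "?L \<Longrightarrow> ?R"
    using hom_zero[OF assms(3,1,2)] rm_closed(1)[OF assms(1)] by (metis inj_onD)
  assume R: ?R
  show ?L
  proof (rule inj_onI)
    fix x y assume "x \<in> carrier M" "y \<in> carrier M" "f x = f y"
    thus "x = y" using R[rule_format, of "x \<oplus>\<^bsub>M\<^esub> neg M y"] assms by (simp add: homD[OF assms(3)])
  qed
qed

lemma mod_iso_inverse:
  assumes "rm M" "rm N" "f \<in> Hom M N" "bij_betw f (carrier M) (carrier N)"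
  obtains g where "g \<in> Hom N M" "\<And>x. x \<in> carrier M \<Longrightarrow> g (f x) = x"
    "\<And>y. y \<in> carrier N \<Longrightarrow> f (g y) = y" "bij_betw g (carrier N) (carrier M)"
proof -
  obtain g where g: "g \<in> Hom N M" "\<And>y. y \<in> carrier N \<Longrightarrow> f (g y) = y"
    using factor_inj[OF assms(2,2,1,3), of "\<lambda>x. x"] assms(4) hom_id
    by (metis bij_betw_def image_ident subset_refl)
  have gf: "g (f x) = x" if "x \<in> carrier M" for x
    using assms(4) g(2)[of "f x"] that homD(1)[OF g(1), of "f x"] homD(1)[OF assms(3)]
    by (metis bij_betw_def inj_onD)
  have "bij_betw g (carrier N) (carrier M)"
    by (rule bij_betw_byWitness[where f' = f])
       (use g gf homD(1)[OF assms(3)] homD(1)[OF g(1)] in auto)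
  thus thesis using that g gf by blast
qed

section \<open>Submodules and quotients\<close>

text \<open>Negatives come for free: the negative of an element is its multiple by -1 in the
  ring.\<close>

lemma submodule_iff:
  assumes "rm M"
  shows "submodule N A M \<longleftrightarrow> N \<subseteq> carrier M \<and> \<zero>\<^bsub>M\<^esub> \<in> N \<and>
    (\<forall>x\<in>N. \<forall>y\<in>N. x \<oplus>\<^bsub>M\<^esub> y \<in> N) \<and> (\<forall>a\<in>carrier A. \<forall>x\<in>N. a \<odot>\<^bsub>M\<^esub> x \<in> N)" (is "_ \<longleftrightarrow> ?R")
proof
  assume "submodule N A M"
  then show ?R
    by (auto simp: submodule_def submodule_axioms_def subgroup_def)
next
  assume R: ?R
  have "\<ominus>\<^bsub>M\<^esub> x \<in> N" if "x \<in> N" for x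
    using R that assms by (subst rm_a_inv) (auto simp: neg_def)
  with R show "submodule N A M"
    by (auto simp: submodule_def submodule_axioms_def subgroup_def a_inv_def)
qed

lemma rm_submodule:
  assumes "rm M" "submodule N A M"
  shows "rm (M\<lparr>carrier := N\<rparr>)"
proof -
  note N = assms(2)[unfolded submodule_iff[OF assms(1)]]
  have sub: "x \<in> carrier M" if "x \<in> N" for x using N that by blast
  show ?thesis
  proof (rule rmI)
    fix x assume "x \<in> carrier (M\<lparr>carrier := N\<rparr>)"
    moreover from this have "neg M x \<in> N" using N by (simp add: neg_def)
    ultimately show "\<exists>y\<in>carrier (M\<lparr>carrier := N\<rparr>). y \<oplus>\<^bsub>M\<lparr>carrier := N\<rparr>\<^esub> x = \<zero>\<^bsub>M\<lparr>carrier := N\<rparr>\<^esub>"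
      using sub assms(1) by (intro bexI[of _ "neg M x"]) auto
  qed (use N sub assms(1) in \<open>auto simp: rm_ac rm_smult\<close>)
qed

lemma a_kernel_eq [simp]: "a_kernel M N f = {x \<in> carrier M. f x = \<zero>\<^bsub>N\<^esub>}"
  by (simp add: a_kernel_def kernel_def)

lemma submodule_kernel:
  assumes "rm M" "rm N" "f \<in> Hom M N"
  shows "submodule {x \<in> carrier M. f x = \<zero>\<^bsub>N\<^esub>} A M"
  using assms by (auto simp: submodule_iff homD[OF assms(3)] hom_zero)

lemma submodule_image:
  assumes "rm M" "rm N" "f \<in> Hom M N" "submodule S A M"
  shows "submodule (f ` S) A N"
proof -
  note S = assms(4)[unfolded submodule_iff[OF assms(1)]]
  have sub: "x \<in> carrier M" if "x \<in> S" for x using S that by blast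
  have "\<zero>\<^bsub>N\<^esub> \<in> f ` S" using S hom_zero[OF assms(3,1,2)] by force
  moreover have "f x \<oplus>\<^bsub>N\<^esub> f y \<in> f ` S" if "x \<in> S" "y \<in> S" for x y
    using that S sub homD(2)[OF assms(3), of x y] by (metis image_eqI)
  moreover have "a \<odot>\<^bsub>N\<^esub> f x \<in> f ` S" if "x \<in> S" "a \<in> carrier A" for x a
    using that S sub homD(3)[OF assms(3), of x a] by (metis image_eqI)
  ultimately show ?thesis
    using sub homD(1)[OF assms(3)] by (auto simp: submodule_iff[OF assms(2)])
qed

lemma submodule_carrier: "rm M \<Longrightarrow> submodule (carrier M) A M"
  by (auto simp: submodule_iff)

lemma submodule_preimage:
  assumes "rm M" "rm N" "f \<in> Hom M N" "submodule S A N"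
  shows "submodule {x \<in> carrier M. f x \<in> S} A M"
  using assms(1) assms(4)[unfolded submodule_iff[OF assms(2)]] hom_zero[OF assms(3,1,2)]
  by (auto simp: submodule_iff homD[OF assms(3)])

abbreviation Ker :: "('a, 'm) module \<Rightarrow> ('a, 'n) module \<Rightarrow> ('m \<Rightarrow> 'n) \<Rightarrow> ('a, 'm) module" where
  "Ker M N f \<equiv> M\<lparr>carrier := {x \<in> carrier M. f x = \<zero>\<^bsub>N\<^esub>}\<rparr>"

lemma rm_Ker: "rm M \<Longrightarrow> rm N \<Longrightarrow> f \<in> Hom M N \<Longrightarrow> rm (Ker M N f)"
  using rm_submodule submodule_kernel by blast

lemma coset_self:
  assumes M: "rm M" and N: "submodule N A M" and x: "x \<in> carrier M"
  shows "x \<in> N +>\<^bsub>M\<^esub> x"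
proof -
  have "\<zero>\<^bsub>M\<^esub> \<oplus>\<^bsub>M\<^esub> x \<in> N +>\<^bsub>M\<^esub> x"
    using N by (auto simp: a_r_coset_def' submodule_iff[OF M])
  then show ?thesis using M x by simp
qed

lemma coset_eq_iff:
  assumes M: "rm M" and N: "submodule N A M" and x: "x \<in> carrier M" and y: "y \<in> carrier M"
  shows "N +>\<^bsub>M\<^esub> x = N +>\<^bsub>M\<^esub> y \<longleftrightarrow> x \<oplus>\<^bsub>M\<^esub> neg M y \<in> N"
proof
  note N' = N[unfolded submodule_iff[OF M]]
  have sub: "z \<in> carrier M" if "z \<in> N" for z using N' that by blast
  {
    assume "N +>\<^bsub>M\<^esub> x = N +>\<^bsub>M\<^esub> y"
    moreover have "x \<in> N +>\<^bsub>M\<^esub> x" by (rule coset_self[OF M N x])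
    ultimately obtain z where "z \<in> N" "x = z \<oplus>\<^bsub>M\<^esub> y" by (auto simp: a_r_coset_def')
    then show "x \<oplus>\<^bsub>M\<^esub> neg M y \<in> N" using M y sub by (simp add: rm_add(4))
  next
    have le: "N +>\<^bsub>M\<^esub> u \<subseteq> N +>\<^bsub>M\<^esub> v"
      if "u \<in> carrier M" "v \<in> carrier M" and d: "u \<oplus>\<^bsub>M\<^esub> neg M v \<in> N" for u v
    proof
      fix w assume "w \<in> N +>\<^bsub>M\<^esub> u"
      then obtain z where z: "z \<in> N" "w = z \<oplus>\<^bsub>M\<^esub> u" by (auto simp: a_r_coset_def')
      have "w = (z \<oplus>\<^bsub>M\<^esub> (u \<oplus>\<^bsub>M\<^esub> neg M v)) \<oplus>\<^bsub>M\<^esub> v"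
        using z that M sub by (simp add: rm_add(4))
      moreover have "z \<oplus>\<^bsub>M\<^esub> (u \<oplus>\<^bsub>M\<^esub> neg M v) \<in> N" using z d N' by blast
      ultimately show "w \<in> N +>\<^bsub>M\<^esub> v" by (auto simp: a_r_coset_def')
    qed
    assume d: "x \<oplus>\<^bsub>M\<^esub> neg M y \<in> N"
    have "neg M (x \<oplus>\<^bsub>M\<^esub> neg M y) \<in> N" using N' d by (auto simp: neg_def)
    also have "neg M (x \<oplus>\<^bsub>M\<^esub> neg M y) = y \<oplus>\<^bsub>M\<^esub> neg M x"
      using M x y by (intro rm_neg_unique[symmetric]) (auto simp: rm_add(4))
    finally show "N +>\<^bsub>M\<^esub> x = N +>\<^bsub>M\<^esub> y" using le d x y by blast
  }
qed

lemma quotient_carrier: "carrier (quotient_module M N) = (\<lambda>x. N +>\<^bsub>M\<^esub> x) ` carrier M"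
  by (auto simp: quotient_module_def A_RCOSETS_def')

lemma quotient_ops:
  assumes M: "rm M" and N: "submodule N A M"
  shows "\<zero>\<^bsub>quotient_module M N\<^esub> = N +>\<^bsub>M\<^esub> \<zero>\<^bsub>M\<^esub>"
    and "x \<in> carrier M \<Longrightarrow> y \<in> carrier M \<Longrightarrow>
      (N +>\<^bsub>M\<^esub> x) \<oplus>\<^bsub>quotient_module M N\<^esub> (N +>\<^bsub>M\<^esub> y) = N +>\<^bsub>M\<^esub> (x \<oplus>\<^bsub>M\<^esub> y)"
    and "a \<in> carrier A \<Longrightarrow> x \<in> carrier M \<Longrightarrow>
      a \<odot>\<^bsub>quotient_module M N\<^esub> (N +>\<^bsub>M\<^esub> x) = N +>\<^bsub>M\<^esub> (a \<odot>\<^bsub>M\<^esub> x)"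
proof -
  note N' = N[unfolded submodule_iff[OF M]]
  have sub: "z \<in> carrier M" if "z \<in> N" for z using N' that by blast
  show "\<zero>\<^bsub>quotient_module M N\<^esub> = N +>\<^bsub>M\<^esub> \<zero>\<^bsub>M\<^esub>"
    using M sub by (auto simp: quotient_module_def a_r_coset_def')
  show "(N +>\<^bsub>M\<^esub> x) \<oplus>\<^bsub>quotient_module M N\<^esub> (N +>\<^bsub>M\<^esub> y) = N +>\<^bsub>M\<^esub> (x \<oplus>\<^bsub>M\<^esub> y)"
    if "x \<in> carrier M" "y \<in> carrier M"
  proof (intro equalityI subsetI)
    fix w assume "w \<in> (N +>\<^bsub>M\<^esub> x) \<oplus>\<^bsub>quotient_module M N\<^esub> (N +>\<^bsub>M\<^esub> y)"
    then obtain u v where uv: "u \<in> N" "v \<in> N" "w = (u \<oplus>\<^bsub>M\<^esub> x) \<oplus>\<^bsub>M\<^esub> (v \<oplus>\<^bsub>M\<^esub> y)"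
      by (auto simp: quotient_module_def a_r_coset_def' set_add_def')
    have "w = (u \<oplus>\<^bsub>M\<^esub> v) \<oplus>\<^bsub>M\<^esub> (x \<oplus>\<^bsub>M\<^esub> y)"
      using uv sub M that by (simp add: rm_ac)
    moreover have "u \<oplus>\<^bsub>M\<^esub> v \<in> N" using uv N' by blast
    ultimately show "w \<in> N +>\<^bsub>M\<^esub> (x \<oplus>\<^bsub>M\<^esub> y)" by (auto simp: a_r_coset_def')
  next
    fix w assume "w \<in> N +>\<^bsub>M\<^esub> (x \<oplus>\<^bsub>M\<^esub> y)"
    then obtain u where u: "u \<in> N" "w = u \<oplus>\<^bsub>M\<^esub> (x \<oplus>\<^bsub>M\<^esub> y)" by (auto simp: a_r_coset_def')
    have "w = (u \<oplus>\<^bsub>M\<^esub> x) \<oplus>\<^bsub>M\<^esub> (\<zero>\<^bsub>M\<^esub> \<oplus>\<^bsub>M\<^esub> y)" using u M that sub by (simp add: rm_add(4))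
    thus "w \<in> (N +>\<^bsub>M\<^esub> x) \<oplus>\<^bsub>quotient_module M N\<^esub> (N +>\<^bsub>M\<^esub> y)"
      using u N' by (auto simp: quotient_module_def a_r_coset_def' set_add_def')
  qed
  show "a \<odot>\<^bsub>quotient_module M N\<^esub> (N +>\<^bsub>M\<^esub> x) = N +>\<^bsub>M\<^esub> (a \<odot>\<^bsub>M\<^esub> x)"
    if a: "a \<in> carrier A" and x: "x \<in> carrier M"
  proof -
    have "N +>\<^bsub>M\<^esub> (a \<odot>\<^bsub>M\<^esub> y) = N +>\<^bsub>M\<^esub> (a \<odot>\<^bsub>M\<^esub> x)" if y: "y \<in> N +>\<^bsub>M\<^esub> x" for y
    proof -
      obtain u where u: "u \<in> N" "y = u \<oplus>\<^bsub>M\<^esub> x" using y by (auto simp: a_r_coset_def')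
      have yM: "y \<in> carrier M" using sub[OF u(1)] u(2) M x by simp
      have "a \<odot>\<^bsub>M\<^esub> y \<oplus>\<^bsub>M\<^esub> neg M (a \<odot>\<^bsub>M\<^esub> x) = a \<odot>\<^bsub>M\<^esub> u"
        using sub[OF u(1)] u(2) M x a by (simp add: rm_smult rm_add(4))
      moreover have "a \<odot>\<^bsub>M\<^esub> u \<in> N" using N' u a by blast
      ultimately have "a \<odot>\<^bsub>M\<^esub> y \<oplus>\<^bsub>M\<^esub> neg M (a \<odot>\<^bsub>M\<^esub> x) \<in> N" by (simp only:)
      then show ?thesis
        using coset_eq_iff[OF M N, THEN iffD2] rm_closed(3)[OF M a] yM x by blast
    qed
    with coset_self[OF M N x] have "(\<Union>y\<in>N +>\<^bsub>M\<^esub> x. N +>\<^bsub>M\<^esub> (a \<odot>\<^bsub>M\<^esub> y)) = N +>\<^bsub>M\<^esub> (a \<odot>\<^bsub>M\<^esub> x)"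
      by (intro SUP_eq_const) blast+
    then show ?thesis by (simp add: quotient_module_def)
  qed
qed

lemma quotient_module:
  assumes M: "rm M" and N: "submodule N A M"
  shows rm_quotient: "rm (quotient_module M N)"
    and hom_quotient: "(\<lambda>x. N +>\<^bsub>M\<^esub> x) \<in> Hom M (quotient_module M N)"
    and quotient_eq_zero_iff:
      "x \<in> carrier M \<Longrightarrow> N +>\<^bsub>M\<^esub> x = \<zero>\<^bsub>quotient_module M N\<^esub> \<longleftrightarrow> x \<in> N"
proof -
  show "rm (quotient_module M N)"
  proof (rule rmI)
    fix x assume "x \<in> carrier (quotient_module M N)"
    then obtain y where y: "y \<in> carrier M" "x = N +>\<^bsub>M\<^esub> y" by (auto simp: quotient_carrier)
    then show "\<exists>z\<in>carrier (quotient_module M N).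
        z \<oplus>\<^bsub>quotient_module M N\<^esub> x = \<zero>\<^bsub>quotient_module M N\<^esub>"
      using M by (intro bexI[of _ "N +>\<^bsub>M\<^esub> neg M y"])
        (auto simp: quotient_ops[OF M N] quotient_carrier)
  qed (use M in \<open>auto simp: quotient_carrier quotient_ops[OF M N] rm_ac rm_smult\<close>)
  show "(\<lambda>x. N +>\<^bsub>M\<^esub> x) \<in> Hom M (quotient_module M N)"
    by (rule homI) (auto simp: quotient_carrier quotient_ops[OF M N])
  show "N +>\<^bsub>M\<^esub> x = \<zero>\<^bsub>quotient_module M N\<^esub> \<longleftrightarrow> x \<in> N" if "x \<in> carrier M"
    using that M by (simp add: quotient_ops[OF M N] coset_eq_iff[OF M N])
qed

section \<open>Direct sums and powers\<close>

lemma direct_sum_simps [simp]: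
  "carrier (direct_sum M N) = carrier M \<times> carrier N"
  "\<zero>\<^bsub>direct_sum M N\<^esub> = (\<zero>\<^bsub>M\<^esub>, \<zero>\<^bsub>N\<^esub>)"
  "u \<oplus>\<^bsub>direct_sum M N\<^esub> v = (fst u \<oplus>\<^bsub>M\<^esub> fst v, snd u \<oplus>\<^bsub>N\<^esub> snd v)"
  "a \<odot>\<^bsub>direct_sum M N\<^esub> u = (a \<odot>\<^bsub>M\<^esub> fst u, a \<odot>\<^bsub>N\<^esub> snd u)"
  by (auto simp: direct_sum_def case_prod_beta)

lemma neg_direct_sum [simp]: "neg (direct_sum M N) u = (neg M (fst u), neg N (snd u))"
  by (simp add: neg_def)

lemma rm_direct_sum:
  assumes "rm M" "rm N"
  shows "rm (direct_sum M N)"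
proof (rule rmI)
  fix x assume x: "x \<in> carrier (direct_sum M N)"
  then show "\<exists>y\<in>carrier (direct_sum M N). y \<oplus>\<^bsub>direct_sum M N\<^esub> x = \<zero>\<^bsub>direct_sum M N\<^esub>"
    using assms by (intro bexI[of _ "neg (direct_sum M N) x"]) auto
qed (use assms in \<open>auto simp: rm_ac rm_smult\<close>)

lemma hom_direct_sum:
  shows hom_fst: "fst \<in> Hom (direct_sum M N) M"
    and hom_snd: "snd \<in> Hom (direct_sum M N) N"
    and hom_inl: "rm N \<Longrightarrow> (\<lambda>x. (x, \<zero>\<^bsub>N\<^esub>)) \<in> Hom M (direct_sum M N)"
    and hom_inr: "rm M \<Longrightarrow> (\<lambda>x. (\<zero>\<^bsub>M\<^esub>, x)) \<in> Hom N (direct_sum M N)"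
    and hom_pair: "f \<in> Hom L M \<Longrightarrow> g \<in> Hom L N \<Longrightarrow> (\<lambda>x. (f x, g x)) \<in> Hom L (direct_sum M N)"
  by (auto simp: mod_hom_def Pi_iff)

lemma power_simps [simp]:
  "carrier (power_module M k) = {..<k} \<rightarrow>\<^sub>E carrier M"
  "\<zero>\<^bsub>power_module M k\<^esub> = (\<lambda>i\<in>{..<k}. \<zero>\<^bsub>M\<^esub>)"
  "u \<oplus>\<^bsub>power_module M k\<^esub> v = (\<lambda>i\<in>{..<k}. u i \<oplus>\<^bsub>M\<^esub> v i)"
  "a \<odot>\<^bsub>power_module M k\<^esub> u = (\<lambda>i\<in>{..<k}. a \<odot>\<^bsub>M\<^esub> u i)"
  by (auto simp: power_module_def)

lemma rm_power:
  assumes M: "rm M"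
  shows "rm (power_module M k)"
proof (rule rmI)
  fix x assume x: "x \<in> carrier (power_module M k)"
  then show "\<exists>y\<in>carrier (power_module M k). y \<oplus>\<^bsub>power_module M k\<^esub> x = \<zero>\<^bsub>power_module M k\<^esub>"
    using M by (intro bexI[of _ "\<lambda>i\<in>{..<k}. neg M (x i)"]) (auto simp: PiE_iff fun_eq_iff)
qed (use M in \<open>auto simp: PiE_iff fun_eq_iff rm_ac rm_smult extensional_def\<close>)

lemma hom_power_component: "i < k \<Longrightarrow> (\<lambda>x. x i) \<in> Hom (power_module M k) M"
  by (rule homI) (auto simp: PiE_iff)

lemma hom_power_restrict:
  "k \<le> l \<Longrightarrow> (\<lambda>x. restrict x {..<k}) \<in> Hom (power_module M l) (power_module M k)"
  by (rule homI) (auto simp: PiE_iff fun_eq_iff)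

lemma hom_power_extend:
  assumes "f \<in> Hom L (power_module M k)" "g \<in> Hom L M"
  shows "(\<lambda>x. (f x)(k := g x)) \<in> Hom L (power_module M (Suc k))"
proof (rule homI)
  fix x assume x: "x \<in> carrier L"
  then show "(f x)(k := g x) \<in> carrier (power_module M (Suc k))"
    using homD(1)[OF assms(1) x] homD(1)[OF assms(2) x]
    by (auto simp: PiE_iff extensional_def less_Suc_eq)
qed (auto simp: homD[OF assms(1)] homD[OF assms(2)] fun_eq_iff less_Suc_eq)

section \<open>The regular module\<close>

lemma regular_simps [simp]:
  "carrier reg = carrier A" "\<zero>\<^bsub>reg\<^esub> = \<zero>\<^bsub>A\<^esub>" "x \<oplus>\<^bsub>reg\<^esub> y = x \<oplus>\<^bsub>A\<^esub> y" "a \<odot>\<^bsub>reg\<^esub> x = x \<otimes>\<^bsub>A\<^esub> a"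
  by (auto simp: regular_module_def)

lemma rm_regular: "rm reg"
proof (rule rmI)
  fix x assume "x \<in> carrier reg"
  then show "\<exists>y\<in>carrier reg. y \<oplus>\<^bsub>reg\<^esub> x = \<zero>\<^bsub>reg\<^esub>"
    by (intro bexI[of _ "\<ominus>\<^bsub>A\<^esub> x"]) (auto simp: A.l_neg)
qed (auto simp: A.a_ac A.l_distr A.r_distr A.m_assoc)

lemma hom_regular:
  assumes "rm M" "m \<in> carrier M"
  shows "(\<lambda>a. a \<odot>\<^bsub>M\<^esub> m) \<in> Hom reg M"
  by (rule homI) (use assms in \<open>auto simp: rm_smult\<close>)

lemma hom_regular_eq:
  assumes "f \<in> Hom reg M" "a \<in> carrier A"
  shows "f a = a \<odot>\<^bsub>M\<^esub> f \<one>\<^bsub>A\<^esub>"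
  using homD(3)[OF assms(1), of "\<one>\<^bsub>A\<^esub>" a] assms(2) by simp

section \<open>Homomorphisms that factor through powers of a module\<close>

text \<open>\<open>thru Q M N h\<close> says that \<open>h : M \<rightarrow> N\<close> is a finite sum of maps \<open>M \<rightarrow> Q \<rightarrow> N\<close>, i.e. that it factors
  through some \<open>Q\<^sup>k\<close>.  With \<open>h = id\<close> this is membership in \<open>add Q\<close>, without the need to handle
  complements.\<close>

inductive thru ::
    "('a, 'q) module \<Rightarrow> ('a, 'm) module \<Rightarrow> ('a, 'n) module \<Rightarrow> ('m \<Rightarrow> 'n) \<Rightarrow> bool"
  for Q M N where
  thru_zero: "thru Q M N (\<lambda>_. \<zero>\<^bsub>N\<^esub>)"
| thru_step: "thru Q M N h \<Longrightarrow> f \<in> Hom M Q \<Longrightarrow> g \<in> Hom Q N \<Longrightarrow> thru Q M N (\<lambda>x. h x \<oplus>\<^bsub>N\<^esub> g (f x))"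
| thru_cong: "thru Q M N h \<Longrightarrow> (\<And>x. x \<in> carrier M \<Longrightarrow> h' x = h x) \<Longrightarrow> thru Q M N h'"

lemma thru_hom:
  assumes "thru Q M N h" "rm M" "rm N"
  shows "h \<in> Hom M N"
  using assms(1)
proof induction
  case thru_zero
  show ?case by (rule hom_const_zero) fact
next
  case (thru_step h f g)
  then show ?case by (intro hom_add hom_comp[of f M Q g]) (use assms in auto)
next
  case (thru_cong h h')
  then show ?case using hom_cong assms by blast
qed

lemma thru_add:
  assumes "thru Q M N h'" "thru Q M N h" "rm M" "rm N"
  shows "thru Q M N (\<lambda>x. h x \<oplus>\<^bsub>N\<^esub> h' x)"
  using assms(1)
proof induction
  case thru_zero
  show ?case using assms(2)
    by (rule thru.thru_cong) (use assms homD(1)[OF thru_hom[OF assms(2-4)]] in simp)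
next
  case (thru_step h' f g)
  have "thru Q M N (\<lambda>x. (h x \<oplus>\<^bsub>N\<^esub> h' x) \<oplus>\<^bsub>N\<^esub> g (f x))"
    by (rule thru.thru_step) (use thru_step in auto)
  then show ?case
  proof (rule thru.thru_cong)
    fix x assume "x \<in> carrier M"
    then show "h x \<oplus>\<^bsub>N\<^esub> (h' x \<oplus>\<^bsub>N\<^esub> g (f x)) = h x \<oplus>\<^bsub>N\<^esub> h' x \<oplus>\<^bsub>N\<^esub> g (f x)"
      using thru_step(1-3) homD(1)[OF thru_hom[OF assms(2-4)]]
        homD(1)[OF thru_hom[OF thru_step(1) assms(3,4)]] homD(1)[OF hom_comp[OF thru_step(2,3)]]
        assms(4) by (simp add: rm_add(4))
  qed
next
  case (thru_cong h1 h2)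
  show ?case using thru_cong(3) by (rule thru.thru_cong) (simp add: thru_cong(2))
qed

lemma thru_comp_left:
  assumes "thru Q M N h" "k \<in> Hom N L" "rm M" "rm N" "rm L"
  shows "thru Q M L (\<lambda>x. k (h x))"
  using assms(1)
proof induction
  case thru_zero
  show ?case by (rule thru.thru_cong[OF thru.thru_zero]) (use assms in \<open>simp add: hom_zero\<close>)
next
  case (thru_step h f g)
  have "thru Q M L (\<lambda>x. k (h x) \<oplus>\<^bsub>L\<^esub> k (g (f x)))"
    using thru_step hom_comp[OF thru_step(3) assms(2)] by (intro thru.thru_step) auto
  then show ?case
  proof (rule thru.thru_cong)
    fix x assume "x \<in> carrier M"
    then show "k (h x \<oplus>\<^bsub>N\<^esub> g (f x)) = k (h x) \<oplus>\<^bsub>L\<^esub> k (g (f x))"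
      using homD(1)[OF thru_hom[OF thru_step(1) assms(3,4)]] homD(1)[OF hom_comp[OF thru_step(2,3)]]
      by (simp add: homD(2)[OF assms(2)])
  qed
next
  case (thru_cong h h')
  show ?case using thru_cong(3) by (rule thru.thru_cong) (simp add: thru_cong(2))
qed

lemma thru_comp_right:
  assumes "thru Q M N h" "k \<in> Hom L M"
  shows "thru Q L N (\<lambda>x. h (k x))"
  using assms(1)
proof induction
  case thru_zero
  show ?case by (rule thru.thru_zero)
next
  case (thru_step h f g)
  then show ?case using hom_comp[OF assms(2) thru_step(2)] by (intro thru.thru_step) auto
next
  case (thru_cong h h')
  show ?case using thru_cong(3)
    by (rule thru.thru_cong) (use homD(1)[OF assms(2)] thru_cong(2) in simp)
qed

lemma thru_comp:
  assumes "f \<in> Hom M Q" "g \<in> Hom Q N" "rm N"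
  shows "thru Q M N (\<lambda>x. g (f x))"
proof -
  have "thru Q M N (\<lambda>x. \<zero>\<^bsub>N\<^esub> \<oplus>\<^bsub>N\<^esub> g (f x))"
    using assms by (intro thru.intros)
  then show ?thesis
    by (rule thru.thru_cong) (use homD(1)[OF hom_comp[OF assms(1,2)]] assms(3) in simp)
qed

lemma thru_self: "rm Q \<Longrightarrow> thru Q Q Q (\<lambda>x. x)"
  by (rule thru_comp[OF hom_id hom_id])

text \<open>Each summand M -> Q -> N is subdivided by the decomposition of the identity of
  \<open>Q\<close> into maps through \<open>T\<close>.\<close>

lemma thru_trans:
  assumes "thru T Q Q (\<lambda>x. x)" "thru Q M N h" "rm Q" "rm M" "rm N"
  shows "thru T M N h"
  using assms(2)
proof induction
  case thru_zero
  show ?case by (rule thru.thru_zero)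
next
  case (thru_step h f g)
  have "thru T M N (\<lambda>x. g (f x))"
    using thru_comp_left[OF thru_comp_right[OF assms(1) thru_step(2)] thru_step(3)] assms by simp
  then show ?case using thru_step thru_add assms by blast
next
  case (thru_cong h h')
  show ?case using thru_cong(3) by (rule thru.thru_cong) (simp add: thru_cong(2))
qed

lemma hom_power_split:
  assumes "g \<in> Hom (power_module Q k) N" "b \<in> Hom Q N" "rm N"
  shows "(\<lambda>x. g (restrict x {..<k}) \<oplus>\<^bsub>N\<^esub> b (x k)) \<in> Hom (power_module Q (Suc k)) N"
  by (intro hom_add hom_comp[OF hom_power_restrict assms(1)] hom_comp[OF hom_power_component assms(2)])
     (use assms in auto)

lemma thru_power:
  assumes "thru Q M N h" "rm Q" "rm M" "rm N"
  obtains k f g where "f \<in> Hom M (power_module Q k)" "g \<in> Hom (power_module Q k) N"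
    "\<And>x. x \<in> carrier M \<Longrightarrow> g (f x) = h x"
proof -
  have "\<exists>k f g. f \<in> Hom M (power_module Q k) \<and> g \<in> Hom (power_module Q k) N \<and>
    (\<forall>x\<in>carrier M. g (f x) = h x)"
    using assms(1)
  proof induction
    case thru_zero
    show ?case
      by (rule exI[of _ 0], rule exI[of _ "\<lambda>_. \<zero>\<^bsub>power_module Q 0\<^esub>"], rule exI[of _ "\<lambda>_. \<zero>\<^bsub>N\<^esub>"])
         (use assms in \<open>auto intro!: hom_const_zero rm_power simp del: power_simps\<close>)
  next
    case (thru_step h a b)
    then obtain k f g where fg: "f \<in> Hom M (power_module Q k)" "g \<in> Hom (power_module Q k) N"
      "\<And>x. x \<in> carrier M \<Longrightarrow> g (f x) = h x" by auto
    have r: "restrict (f x) {..<k} = f x" if "x \<in> carrier M" for x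
      using homD(1)[OF fg(1) that] by (auto simp: PiE_iff fun_eq_iff extensional_def)
    have "(\<lambda>x. (f x)(k := a x)) \<in> Hom M (power_module Q (Suc k))"
      by (rule hom_power_extend[OF fg(1) thru_step(2)])
    moreover have "(\<lambda>x. g (restrict x {..<k}) \<oplus>\<^bsub>N\<^esub> b (x k)) \<in> Hom (power_module Q (Suc k)) N"
      by (rule hom_power_split[OF fg(2) thru_step(3) assms(4)])
    moreover have "\<forall>x\<in>carrier M. g (restrict ((f x)(k := a x)) {..<k}) \<oplus>\<^bsub>N\<^esub> b (((f x)(k := a x)) k)
        = h x \<oplus>\<^bsub>N\<^esub> b (a x)"
      by (simp add: r fg(3))
    ultimately show ?case by blast
  next
    case (thru_cong h h')
    then show ?case by auto
  qed
  then show thesis using that by blast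
qed

text \<open>The spare last coordinate makes the cokernel of \<open>f\<close> nonzero whenever \<open>Q\<close> is.\<close>

lemma thru_power_spare:
  assumes "thru Q M N h" "rm Q" "rm M" "rm N"
  obtains k f g where "f \<in> Hom M (power_module Q (Suc k))" "g \<in> Hom (power_module Q (Suc k)) N"
    "\<And>x. x \<in> carrier M \<Longrightarrow> g (f x) = h x" "\<And>x. x \<in> carrier M \<Longrightarrow> f x k = \<zero>\<^bsub>Q\<^esub>"
proof -
  obtain k f g where fg: "f \<in> Hom M (power_module Q k)" "g \<in> Hom (power_module Q k) N"
    "\<And>x. x \<in> carrier M \<Longrightarrow> g (f x) = h x" by (rule thru_power[OF assms]) (rule that)
  have r: "restrict (f x) {..<k} = f x" if "x \<in> carrier M" for x
    using homD(1)[OF fg(1) that] by (auto simp: PiE_iff fun_eq_iff extensional_def)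
  show thesis
  proof (rule that)
    show "(\<lambda>x. (f x)(k := \<zero>\<^bsub>Q\<^esub>)) \<in> Hom M (power_module Q (Suc k))"
      by (intro hom_power_extend fg hom_const_zero assms)
    show "(\<lambda>x. g (restrict x {..<k})) \<in> Hom (power_module Q (Suc k)) N"
      by (rule hom_comp[OF hom_power_restrict fg(2)]) simp
  qed (simp_all add: fg(3) r)
qed

lemma thru_power_id:
  assumes Q: "rm Q"
  shows "thru Q (power_module Q k) (power_module Q k) (\<lambda>x. x)"
proof -
  let ?P = "power_module Q k"
  \<comment> \<open>The sum of the first \<open>j\<close> coordinate idempotents; at
    \<open>j = k\<close> it is the identity.\<close>
  have "thru Q ?P ?P (\<lambda>x. \<lambda>i\<in>{..<k}. if i < j then x i else \<zero>\<^bsub>Q\<^esub>)" if "j \<le> k" for j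
    using that
  proof (induction j)
    case 0
    show ?case by (rule thru.thru_cong[OF thru.thru_zero]) (simp add: restrict_def)
  next
    case (Suc j)
    have ins: "(\<lambda>q. \<lambda>i\<in>{..<k}. if i = j then q else \<zero>\<^bsub>Q\<^esub>) \<in> Hom Q ?P"
      by (rule homI) (use Q in \<open>simp_all add: restrict_def fun_eq_iff PiE_iff extensional_def\<close>)
    have "thru Q ?P ?P (\<lambda>x. (\<lambda>i\<in>{..<k}. if i < j then x i else \<zero>\<^bsub>Q\<^esub>) \<oplus>\<^bsub>?P\<^esub>
        (\<lambda>i\<in>{..<k}. if i = j then x j else \<zero>\<^bsub>Q\<^esub>))"
      by (rule thru.thru_step[OF Suc.IH hom_power_component ins]) (use Suc.prems in simp_all)
    then show ?case
      by (rule thru.thru_cong)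
        (use Q in \<open>auto simp: restrict_def fun_eq_iff PiE_iff less_Suc_eq\<close>)
  qed
  from this[of k] show ?thesis
    by (rule thru.thru_cong) (auto simp: fun_eq_iff PiE_iff extensional_def)
qed

section \<open>Finite generation\<close>

text \<open>Generation is relative to a subset \<open>B\<close>, so that it can be pushed along maps
  that are not onto and added up summand by summand.\<close>

definition spans :: "('a, 'm) module \<Rightarrow> 'm set \<Rightarrow> 'm set \<Rightarrow> bool" where
  "spans M S B \<longleftrightarrow> finite S \<and> S \<subseteq> carrier M \<and> (\<forall>N. submodule N A M \<and> S \<subseteq> N \<longrightarrow> B \<subseteq> N)"

lemma fin_gen_iff:
  assumes "rm M"
  shows "fin_gen A M \<longleftrightarrow> (\<exists>S. spans M S (carrier M))"
proof -
  have "N = carrier M \<longleftrightarrow> carrier M \<subseteq> N" if "submodule N A M" for N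
    using that submodule_iff[OF assms, of N] by blast
  then have "(\<forall>N. submodule N A M \<and> S \<subseteq> N \<longrightarrow> N = carrier M) \<longleftrightarrow>
      (\<forall>N. submodule N A M \<and> S \<subseteq> N \<longrightarrow> carrier M \<subseteq> N)" for S
    by meson
  then show ?thesis unfolding fin_gen_def spans_def by (rule ex_cong1[OF conj_cong[OF refl conj_cong[OF refl]]])
qed

lemma spans_image:
  assumes "rm M" "rm N" "f \<in> Hom M N" "spans M S B" "B \<subseteq> carrier M"
  shows "spans N (f ` S) (f ` B)"
  unfolding spans_def
proof (intro conjI allI impI)
  show "finite (f ` S)" "f ` S \<subseteq> carrier N"
    using assms(4) homD(1)[OF assms(3)] by (auto simp: spans_def)
  fix L assume L: "submodule L A N \<and> f ` S \<subseteq> L"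
  then have "S \<subseteq> {x \<in> carrier M. f x \<in> L}" using assms(4) by (auto simp: spans_def)
  then have "B \<subseteq> {x \<in> carrier M. f x \<in> L}"
    using assms(4) submodule_preimage[OF assms(1-3)] L unfolding spans_def by blast
  then show "f ` B \<subseteq> L" by blast
qed

lemma spans_add:
  assumes "rm M" "spans M S B" "spans M S' B'"
    and "\<And>z. z \<in> C \<Longrightarrow> \<exists>x\<in>B. \<exists>y\<in>B'. z = x \<oplus>\<^bsub>M\<^esub> y"
  shows "spans M (S \<union> S') C"
  unfolding spans_def
proof (intro conjI allI impI)
  show "finite (S \<union> S')" "S \<union> S' \<subseteq> carrier M" using assms(2,3) by (auto simp: spans_def)
  fix N assume N: "submodule N A M \<and> S \<union> S' \<subseteq> N"
  then have "B \<subseteq> N" "B' \<subseteq> N" using assms(2,3) unfolding spans_def by blast+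
  moreover have "\<forall>x\<in>N. \<forall>y\<in>N. x \<oplus>\<^bsub>M\<^esub> y \<in> N" using N submodule_iff[OF assms(1)] by blast
  ultimately show "C \<subseteq> N" using assms(4) by blast
qed

lemma fg_moduleD: "fg_module A M \<Longrightarrow> rm M"
  by (simp add: fg_module_def)

text \<open>Every summand takes its values in the image of \<open>Q\<close>, which is generated by
  the images of finitely many generators of \<open>Q\<close>. The submodule generated in the end may
  be larger than the image of \<open>h\<close>.\<close>

lemma thru_spans:
  assumes "thru Q M N h" "fg_module A Q" "rm M" "rm N"
  shows "\<exists>S. spans N S (h ` carrier M)"
  using assms(1)
proof induction
  case thru_zero
  have "spans N {} ((\<lambda>_. \<zero>\<^bsub>N\<^esub>) ` carrier M)"
    using submodule_iff[OF assms(4)] by (auto simp: spans_def)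
  then show ?case by blast
next
  case (thru_step h f g)
  obtain S where S: "spans N S (h ` carrier M)" using thru_step by blast
  obtain S' where "spans Q S' (carrier Q)"
    using assms(2) fin_gen_iff[of Q] unfolding fg_module_def by blast
  then have "spans N (g ` S') (g ` carrier Q)"
    using spans_image[of Q N g] thru_step(3) assms(2,4) fg_moduleD by blast
  with S have "spans N (S \<union> g ` S') ((\<lambda>x. h x \<oplus>\<^bsub>N\<^esub> g (f x)) ` carrier M)"
    using homD(1)[OF thru_step(2)] by (intro spans_add[OF assms(4)]) auto
  then show ?case by blast
next
  case (thru_cong h h')
  have "h' ` carrier M = h ` carrier M" by (rule image_cong[OF refl thru_cong(2)])
  with thru_cong(3) show ?case by simp
qed

lemma fg_thru:
  assumes "fg_module A Q" "thru Q M N h" "rm M" "rm N" "h ` carrier M = carrier N"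
  shows "fg_module A N"
  using thru_spans[OF assms(2,1,3,4)] assms(4,5) fin_gen_iff[OF assms(4)] by (simp add: fg_module_def)

lemma fg_surj:
  assumes "fg_module A M" "f \<in> Hom M N" "rm N" "f ` carrier M = carrier N"
  shows "fg_module A N"
  by (rule fg_thru[OF assms(1) thru_comp[OF hom_id assms(2,3)] fg_moduleD[OF assms(1)] assms(3,4)])

lemma fg_direct_sum:
  assumes "fg_module A M" "fg_module A N"
  shows "fg_module A (direct_sum M N)"
proof -
  note rm = assms[THEN fg_moduleD]
  let ?D = "direct_sum M N"
  obtain S S' where S: "spans M S (carrier M)" "spans N S' (carrier N)"
    using assms fin_gen_iff[OF rm(1)] fin_gen_iff[OF rm(2)] unfolding fg_module_def by blast
  have 1: "spans ?D ((\<lambda>x. (x, \<zero>\<^bsub>N\<^esub>)) ` S) ((\<lambda>x. (x, \<zero>\<^bsub>N\<^esub>)) ` carrier M)"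
    using spans_image[OF rm(1) rm_direct_sum[OF rm] hom_inl[OF rm(2)] S(1)] by simp
  have 2: "spans ?D ((\<lambda>x. (\<zero>\<^bsub>M\<^esub>, x)) ` S') ((\<lambda>x. (\<zero>\<^bsub>M\<^esub>, x)) ` carrier N)"
    using spans_image[OF rm(2) rm_direct_sum[OF rm] hom_inr[OF rm(1)] S(2)] by simp
  have "\<exists>S. spans ?D S (carrier ?D)"
    by (rule exI, rule spans_add[OF rm_direct_sum[OF rm] 1 2]) (use rm in auto)
  then show ?thesis
    using fin_gen_iff[OF rm_direct_sum[OF rm]] rm_direct_sum[OF rm] by (simp add: fg_module_def)
qed

lemma fg_regular: "fg_module A reg"
proof -
  have "carrier reg \<subseteq> N" if "submodule N A reg" "\<one>\<^bsub>A\<^esub> \<in> N" for N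
  proof
    fix a assume a: "a \<in> carrier reg"
    then have "a \<odot>\<^bsub>reg\<^esub> \<one>\<^bsub>A\<^esub> \<in> N"
      using that submodule_iff[OF rm_regular] by (auto simp del: regular_simps(4))
    then show "a \<in> N" using a by simp
  qed
  then have "spans reg {\<one>\<^bsub>A\<^esub>} (carrier reg)" by (auto simp: spans_def)
  then show ?thesis using fin_gen_iff[OF rm_regular] rm_regular unfolding fg_module_def by blast
qed

lemma fg_power: "fg_module A Q \<Longrightarrow> fg_module A (power_module Q k)"
  by (rule fg_thru[OF _ thru_power_id]) (auto intro: rm_power fg_moduleD simp del: power_simps)

lemma fg_free_cover:
  assumes "fg_module A M"
  obtains k e where "e \<in> Hom (power_module reg k) M" "e ` carrier (power_module reg k) = carrier M"
proof -
  have rm: "rm M" using assms fg_moduleD by blast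
  have *: "\<exists>k. \<exists>e\<in>Hom (power_module reg k) M. S \<subseteq> e ` carrier (power_module reg k)"
    if "finite S" "S \<subseteq> carrier M" for S
    using that
  proof (induction S)
    case empty
    show ?case using hom_const_zero[OF rm] by blast
  next
    case (insert s S)
    then obtain k e where e: "e \<in> Hom (power_module reg k) M"
      "S \<subseteq> e ` carrier (power_module reg k)" by auto
    let ?P = "power_module reg (Suc k)"
    \<comment> \<open>The new coordinate multiplies the new generator \<open>s\<close>; the old
      coordinates keep the map for \<open>S\<close>.\<close>
    define e' where "e' = (\<lambda>x. e (restrict x {..<k}) \<oplus>\<^bsub>M\<^esub> x k \<odot>\<^bsub>M\<^esub> s)"
    have s: "s \<in> carrier M" using insert by simp
    have e': "e' \<in> Hom ?P M"
      unfolding e'_def by (rule hom_power_split[OF e(1) hom_regular[OF rm s] rm])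
    have "t \<in> e' ` carrier ?P" if t: "t \<in> S" for t
    proof -
      obtain u where u: "u \<in> carrier (power_module reg k)" "t = e u" using e(2) t by blast
      have "restrict (u(k := \<zero>\<^bsub>A\<^esub>)) {..<k} = u"
        using u(1) by (auto simp: fun_eq_iff PiE_iff extensional_def)
      then have "e' (u(k := \<zero>\<^bsub>A\<^esub>)) = t"
        using u(2) s rm homD(1)[OF e(1) u(1)] by (simp add: e'_def)
      moreover have "u(k := \<zero>\<^bsub>A\<^esub>) \<in> carrier ?P"
        using u(1) by (auto simp: PiE_iff extensional_def less_Suc_eq)
      ultimately show ?thesis by force
    qed
    moreover have "s \<in> e' ` carrier ?P"
    proof -
      let ?z = "\<zero>\<^bsub>power_module reg k\<^esub>"
      have z: "e ?z = \<zero>\<^bsub>M\<^esub>" using hom_zero[OF e(1) rm_power[OF rm_regular] rm] .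
      have "restrict (?z(k := \<one>\<^bsub>A\<^esub>)) {..<k} = ?z"
        by (auto simp: fun_eq_iff)
      then have "e' (?z(k := \<one>\<^bsub>A\<^esub>)) = s" using z s rm by (simp add: e'_def del: power_simps)
      moreover have "?z(k := \<one>\<^bsub>A\<^esub>) \<in> carrier ?P"
        by (auto simp: PiE_iff extensional_def less_Suc_eq)
      ultimately show ?thesis by (metis image_eqI)
    qed
    ultimately show ?case using e' by blast
  qed
  obtain S where S: "spans M S (carrier M)"
    using assms fin_gen_iff[OF rm] unfolding fg_module_def by blast
  then obtain k e where e: "e \<in> Hom (power_module reg k) M" "S \<subseteq> e ` carrier (power_module reg k)"
    using *[of S] unfolding spans_def by blast
  have "submodule (e ` carrier (power_module reg k)) A M"
    using submodule_image[OF rm_power[OF rm_regular] rm e(1)]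
      submodule_carrier[OF rm_power[OF rm_regular]] by blast
  then have "e ` carrier (power_module reg k) = carrier M"
    using S e homD(1)[OF e(1)] unfolding spans_def by blast
  then show thesis using that e by blast
qed

section \<open>Summands of powers\<close>

lemma submoduleD:
  assumes "rm M" "submodule N A M"
  shows "x \<in> N \<Longrightarrow> x \<in> carrier M" and "\<zero>\<^bsub>M\<^esub> \<in> N"
    and "x \<in> N \<Longrightarrow> y \<in> N \<Longrightarrow> x \<oplus>\<^bsub>M\<^esub> y \<in> N" and "x \<in> N \<Longrightarrow> neg M x \<in> N"
  using assms(2)[unfolded submodule_iff[OF assms(1)]] by (auto simp: neg_def)

text \<open>Addition from the direct sum of \<open>N\<close> and \<open>N'\<close> to
  \<open>P\<close> is bijective; the projection is its inverse followed by
  \<open>fst\<close>.\<close>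

lemma complementary_projection:
  assumes P: "rm P" and N: "complementary A P N N'"
  obtains \<pi> where "\<pi> \<in> Hom P (P\<lparr>carrier := N\<rparr>)" "\<And>x. x \<in> N \<Longrightarrow> \<pi> x = x"
proof -
  have sub: "submodule N A P" "submodule N' A P" "N \<inter> N' = {\<zero>\<^bsub>P\<^esub>}" "N <+>\<^bsub>P\<^esub> N' = carrier P"
    using N by (auto simp: complementary_def)
  note N1 = submoduleD[OF P sub(1)] and N2 = submoduleD[OF P sub(2)]
  let ?N = "P\<lparr>carrier := N\<rparr>" and ?N' = "P\<lparr>carrier := N'\<rparr>"
  have rmN: "rm ?N" "rm ?N'" using rm_submodule P sub by blast+
  let ?D = "direct_sum ?N ?N'" and ?s = "\<lambda>u. fst u \<oplus>\<^bsub>P\<^esub> snd u"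
  have s: "?s \<in> Hom ?D P"
    by (intro hom_add hom_uncorestrict[OF hom_fst] hom_uncorestrict[OF hom_snd] subsetI P N1(1) N2(1))
  have inj: "inj_on ?s (carrier ?D)"
    unfolding hom_inj_iff[OF rm_direct_sum[OF rmN] P s]
  proof (intro ballI impI)
    fix u assume u: "u \<in> carrier ?D" "fst u \<oplus>\<^bsub>P\<^esub> snd u = \<zero>\<^bsub>P\<^esub>"
    then have uN: "fst u \<in> N" "snd u \<in> N'" by auto
    have "fst u = neg P (snd u)"
      by (rule rm_neg_unique[OF P N2(1)[OF uN(2)] N1(1)[OF uN(1)] u(2)])
    then have "fst u \<in> N \<inter> N'" using uN N2(4) by simp
    then have f0: "fst u = \<zero>\<^bsub>P\<^esub>" using sub(3) by simp
    then have "snd u = \<zero>\<^bsub>P\<^esub>" using u(2) rm_add(1)[OF P N2(1)[OF uN(2)]] by simp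
    then show "u = \<zero>\<^bsub>?D\<^esub>" using f0 by (simp add: prod_eq_iff)
  qed
  have "?s ` carrier ?D = N <+>\<^bsub>P\<^esub> N'"
    by (force simp: set_add_def')
  then have "bij_betw ?s (carrier ?D) (carrier P)" using inj sub(4) by (simp add: bij_betw_def)
  from mod_iso_inverse[OF rm_direct_sum[OF rmN] P s this]
  obtain t where t: "t \<in> Hom P ?D" "\<And>u. u \<in> carrier ?D \<Longrightarrow> t (?s u) = u" by blast
  show thesis
  proof (rule that)
    show "(\<lambda>x. fst (t x)) \<in> Hom P ?N" by (rule hom_comp[OF t(1) hom_fst])
    fix x assume x: "x \<in> N"
    then have "t (?s (x, \<zero>\<^bsub>P\<^esub>)) = (x, \<zero>\<^bsub>P\<^esub>)" using N2(2) by (intro t(2)) simp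
    then show "fst (t x) = x" using rm_add(2)[OF P N1(1)[OF x]] by simp
  qed
qed

text \<open>The splitting is y = f (g y) + (y - f (g y)).\<close>

lemma retract_complementary:
  assumes X: "rm X" and P: "rm P" and f: "f \<in> Hom X P" and g: "g \<in> Hom P X"
    and gf: "\<And>x. x \<in> carrier X \<Longrightarrow> g (f x) = x"
  shows "complementary A P (f ` carrier X) {y \<in> carrier P. g y = \<zero>\<^bsub>X\<^esub>}"
    and "mod_iso A X (P\<lparr>carrier := f ` carrier X\<rparr>)"
proof -
  let ?N = "f ` carrier X" and ?N' = "{y \<in> carrier P. g y = \<zero>\<^bsub>X\<^esub>}"
  have "?N \<inter> ?N' = {\<zero>\<^bsub>P\<^esub>}"
  proof -
    have "\<zero>\<^bsub>P\<^esub> = f \<zero>\<^bsub>X\<^esub>" using hom_zero[OF f X P] by simp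
    then show ?thesis using gf X P homD(1)[OF f] hom_zero[OF g P X] by auto
  qed
  moreover have "?N <+>\<^bsub>P\<^esub> ?N' = carrier P"
  proof (intro equalityI subsetI)
    fix y assume "y \<in> ?N <+>\<^bsub>P\<^esub> ?N'"
    then show "y \<in> carrier P" using homD(1)[OF f] P by (auto simp: set_add_def')
  next
    fix y assume y: "y \<in> carrier P"
    have gy: "g y \<in> carrier X" and fgy: "f (g y) \<in> carrier P"
      using y homD(1)[OF g] homD(1)[OF f] by auto
    let ?y = "y \<oplus>\<^bsub>P\<^esub> neg P (f (g y))"
    have "f (g y) \<in> ?N" "?y \<in> ?N'" using y gy fgy P X by (auto simp: homD[OF g] gf)
    moreover have "y = f (g y) \<oplus>\<^bsub>P\<^esub> ?y" using y fgy P by (simp add: rm_ac)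
    ultimately show "y \<in> ?N <+>\<^bsub>P\<^esub> ?N'" unfolding set_add_def' by blast
  qed
  ultimately show "complementary A P ?N ?N'"
    using submodule_image[OF X P f submodule_carrier[OF X]] submodule_kernel[OF P X g]
    by (simp add: complementary_def)
  show "mod_iso A X (P\<lparr>carrier := ?N\<rparr>)"
    unfolding mod_iso_def
  proof (rule bexI[of _ f])
    show "bij_betw f (carrier X) (carrier (P\<lparr>carrier := ?N\<rparr>))"
      using inj_on_inverseI[of "carrier X" g f, OF gf] by (simp add: bij_betw_def)
    show "f \<in> Hom X (P\<lparr>carrier := ?N\<rparr>)" by (rule hom_corestrict[OF f]) simp
  qed
qed

text \<open>From left to right the identity of the power is conjugated by the inclusion of, and the
  projection onto, the summand; from right to left a factorization of the identity through a power
  splits. The closure properties of add are read off from this form.\<close>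

lemma in_add_iff:
  assumes Q: "rm Q"
  shows "in_add A Q X \<longleftrightarrow> fg_module A X \<and> thru Q X X (\<lambda>x. x)"
proof
  assume X: "in_add A Q X"
  then have rmX: "rm X" using fg_moduleD by (auto simp: in_add_def)
  obtain k N N' where N: "complementary A (power_module Q k) N N'"
    and "mod_iso A X ((power_module Q k)\<lparr>carrier := N\<rparr>)"
    using X unfolding in_add_def by blast
  then obtain \<phi> where \<phi>: "\<phi> \<in> Hom X ((power_module Q k)\<lparr>carrier := N\<rparr>)" "bij_betw \<phi> (carrier X) N"
    unfolding mod_iso_def by auto
  define P where "P = power_module Q k"
  note N = N[folded P_def] and \<phi> = \<phi>[folded P_def]
  have rmP: "rm P" and thP: "thru Q P P (\<lambda>x. x)"
    unfolding P_def using Q rm_power thru_power_id by blast+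
  have sub: "submodule N A P" using N by (simp add: complementary_def)
  have rmN: "rm (P\<lparr>carrier := N\<rparr>)" by (rule rm_submodule[OF rmP sub])
  obtain \<pi> where \<pi>: "\<pi> \<in> Hom P (P\<lparr>carrier := N\<rparr>)" "\<And>x. x \<in> N \<Longrightarrow> \<pi> x = x"
    using complementary_projection[OF rmP N] by blast
  obtain \<psi> where \<psi>: "\<psi> \<in> Hom (P\<lparr>carrier := N\<rparr>) X" "\<And>x. x \<in> carrier X \<Longrightarrow> \<psi> (\<phi> x) = x"
    using mod_iso_inverse[OF rmX rmN \<phi>(1), simplified, OF \<phi>(2)] by blast
  have \<phi>P: "\<phi> \<in> Hom X P"
    by (rule hom_uncorestrict[OF \<phi>(1)]) (use submoduleD(1)[OF rmP sub] in blast)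
  have th: "thru Q X X (\<lambda>x. \<psi> (\<pi> (\<phi> x)))"
    by (rule thru_comp_left[OF thru_comp_right[OF thP \<phi>P] hom_comp[OF \<pi>(1) \<psi>(1)] rmX rmP rmX])
  have "\<psi> (\<pi> (\<phi> x)) = x" if "x \<in> carrier X" for x
    using homD(1)[OF \<phi>(1) that] \<pi>(2) \<psi>(2)[OF that] by simp
  then have "thru Q X X (\<lambda>x. x)" by (intro thru.thru_cong[OF th]) simp
  then show "fg_module A X \<and> thru Q X X (\<lambda>x. x)" using X by (simp add: in_add_def)
next
  assume X: "fg_module A X \<and> thru Q X X (\<lambda>x. x)"
  then have rmX: "rm X" by (intro fg_moduleD) simp
  obtain k f g where f: "f \<in> Hom X (power_module Q k)" and g: "g \<in> Hom (power_module Q k) X"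
    and gf: "\<And>x. x \<in> carrier X \<Longrightarrow> g (f x) = x"
    by (rule thru_power[OF conjunct2[OF X] Q rmX rmX]) (rule that)
  have "complementary A (power_module Q k) (f ` carrier X)
      {y \<in> carrier (power_module Q k). g y = \<zero>\<^bsub>X\<^esub>}"
    by (rule retract_complementary(1)[OF rmX rm_power[OF Q] f g]) (erule gf)
  moreover have "mod_iso A X ((power_module Q k)\<lparr>carrier := f ` carrier X\<rparr>)"
    by (rule retract_complementary(2)[OF rmX rm_power[OF Q] f g]) (erule gf)
  ultimately show "in_add A Q X"
    unfolding in_add_def using conjunct1[OF X] by blast
qed

lemma in_add_fg: "in_add A Q X \<Longrightarrow> fg_module A X"
  by (simp add: in_add_def)

lemma in_add_rm: "in_add A Q X \<Longrightarrow> rm X"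
  using in_add_fg fg_moduleD by blast

lemma in_add_thru: "in_add A Q X \<Longrightarrow> rm Q \<Longrightarrow> thru Q X X (\<lambda>x. x)"
  using in_add_iff by blast

text \<open>The existential quantifiers in the definitions of \<open>in_Sub\<close>,
  \<open>in_Fac\<close>, \<open>tilting\<close> and \<open>proj_resolution\<close> range over one
  carrier type; this lemma moves a summand onto it.\<close>

lemma in_add_copy:
  fixes Q :: "('a, 'q) module"
  assumes "in_add A Q X" "rm Q"
  obtains X' :: "('a, nat \<Rightarrow> 'q) module" and \<phi> \<psi> where "rm X'" "\<phi> \<in> Hom X X'" "\<psi> \<in> Hom X' X"
    "\<And>x. x \<in> carrier X \<Longrightarrow> \<psi> (\<phi> x) = x" "\<And>x. x \<in> carrier X' \<Longrightarrow> \<phi> (\<psi> x) = x"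
proof -
  obtain k N N' where N: "complementary A (power_module Q k) N N'"
    and "mod_iso A X ((power_module Q k)\<lparr>carrier := N\<rparr>)"
    using assms unfolding in_add_def by blast
  then obtain \<phi> where \<phi>: "\<phi> \<in> Hom X ((power_module Q k)\<lparr>carrier := N\<rparr>)"
      "bij_betw \<phi> (carrier X) (carrier ((power_module Q k)\<lparr>carrier := N\<rparr>))"
    unfolding mod_iso_def by blast
  have rm': "rm ((power_module Q k)\<lparr>carrier := N\<rparr>)"
    using N assms(2) rm_power rm_submodule unfolding complementary_def by blast
  obtain \<psi> where "\<psi> \<in> Hom ((power_module Q k)\<lparr>carrier := N\<rparr>) X"
      "\<And>x. x \<in> carrier X \<Longrightarrow> \<psi> (\<phi> x) = x"
      "\<And>y. y \<in> carrier ((power_module Q k)\<lparr>carrier := N\<rparr>) \<Longrightarrow> \<phi> (\<psi> y) = y"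
    using mod_iso_inverse[OF in_add_rm[OF assms(1)] rm' \<phi>] by blast
  then show thesis using that rm' \<phi>(1) by blast
qed

lemma in_add_self: "fg_module A Q \<Longrightarrow> in_add A Q Q"
  by (simp add: in_add_iff fg_moduleD thru_self)

lemma in_add_retract:
  assumes "in_add A Q X" "rm Q" "rm Y" "f \<in> Hom Y X" "g \<in> Hom X Y"
    and "\<And>y. y \<in> carrier Y \<Longrightarrow> g (f y) = y"
  shows "in_add A Q Y"
proof -
  note X = in_add_rm[OF assms(1)] in_add_thru[OF assms(1,2)] in_add_fg[OF assms(1)]
  have "thru Q Y Y (\<lambda>y. g (f y))"
    by (rule thru_comp_left[OF thru_comp_right[OF X(2) assms(4)] assms(5,3) X(1) assms(3)])
  then have "thru Q Y Y (\<lambda>x. x)" by (rule thru.thru_cong) (simp add: assms(6))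
  moreover have "g ` carrier X = carrier Y"
    using assms(6) homD(1)[OF assms(5)] homD(1)[OF assms(4)] by force
  ultimately show ?thesis
    using fg_surj[OF X(3) assms(5,3)] by (simp add: in_add_iff[OF assms(2)])
qed

lemma thru_direct_sum_id:
  assumes "thru Q M M (\<lambda>x. x)" "thru Q N N (\<lambda>x. x)" "rm M" "rm N"
  shows "thru Q (direct_sum M N) (direct_sum M N) (\<lambda>x. x)"
proof -
  let ?D = "direct_sum M N"
  have rm: "rm ?D" using assms rm_direct_sum by blast
  have 1: "thru Q ?D ?D (\<lambda>u. (fst u, \<zero>\<^bsub>N\<^esub>))"
    using thru_comp_left[OF thru_comp_right[OF assms(1) hom_fst] hom_inl[OF assms(4)] rm assms(3) rm] .
  have 2: "thru Q ?D ?D (\<lambda>u. (\<zero>\<^bsub>M\<^esub>, snd u))"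
    using thru_comp_left[OF thru_comp_right[OF assms(2) hom_snd] hom_inr[OF assms(3)] rm assms(4) rm] .
  show ?thesis
    by (rule thru.thru_cong[OF thru_add[OF 2 1 rm rm]]) (use assms(3,4) in \<open>auto simp: prod_eq_iff\<close>)
qed

lemma in_add_direct_sum:
  assumes "in_add A Q X" "in_add A Q Y" "rm Q"
  shows "in_add A Q (direct_sum X Y)"
  unfolding in_add_iff[OF assms(3)]
  by (intro conjI fg_direct_sum thru_direct_sum_id in_add_fg[OF assms(1)] in_add_fg[OF assms(2)]
      in_add_thru[OF _ assms(3)] in_add_rm[OF assms(1)] in_add_rm[OF assms(2)] assms(1,2))

lemma in_add_trans:
  assumes "in_add A T Q" "in_add A Q X" "rm T"
  shows "in_add A T X"
  unfolding in_add_iff[OF assms(3)]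
  using thru_trans[OF in_add_thru[OF assms(1,3)] in_add_thru[OF assms(2) in_add_rm[OF assms(1)]]]
    in_add_rm[OF assms(1)] in_add_rm[OF assms(2)] in_add_fg[OF assms(2)] by simp

lemma in_add_power: "fg_module A Q \<Longrightarrow> in_add A Q (power_module Q k)"
  by (simp add: in_add_iff fg_moduleD fg_power thru_power_id)

lemma in_add_zero:
  assumes "rm Q" "rm Z" "zero_module Z"
  shows "in_add A Q Z"
proof -
  have "thru Q Z Z (\<lambda>x. x)"
    by (rule thru.thru_cong[OF thru.thru_zero]) (use assms(3) in \<open>simp add: zero_module_def\<close>)
  moreover have "spans Z {} (carrier Z)"
    using submodule_iff[OF assms(2)] assms(3) by (auto simp: spans_def zero_module_def)
  ultimately show ?thesis
    using in_add_iff[OF assms(1)] fin_gen_iff[OF assms(2)] assms(2) unfolding fg_module_def by blast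
qed

section \<open>Projective modules\<close>

text \<open>A map out of the regular module is determined by its value at 1, so each summand M -> A
  -> N is lifted by choosing a preimage of \<open>g \<one>\<close>. The source \<open>M\<close> is
  arbitrary: what counts is that \<open>h\<close> passes through a free module.\<close>

lemma thru_reg_lift:
  assumes "thru reg M N h" "rm M" "rm N" "rm L" "e \<in> Hom L N" "e ` carrier L = carrier N"
  shows "\<exists>s\<in>Hom M L. \<forall>x\<in>carrier M. e (s x) = h x"
  using assms(1)
proof induction
  case thru_zero
  show ?case
    by (rule bexI[of _ "\<lambda>_. \<zero>\<^bsub>L\<^esub>"]) (use hom_const_zero[OF assms(4)] hom_zero[OF assms(5,4,3)] in simp_all)
next
  case (thru_step h f g)
  from thru_step.IH obtain s where s: "s \<in> Hom M L" "\<And>x. x \<in> carrier M \<Longrightarrow> e (s x) = h x" by blast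
  have "g \<one>\<^bsub>A\<^esub> \<in> carrier N" using homD(1)[OF thru_step(3)] by simp
  then obtain l where l: "l \<in> carrier L" "e l = g \<one>\<^bsub>A\<^esub>" using assms(6) by (metis imageE)
  let ?s = "\<lambda>x. s x \<oplus>\<^bsub>L\<^esub> f x \<odot>\<^bsub>L\<^esub> l"
  have "?s \<in> Hom M L"
    by (intro hom_add s hom_comp[OF thru_step(2) hom_regular] assms l)
  moreover have "e (?s x) = h x \<oplus>\<^bsub>N\<^esub> g (f x)" if "x \<in> carrier M" for x
  proof -
    have fx: "f x \<in> carrier A" using homD(1)[OF thru_step(2) that] by simp
    show ?thesis
      using homD(2)[OF assms(5), of "s x" "f x \<odot>\<^bsub>L\<^esub> l"] homD(3)[OF assms(5) l(1) fx] l s(2)[OF that]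
        homD(1)[OF s(1) that] rm_closed(3)[OF assms(4) fx l(1)] hom_regular_eq[OF thru_step(3) fx]
      by simp
  qed
  ultimately show ?case by (intro bexI[of _ ?s] ballI)
next
  case (thru_cong h h')
  then show ?case by simp
qed

lemma proj_lift:
  assumes "in_add A reg P" "rm N" "rm L" "f \<in> Hom P N" "e \<in> Hom L N" "e ` carrier L = carrier N"
  obtains s where "s \<in> Hom P L" "\<And>x. x \<in> carrier P \<Longrightarrow> e (s x) = f x"
proof -
  note P = in_add_rm[OF assms(1)]
  have "thru reg P N f"
    by (rule thru_comp_left[OF in_add_thru[OF assms(1) rm_regular] assms(4) P P assms(2)])
  from thru_reg_lift[OF this P assms(2,3,5,6)] show thesis using that by blast
qed

section \<open>Projective presentations and syzygies\<close>

text \<open>Any epimorphism from a finitely generated projective module; it is not a projective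
  cover in the minimal sense.\<close>

definition cover :: "('a, 'p) module \<Rightarrow> ('p \<Rightarrow> 'm) \<Rightarrow> ('a, 'm) module \<Rightarrow> bool" where
  "cover P e M \<longleftrightarrow> rm M \<and> in_add A reg P \<and> e \<in> Hom P M \<and> e ` carrier P = carrier M"

text \<open>For a projective \<open>P\<close> mapping onto \<open>M\<close> by \<open>e\<close>, \<open>extr P e M N\<close> means \<open>Ext\<^sup>1(M, N) = 0\<close>.\<close>

definition extr :: "('a, 'p) module \<Rightarrow> ('p \<Rightarrow> 'm) \<Rightarrow> ('a, 'm) module \<Rightarrow> ('a, 'n) module \<Rightarrow> bool" where
  "extr P e M N \<longleftrightarrow>
     (\<forall>g\<in>Hom (Ker P M e) N. \<exists>h\<in>Hom P N. \<forall>x\<in>carrier (Ker P M e). h x = g x)"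

text \<open>\<open>stadd Q X\<close>: \<open>X\<close> is a summand of some \<open>Q\<^sup>k \<oplus> A\<^sup>l\<close>.  Unlike \<open>add\<close>, this relation passes to
  syzygies.\<close>

definition stadd :: "('a, 'q) module \<Rightarrow> ('a, 'm) module \<Rightarrow> bool" where
  "stadd Q X \<longleftrightarrow> (\<exists>h1 h2. thru Q X X h1 \<and> thru reg X X h2 \<and> (\<forall>x\<in>carrier X. h1 x \<oplus>\<^bsub>X\<^esub> h2 x = x))"

lemma coverD:
  assumes "cover P e M"
  shows "rm M" "in_add A reg P" "rm P" "e \<in> Hom P M" "e ` carrier P = carrier M"
    and "rm (Ker P M e)"
  using assms in_add_rm[of reg P] rm_Ker[of P M e] by (simp_all add: cover_def)

lemma extrD:
  assumes "extr P e M N" "g \<in> Hom (Ker P M e) N"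
  obtains h where "h \<in> Hom P N" "\<And>x. x \<in> carrier P \<Longrightarrow> e x = \<zero>\<^bsub>M\<^esub> \<Longrightarrow> h x = g x"
  using assms that unfolding extr_def by fastforce

lemma extrI:
  assumes "\<And>g. g \<in> Hom (Ker P M e) N \<Longrightarrow>
    \<exists>h\<in>Hom P N. \<forall>x\<in>carrier P. e x = \<zero>\<^bsub>M\<^esub> \<longrightarrow> h x = g x"
  shows "extr P e M N"
  unfolding extr_def
proof
  fix g assume "g \<in> Hom (Ker P M e) N"
  from assms[OF this] show "\<exists>h\<in>Hom P N. \<forall>x\<in>carrier (Ker P M e). h x = g x" by auto
qed

lemma hom_incl: "(\<lambda>x. x) \<in> Hom (M\<lparr>carrier := {x \<in> carrier M. Q x}\<rparr>) M"
  by (rule hom_restrict[OF hom_id]) auto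

lemma fg_cover:
  fixes M :: "('a, 'm) module"
  assumes "fg_module A M"
  obtains P :: "'a fmodule" and e where "cover P e M"
proof -
  obtain k e where e: "e \<in> Hom (power_module reg k) M"
    "e ` carrier (power_module reg k) = carrier M"
    by (rule fg_free_cover[OF assms])
  have "cover (power_module reg k) e M"
    unfolding cover_def
    by (intro conjI fg_moduleD[OF assms] in_add_power[OF fg_regular] e)
  then show thesis by (rule that)
qed

lemma cover_fg: "cover P e M \<Longrightarrow> fg_module A M"
  by (rule fg_surj[OF in_add_fg]) (auto simp: cover_def)

lemma cover_lift:
  assumes "cover P e M" "cover R q N" "h \<in> Hom M N"
  obtains \<phi> where "\<phi> \<in> Hom P R" "\<And>x. x \<in> carrier P \<Longrightarrow> q (\<phi> x) = h (e x)"
    "\<phi> \<in> Hom (Ker P M e) (Ker R N q)"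
proof -
  note P = coverD[OF assms(1)] and R = coverD[OF assms(2)]
  obtain \<phi> where \<phi>: "\<phi> \<in> Hom P R" "\<And>x. x \<in> carrier P \<Longrightarrow> q (\<phi> x) = h (e x)"
    by (rule proj_lift[OF P(2) R(1,3) hom_comp[OF P(4) assms(3)] R(4,5)]) (rule that)
  have "\<phi> \<in> Hom (Ker P M e) (Ker R N q)"
    by (rule hom_corestrict[OF hom_restrict[OF \<phi>(1)]])
      (auto simp: homD(1)[OF \<phi>(1)] \<phi>(2) hom_zero[OF assms(3) P(1) R(1)])
  with \<phi> show thesis by (rule that)
qed

text \<open>Each summand X -> Q -> Y lifts to the covers and restricts to the kernels, so on
  syzygies \<open>h\<close> induces a map through the syzygy of \<open>Q\<close>. The last clause is
  the effect on Ext^1: a class pulled back along \<open>h\<close> passes through Ext^1(Q, N). All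
  clauses concern the same lift \<open>\<phi>\<close> and therefore share one induction.\<close>

lemma thru_syz:
  assumes "thru Q X Y h" and cov: "cover R q Q" "cover P e X" "cover P' e' Y" and N: "rm N"
  shows "\<exists>\<phi>\<in>Hom P P'. (\<forall>x\<in>carrier P. e' (\<phi> x) = h (e x)) \<and>
    thru (Ker R Q q) (Ker P X e) (Ker P' Y e') \<phi> \<and>
    (extr R q Q N \<longrightarrow> (\<forall>g\<in>Hom (Ker P' Y e') N. \<exists>k\<in>Hom P N.
       \<forall>x\<in>carrier P. e x = \<zero>\<^bsub>X\<^esub> \<longrightarrow> k x = g (\<phi> x)))"
  using assms(1)
proof induction
  note R = coverD[OF cov(1)] and P = coverD[OF cov(2)] and P' = coverD[OF cov(3)]
  {
    case thru_zero
    have "thru (Ker R Q q) (Ker P X e) (Ker P' Y e') (\<lambda>_. \<zero>\<^bsub>P'\<^esub>)"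
      using thru.thru_zero[of "Ker R Q q" "Ker P X e" "Ker P' Y e'"] by simp
    moreover have "\<exists>k\<in>Hom P N. \<forall>x\<in>carrier P. e x = \<zero>\<^bsub>X\<^esub> \<longrightarrow> k x = g \<zero>\<^bsub>P'\<^esub>"
      if "g \<in> Hom (Ker P' Y e') N" for g
      by (rule bexI[of _ "\<lambda>_. \<zero>\<^bsub>N\<^esub>"])
        (use hom_zero[OF that P'(6) N] hom_const_zero[OF N] in simp_all)
    ultimately show ?case
      by (intro bexI[of _ "\<lambda>_. \<zero>\<^bsub>P'\<^esub>"])
        (use hom_const_zero[OF P'(3)] hom_zero[OF P'(4,3,1)] in simp_all)
  next
    case (thru_step h f g)
    from thru_step.IH obtain \<phi> where \<phi>: "\<phi> \<in> Hom P P'" "\<And>x. x \<in> carrier P \<Longrightarrow> e' (\<phi> x) = h (e x)"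
      and th: "thru (Ker R Q q) (Ker P X e) (Ker P' Y e') \<phi>"
      and ext: "\<And>g. extr R q Q N \<Longrightarrow> g \<in> Hom (Ker P' Y e') N \<Longrightarrow>
        \<exists>k\<in>Hom P N. \<forall>x\<in>carrier P. e x = \<zero>\<^bsub>X\<^esub> \<longrightarrow> k x = g (\<phi> x)" by auto
    obtain \<alpha> where \<alpha>: "\<alpha> \<in> Hom P R" "\<And>x. x \<in> carrier P \<Longrightarrow> q (\<alpha> x) = f (e x)"
      "\<alpha> \<in> Hom (Ker P X e) (Ker R Q q)"
      by (rule cover_lift[OF cov(2,1) thru_step.hyps(2)]) (rule that)
    obtain \<beta> where \<beta>: "\<beta> \<in> Hom R P'" "\<And>x. x \<in> carrier R \<Longrightarrow> e' (\<beta> x) = g (q x)"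
      "\<beta> \<in> Hom (Ker R Q q) (Ker P' Y e')"
      by (rule cover_lift[OF cov(1,3) thru_step.hyps(3)]) (rule that)
    let ?\<phi> = "\<lambda>x. \<phi> x \<oplus>\<^bsub>P'\<^esub> \<beta> (\<alpha> x)"
    have 1: "?\<phi> \<in> Hom P P'" by (rule hom_add[OF \<phi>(1) hom_comp[OF \<alpha>(1) \<beta>(1)] P'(3)])
    have 2: "e' (?\<phi> x) = h (e x) \<oplus>\<^bsub>Y\<^esub> g (f (e x))" if "x \<in> carrier P" for x
      using that by (simp add: homD(2)[OF P'(4)] homD(1)[OF \<phi>(1)] homD(1)[OF \<alpha>(1)] homD(1)[OF \<beta>(1)]
          \<phi>(2) \<alpha>(2) \<beta>(2))
    have 3: "thru (Ker R Q q) (Ker P X e) (Ker P' Y e') ?\<phi>"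
      using thru.thru_step[OF th \<alpha>(3) \<beta>(3)] by simp
    have 4: "\<exists>k\<in>Hom P N. \<forall>x\<in>carrier P. e x = \<zero>\<^bsub>X\<^esub> \<longrightarrow> k x = g0 (?\<phi> x)"
      if ex: "extr R q Q N" and g0: "g0 \<in> Hom (Ker P' Y e') N" for g0
    proof -
      from ext[OF that] obtain k1 where k1: "k1 \<in> Hom P N"
        "\<And>x. x \<in> carrier P \<Longrightarrow> e x = \<zero>\<^bsub>X\<^esub> \<Longrightarrow> k1 x = g0 (\<phi> x)" by auto
      obtain k2 where k2: "k2 \<in> Hom R N" "\<And>x. x \<in> carrier R \<Longrightarrow> q x = \<zero>\<^bsub>Q\<^esub> \<Longrightarrow> k2 x = g0 (\<beta> x)"
        by (rule extrD[OF ex hom_comp[OF \<beta>(3) g0]]) (rule that)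
      have "k1 x \<oplus>\<^bsub>N\<^esub> k2 (\<alpha> x) = g0 (?\<phi> x)" if x: "x \<in> carrier P" "e x = \<zero>\<^bsub>X\<^esub>" for x
      proof -
        have xK: "x \<in> carrier (Ker P X e)" using x by simp
        have a: "\<alpha> x \<in> carrier R" "q (\<alpha> x) = \<zero>\<^bsub>Q\<^esub>" using homD(1)[OF \<alpha>(3) xK] by simp_all
        have "\<phi> x \<in> carrier (Ker P' Y e')" by (rule homD(1)[OF thru_hom[OF th P(6) P'(6)] xK])
        moreover have "\<beta> (\<alpha> x) \<in> carrier (Ker P' Y e')"
          by (rule homD(1)[OF hom_comp[OF \<alpha>(3) \<beta>(3)] xK])
        ultimately have "g0 (?\<phi> x) = g0 (\<phi> x) \<oplus>\<^bsub>N\<^esub> g0 (\<beta> (\<alpha> x))"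
          using homD(2)[OF g0, of "\<phi> x" "\<beta> (\<alpha> x)"] by simp
        then show ?thesis using k1(2)[OF x] k2(2)[OF a] by simp
      qed
      then show ?thesis
        by (intro bexI[OF _ hom_add[OF k1(1) hom_comp[OF \<alpha>(1) k2(1)] N]]) simp
    qed
    show ?case using 2 3 4 by (intro bexI[OF _ 1]) simp
  next
    case (thru_cong h h')
    then show ?case using homD(1)[OF P(4)] by simp
  }
qed

text \<open>A stable Schanuel lemma. The splitting id = h1 + h2 of \<open>X\<close> lifts to
  \<open>P\<close> as \<open>\<phi>\<close> plus \<open>s\<close> after \<open>e\<close>, and this
  differs from the identity of \<open>P\<close> by a map \<open>c\<close> into the kernel. On the
  kernel \<open>e\<close> vanishes, so there the identity is \<open>\<phi>\<close> plus
  \<open>c\<close>: the first passes through the syzygy of \<open>Q\<close>, the second through the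
  projective \<open>P\<close>. For the extension statement, \<open>g\<close> after \<open>c\<close>
  is defined on all of \<open>P\<close> anyway.\<close>

lemma syz_core:
  assumes cov: "cover R q Q" "cover P e X" and st: "stadd Q X" and N: "rm N"
  shows "stadd (Ker R Q q) (Ker P X e)" and "extr R q Q N \<Longrightarrow> extr P e X N"
proof -
  note P = coverD[OF cov(2)] and R = coverD[OF cov(1)]
  obtain h1 h2 where h: "thru Q X X h1" "thru reg X X h2"
    "\<And>x. x \<in> carrier X \<Longrightarrow> h1 x \<oplus>\<^bsub>X\<^esub> h2 x = x" using st unfolding stadd_def by auto
  from thru_syz[OF h(1) cov(1,2,2) N] obtain \<phi> where
    \<phi>: "\<phi> \<in> Hom P P" "\<And>x. x \<in> carrier P \<Longrightarrow> e (\<phi> x) = h1 (e x)"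
    and th: "thru (Ker R Q q) (Ker P X e) (Ker P X e) \<phi>"
    and ext: "\<And>g. extr R q Q N \<Longrightarrow> g \<in> Hom (Ker P X e) N \<Longrightarrow>
      \<exists>k\<in>Hom P N. \<forall>x\<in>carrier P. e x = \<zero>\<^bsub>X\<^esub> \<longrightarrow> k x = g (\<phi> x)" by auto
  from thru_reg_lift[OF h(2) P(1,1,3,4,5)] obtain s where
    s: "s \<in> Hom X P" "\<And>x. x \<in> carrier X \<Longrightarrow> e (s x) = h2 x" by auto
  let ?K = "Ker P X e"
  define c where "c = (\<lambda>x. x \<oplus>\<^bsub>P\<^esub> neg P (\<phi> x \<oplus>\<^bsub>P\<^esub> s (e x)))"
  have cP: "c \<in> Hom P P"
    unfolding c_def by (intro hom_sub hom_id hom_add \<phi>(1) hom_comp[OF P(4) s(1)] P(3))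
  have ec: "e (c x) = \<zero>\<^bsub>X\<^esub>" if "x \<in> carrier P" for x
    using that P(1,3) unfolding c_def
    by (simp add: homD[OF P(4)] homD(1)[OF \<phi>(1)] homD(1)[OF s(1)] \<phi>(2) s(2) h(3)
        del: rm_neg_add)
  have c: "c \<in> Hom P ?K"
    by (rule hom_corestrict[OF cP]) (auto simp: homD(1)[OF cP] ec)
  have sum: "\<phi> x \<oplus>\<^bsub>P\<^esub> c x = x" if "x \<in> carrier P" "e x = \<zero>\<^bsub>X\<^esub>" for x
    using that P(1,3) homD(1)[OF \<phi>(1) that(1)] hom_zero[OF s(1) P(1,3)]
    by (simp add: c_def rm_ac)
  have "thru reg ?K ?K c"
    by (rule thru_comp_left[OF thru_comp_right[OF in_add_thru[OF P(2) rm_regular] hom_incl] c P(6,3,6)])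
  with th sum show "stadd (Ker R Q q) ?K"
    unfolding stadd_def by (intro exI[of _ \<phi>] exI[of _ c]) simp
  show "extr P e X N" if ex: "extr R q Q N"
  proof (rule extrI)
    fix g assume g: "g \<in> Hom ?K N"
    from ext[OF ex g] obtain k where k: "k \<in> Hom P N"
      "\<And>x. x \<in> carrier P \<Longrightarrow> e x = \<zero>\<^bsub>X\<^esub> \<Longrightarrow> k x = g (\<phi> x)" by auto
    have "k x \<oplus>\<^bsub>N\<^esub> g (c x) = g x" if x: "x \<in> carrier P" "e x = \<zero>\<^bsub>X\<^esub>" for x
    proof -
      have "\<phi> x \<in> carrier ?K" by (rule homD(1)[OF thru_hom[OF th P(6,6)]]) (use x in simp)
      then have "g (\<phi> x \<oplus>\<^bsub>P\<^esub> c x) = g (\<phi> x) \<oplus>\<^bsub>N\<^esub> g (c x)"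
        using homD(2)[OF g, of "\<phi> x" "c x"] homD(1)[OF c x(1)] by simp
      then show ?thesis using sum[OF x] k(2)[OF x] by simp
    qed
    then show "\<exists>h\<in>Hom P N. \<forall>x\<in>carrier P. e x = \<zero>\<^bsub>X\<^esub> \<longrightarrow> h x = g x"
      by (intro bexI[OF _ hom_add[OF k(1) hom_comp[OF c g] N]]) simp
  qed
qed

lemma stadd_thru:
  assumes "thru Q X X (\<lambda>x. x)" "rm X"
  shows "stadd Q X"
  unfolding stadd_def using assms thru.thru_zero[of reg X X]
  by (intro exI[of _ "\<lambda>x. x"] exI[of _ "\<lambda>_. \<zero>\<^bsub>X\<^esub>"]) simp

lemma stadd_refl: "rm X \<Longrightarrow> stadd X X"
  by (intro stadd_thru thru_self)

lemma stadd_retract: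
  assumes "f \<in> Hom X Q" "g \<in> Hom Q X" "\<And>x. x \<in> carrier X \<Longrightarrow> g (f x) = x" "rm X"
  shows "stadd Q X"
  by (rule stadd_thru[OF thru.thru_cong[OF thru_comp[OF assms(1,2,4)]] assms(4)]) (simp add: assms(3))

lemma stadd_fg:
  assumes "stadd Q X" "fg_module A Q" "rm X"
  shows "fg_module A X"
proof -
  obtain h1 h2 where h: "thru Q X X h1" "thru reg X X h2"
    "\<And>x. x \<in> carrier X \<Longrightarrow> h1 x \<oplus>\<^bsub>X\<^esub> h2 x = x" using assms(1) unfolding stadd_def by auto
  obtain S S' where S: "spans X S (h1 ` carrier X)" "spans X S' (h2 ` carrier X)"
    using thru_spans[OF h(1) assms(2,3,3)] thru_spans[OF h(2) fg_regular assms(3,3)] by auto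
  have "spans X (S \<union> S') (carrier X)"
  proof (rule spans_add[OF assms(3) S])
    fix z assume "z \<in> carrier X"
    then show "\<exists>x\<in>h1 ` carrier X. \<exists>y\<in>h2 ` carrier X. z = x \<oplus>\<^bsub>X\<^esub> y"
      using h(3)[of z] by (intro bexI[of _ "h1 z"] bexI[of _ "h2 z"]) simp_all
  qed
  then show ?thesis
    unfolding fg_module_def fin_gen_iff[OF assms(3)] using assms(3) by (intro conjI exI)
qed

section \<open>Projective dimension together with the vanishing of Ext\<close>

text \<open>\<open>pp n M N\<close> says that \<open>M\<close> has projective dimension at most \<open>n\<close> and that
  \<open>Ext\<^sup>j(M, N) = 0\<close> for all \<open>j \<ge> 1\<close>; both are read off from the syzygies of \<open>M\<close>.  The recursion runs
  over modules on the type of submodules of free modules; only its first step is polymorphic.\<close>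

primrec ppU :: "nat \<Rightarrow> 'a fmodule \<Rightarrow> ('a, 'n) module \<Rightarrow> bool" where
  "ppU 0 M N \<longleftrightarrow> in_add A reg M"
| "ppU (Suc n) M N \<longleftrightarrow> (\<exists>(P :: 'a fmodule) e. cover P e M \<and> extr P e M N \<and> ppU n (Ker P M e) N)"

definition pp :: "nat \<Rightarrow> ('a, 'm) module \<Rightarrow> ('a, 'n) module \<Rightarrow> bool" where
  "pp n M N \<longleftrightarrow> (case n of 0 \<Rightarrow> in_add A reg M
     | Suc n \<Rightarrow> \<exists>(P :: 'a fmodule) e. cover P e M \<and> extr P e M N \<and> ppU n (Ker P M e) N)"

lemma pp_0 [simp]: "pp 0 M N \<longleftrightarrow> in_add A reg M"
  by (simp add: pp_def)

lemma ppU_eq: "ppU n M N \<longleftrightarrow> pp n M N"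
  by (cases n) (simp_all add: pp_def)

lemma pp_Suc: "pp (Suc n) M N \<longleftrightarrow>
    (\<exists>(P :: 'a fmodule) e. cover P e M \<and> extr P e M N \<and> pp n (Ker P M e) N)"
  by (simp add: pp_def ppU_eq)

lemma pp_fg: "pp n M N \<Longrightarrow> fg_module A M"
  by (cases n) (auto simp: pp_Suc intro: in_add_fg cover_fg)

lemma pp_rm: "pp n M N \<Longrightarrow> rm M"
  by (intro fg_moduleD pp_fg)

section \<open>Invariance of \<open>pp\<close> under stable summands and independence of the
  cover\<close>

lemma pp_transfer_0:
  assumes "pp 0 Q N" "stadd Q X" "rm X"
  shows "pp 0 X N'"
proof -
  have Q: "in_add A reg Q" using assms(1) by simp
  obtain h1 h2 where h: "thru Q X X h1" "thru reg X X h2"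
    "\<And>x. x \<in> carrier X \<Longrightarrow> h1 x \<oplus>\<^bsub>X\<^esub> h2 x = x" using assms(2) unfolding stadd_def by auto
  have "thru reg X X (\<lambda>x. h1 x \<oplus>\<^bsub>X\<^esub> h2 x)"
    by (rule thru_add[OF h(2) thru_trans[OF in_add_thru[OF Q rm_regular] h(1) in_add_rm[OF Q] assms(3,3)] assms(3,3)])
  then have "thru reg X X (\<lambda>x. x)" by (rule thru.thru_cong) (simp add: h(3))
  then show ?thesis
    using stadd_fg[OF assms(2) in_add_fg[OF Q] assms(3)] by (simp add: in_add_iff[OF rm_regular])
qed

text \<open>The induction hypothesis appears as an assumption on modules over the fixed type, so
  that this lemma serves both as the induction step there and as the final step for arbitrary
  carriers. Several lemmas below have the same shape.\<close>

lemma pp_transfer_Suc: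
  fixes N :: "('a, 'n) module"
  assumes "pp (Suc n) Q N" "stadd Q X" "rm X" "rm N"
    and IH: "\<And>(K :: 'a fmodule) (K' :: 'a fmodule). pp n K N \<Longrightarrow> stadd K K' \<Longrightarrow> rm K' \<Longrightarrow> pp n K' N"
  shows "pp (Suc n) X N"
proof -
  obtain R :: "'a fmodule" and q
    where R: "cover R q Q" "extr R q Q N" "pp n (Ker R Q q) N"
    using assms(1) unfolding pp_Suc by auto
  obtain P :: "'a fmodule" and e where P: "cover P e X"
    by (rule fg_cover[OF stadd_fg[OF assms(2) pp_fg[OF assms(1)] assms(3)]])
  have "pp n (Ker P X e) N"
    by (rule IH[OF R(3) syz_core(1)[OF R(1) P assms(2,4)] coverD(6)[OF P]])
  then show ?thesis
    unfolding pp_Suc using P syz_core(2)[OF R(1) P assms(2,4) R(2)] by (intro exI conjI)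
qed

lemma pp_transfer_U:
  fixes Q X :: "'a fmodule"
  assumes "pp n Q N" "stadd Q X" "rm X" "rm N"
  shows "pp n X N"
  using assms(1-3)
proof (induction n arbitrary: Q X)
  case 0
  then show ?case by (rule pp_transfer_0)
next
  case (Suc n)
  show ?case by (rule pp_transfer_Suc[OF Suc.prems(1-3) assms(4)]) (rule Suc.IH)
qed

lemma pp_transfer:
  assumes "pp n Q N" "stadd Q X" "rm X" "rm N"
  shows "pp n X N"
proof (cases n)
  case 0
  then show ?thesis using pp_transfer_0 assms by blast
next
  case (Suc m)
  show ?thesis unfolding Suc
    by (rule pp_transfer_Suc[OF assms(1)[unfolded Suc] assms(2-4)])
       (rule pp_transfer_U[OF _ _ _ assms(4)])
qed

lemma pp_in_add:
  assumes "pp n Q N" "in_add A Q X" "rm N"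
  shows "pp n X N"
  using in_add_rm[OF assms(2)]
  by (intro pp_transfer[OF assms(1) stadd_thru[OF in_add_thru[OF assms(2) pp_rm[OF assms(1)]]]] assms(3))

lemma pp_retract:
  assumes "pp n Q N" "f \<in> Hom X Q" "g \<in> Hom Q X" "\<And>x. x \<in> carrier X \<Longrightarrow> g (f x) = x" "rm X" "rm N"
  shows "pp n X N"
  by (rule pp_transfer[OF assms(1) stadd_retract[OF assms(2-5)] assms(5,6)])

text \<open>A cover of a projective module splits; x - s (e x) retracts \<open>P\<close> onto the
  kernel.\<close>

lemma pp_cover_0:
  assumes P: "cover P e M" and M: "in_add A reg M"
  shows "extr P e M N" and "in_add A reg (Ker P M e)"
proof -
  note P = coverD[OF P]
  obtain s where s: "s \<in> Hom M P" "\<And>x. x \<in> carrier M \<Longrightarrow> e (s x) = x"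
    by (rule proj_lift[OF M P(1,3) hom_id P(4,5)]) (rule that)
  let ?r = "\<lambda>x. x \<oplus>\<^bsub>P\<^esub> neg P (s (e x))"
  have rP: "?r \<in> Hom P P" by (intro hom_sub hom_id hom_comp[OF P(4) s(1)] P(3))
  have er: "e (?r x) = \<zero>\<^bsub>M\<^esub>" if "x \<in> carrier P" for x
    using that P(1,3) by (simp add: homD[OF P(4)] homD(1)[OF s(1)] s(2))
  have r: "?r \<in> Hom P (Ker P M e)"
    by (rule hom_corestrict[OF rP]) (use homD(1)[OF rP] er in auto)
  have rx: "?r x = x" if "x \<in> carrier P" "e x = \<zero>\<^bsub>M\<^esub>" for x
    using that hom_zero[OF s(1) P(1,3)] P(3) by simp
  show "extr P e M N"
  proof (rule extrI)
    fix g assume "g \<in> Hom (Ker P M e) N"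
    then show "\<exists>h\<in>Hom P N. \<forall>x\<in>carrier P. e x = \<zero>\<^bsub>M\<^esub> \<longrightarrow> h x = g x"
      by (intro bexI[OF _ hom_comp[OF r]]) (use rx in auto)
  qed
  show "in_add A reg (Ker P M e)"
    by (rule in_add_retract[OF P(2) rm_regular P(6) hom_incl r]) (use rx in simp)
qed

text \<open>The existential quantifier over covers in \<open>pp\<close> may be read as a universal
  one. The truncated \<open>n - 1\<close> is right at \<open>n = 0\<close>, because the kernel of a
  cover of a projective module is again projective.\<close>

lemma pp_cover:
  assumes P: "cover P e M" and M: "pp n M N" and N: "rm N"
  shows "extr P e M N" and "pp (n - 1) (Ker P M e) N"
proof -
  have "extr P e M N \<and> pp (n - 1) (Ker P M e) N"
  proof (cases n)
    case 0
    then show ?thesis using pp_cover_0[OF P] M by simp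
  next
    case (Suc m)
    obtain R :: "'a fmodule" and q
      where R: "cover R q M" "extr R q M N" "pp m (Ker R M q) N"
      using M unfolding Suc pp_Suc by auto
    note st = syz_core[OF R(1) P stadd_refl[OF coverD(1)[OF P]] N]
    show ?thesis
      using st(2)[OF R(2)] pp_transfer[OF R(3) st(1) coverD(6)[OF P] N] Suc by simp
  qed
  then show "extr P e M N" and "pp (n - 1) (Ker P M e) N" by auto
qed

lemma pp_SucI:
  assumes P: "cover P e M" and ext: "extr P e M N" and K: "pp n (Ker P M e) N" and N: "rm N"
  shows "pp (Suc n) M N"
proof -
  obtain R :: "'a fmodule" and q where R: "cover R q M"
    by (rule fg_cover[OF cover_fg[OF P]])
  note st = syz_core[OF P R stadd_refl[OF coverD(1)[OF P]] N]
  show ?thesis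
    unfolding pp_Suc
    by (intro exI conjI) (rule R, rule st(2)[OF ext], rule pp_transfer[OF K st(1) coverD(6)[OF R] N])
qed

lemma pp_obtain_cover:
  fixes N :: "('a, 'n) module"
  assumes "pp n M N" "rm N"
  obtains P :: "'a fmodule" and e
    where "cover P e M" "extr P e M N" "pp (n - 1) (Ker P M e) N"
proof -
  obtain P :: "'a fmodule" and e where P: "cover P e M"
    by (rule fg_cover[OF pp_fg[OF assms(1)]])
  show thesis by (rule that[OF P pp_cover[OF P assms]])
qed

lemma pp_Suc_mono_U:
  fixes M :: "'a fmodule"
  assumes "pp n M N" "rm N"
  shows "pp (Suc n) M N"
  using assms(1)
proof (induction n arbitrary: M)
  case 0
  obtain P :: "'a fmodule" and e
    where "cover P e M" "extr P e M N" "pp (0 - 1) (Ker P M e) N"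
    by (rule pp_obtain_cover[OF 0 assms(2)])
  then show ?case by (intro pp_SucI assms(2)) simp_all
next
  case (Suc n)
  obtain P :: "'a fmodule" and e
    where P: "cover P e M" "extr P e M N" "pp (Suc n - 1) (Ker P M e) N"
    by (rule pp_obtain_cover[OF Suc.prems assms(2)])
  then show ?case using Suc.IH[of "Ker P M e"] by (intro pp_SucI[OF P(1,2)] assms(2)) simp
qed

lemma pp_Suc_mono:
  assumes "pp n M N" "rm N"
  shows "pp (Suc n) M N"
proof -
  obtain P :: "'a fmodule" and e
    where P: "cover P e M" "extr P e M N" "pp (n - 1) (Ker P M e) N"
    by (rule pp_obtain_cover[OF assms])
  have "pp n (Ker P M e) N"
    using pp_Suc_mono_U[OF P(3) assms(2)] P(3) by (cases n) simp_all
  then show ?thesis by (rule pp_SucI[OF P(1,2) _ assms(2)])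
qed

lemma pp_mono: "n \<le> m \<Longrightarrow> pp n M N \<Longrightarrow> rm N \<Longrightarrow> pp m M N"
  by (induction m rule: dec_induct) (auto intro: pp_Suc_mono)

text \<open>The vanishing is taken from the first hypothesis and the bound on the projective
  dimension from the second; both descend along the same cover.\<close>

lemma pp_reduce_U:
  fixes M :: "'a fmodule"
  assumes "pp m M N" "pp n M Z" "rm N" "rm Z"
  shows "pp n M N"
  using assms(1,2)
proof (induction n arbitrary: M m)
  case (Suc n)
  obtain P :: "'a fmodule" and e
    where P: "cover P e M" "extr P e M N" "pp (m - 1) (Ker P M e) N"
    by (rule pp_obtain_cover[OF Suc.prems(1) assms(3)])
  have "pp n (Ker P M e) Z" using pp_cover(2)[OF P(1) Suc.prems(2) assms(4)] by simp
  then show ?case by (intro pp_SucI[OF P(1,2)] Suc.IH[OF P(3)] assms(3))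
qed simp

lemma pp_reduce:
  assumes "pp m M N" "pp n M Z" "rm N" "rm Z"
  shows "pp n M N"
proof (cases n)
  case (Suc k)
  obtain P :: "'a fmodule" and e
    where P: "cover P e M" "extr P e M N" "pp (m - 1) (Ker P M e) N"
    by (rule pp_obtain_cover[OF assms(1,3)])
  have "pp k (Ker P M e) Z" using pp_cover(2)[OF P(1) assms(2,4)] Suc by simp
  then show ?thesis unfolding Suc
    by (intro pp_SucI[OF P(1,2)] pp_reduce_U[OF P(3) _ assms(3,4)] assms(3))
qed (use assms in simp)

text \<open>A map from the kernel to \<open>L\<close> is a sum of maps through \<open>N\<close>, and
  each component into \<open>N\<close> extends to \<open>P\<close>.\<close>

lemma extr_second:
  assumes P: "cover P e M" and ext: "extr P e M N" and L: "rm N" "rm L" "thru N L L (\<lambda>x. x)"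
  shows "extr P e M L"
proof (rule extrI)
  fix g assume g: "g \<in> Hom (Ker P M e) L"
  note P = coverD[OF P]
  have "thru N (Ker P M e) L g" using thru_comp_right[OF L(3) g] .
  then show "\<exists>h\<in>Hom P L. \<forall>x\<in>carrier P. e x = \<zero>\<^bsub>M\<^esub> \<longrightarrow> h x = g x"
  proof induction
    case thru_zero
    show ?case by (rule bexI[OF _ hom_const_zero[OF L(2)]]) simp
  next
    case (thru_step h a b)
    from thru_step.IH obtain k where k: "k \<in> Hom P L"
      "\<And>x. x \<in> carrier P \<Longrightarrow> e x = \<zero>\<^bsub>M\<^esub> \<Longrightarrow> k x = h x" by auto
    obtain a' where a': "a' \<in> Hom P N" "\<And>x. x \<in> carrier P \<Longrightarrow> e x = \<zero>\<^bsub>M\<^esub> \<Longrightarrow> a' x = a x"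
      by (rule extrD[OF ext thru_step.hyps(2)]) (rule that)
    show ?case
      by (rule bexI[OF _ hom_add[OF k(1) hom_comp[OF a'(1) thru_step.hyps(3)] L(2)]])
        (simp add: k(2) a'(2))
  next
    case (thru_cong h h')
    then show ?case by simp
  qed
qed

lemma pp_second_U:
  fixes M :: "'a fmodule"
  assumes "pp n M N" "rm N" "rm L" "thru N L L (\<lambda>x. x)"
  shows "pp n M L"
  using assms(1)
proof (induction n arbitrary: M)
  case (Suc n)
  obtain P :: "'a fmodule" and e
    where P: "cover P e M" "extr P e M N" "pp (Suc n - 1) (Ker P M e) N"
    by (rule pp_obtain_cover[OF Suc.prems assms(2)])
  then show ?case
    by (intro pp_SucI[OF P(1) extr_second[OF P(1,2) assms(2-4)]] Suc.IH assms(3)) simp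
qed simp

lemma pp_second:
  assumes "pp n M N" "rm N" "rm L" "thru N L L (\<lambda>x. x)"
  shows "pp n M L"
proof (cases n)
  case (Suc k)
  obtain P :: "'a fmodule" and e
    where P: "cover P e M" "extr P e M N" "pp (n - 1) (Ker P M e) N"
    by (rule pp_obtain_cover[OF assms(1,2)])
  then show ?thesis unfolding Suc
    by (intro pp_SucI[OF P(1) extr_second[OF P(1,2) assms(2-4)]] pp_second_U[OF _ assms(2-4)] assms(3))
       (simp add: Suc)
qed (use assms in simp)

section \<open>Short exact sequences\<close>

definition ses :: "('a, 'x) module \<Rightarrow> ('a, 'y) module \<Rightarrow> ('a, 'z) module \<Rightarrow> ('x \<Rightarrow> 'y) \<Rightarrow> ('y \<Rightarrow> 'z) \<Rightarrow> bool" where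
  "ses X Y Z i p \<longleftrightarrow> rm X \<and> rm Y \<and> rm Z \<and> i \<in> Hom X Y \<and> inj_on i (carrier X) \<and>
     p \<in> Hom Y Z \<and> p ` carrier Y = carrier Z \<and>
     (\<forall>y\<in>carrier Y. p y = \<zero>\<^bsub>Z\<^esub> \<longleftrightarrow> y \<in> i ` carrier X)"

lemma sesD:
  assumes "ses X Y Z i p"
  shows "rm X" "rm Y" "rm Z" "i \<in> Hom X Y" "inj_on i (carrier X)" "p \<in> Hom Y Z"
    and "p ` carrier Y = carrier Z"
    and "y \<in> carrier Y \<Longrightarrow> p y = \<zero>\<^bsub>Z\<^esub> \<Longrightarrow> y \<in> i ` carrier X"
    and "x \<in> carrier X \<Longrightarrow> p (i x) = \<zero>\<^bsub>Z\<^esub>"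
    and "x \<in> carrier X \<Longrightarrow> i x = \<zero>\<^bsub>Y\<^esub> \<Longrightarrow> x = \<zero>\<^bsub>X\<^esub>"
proof -
  show 1: "rm X" "rm Y" "rm Z" "i \<in> Hom X Y" "inj_on i (carrier X)" "p \<in> Hom Y Z"
    "p ` carrier Y = carrier Z" using assms by (simp_all add: ses_def)
  show "y \<in> carrier Y \<Longrightarrow> p y = \<zero>\<^bsub>Z\<^esub> \<Longrightarrow> y \<in> i ` carrier X"
    using assms by (simp add: ses_def)
  show "x \<in> carrier X \<Longrightarrow> p (i x) = \<zero>\<^bsub>Z\<^esub>"
    using assms homD(1)[OF 1(4), of x] by (simp add: ses_def)
  show "x \<in> carrier X \<Longrightarrow> i x = \<zero>\<^bsub>Y\<^esub> \<Longrightarrow> x = \<zero>\<^bsub>X\<^esub>"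
    using 1(5) hom_inj_iff[OF 1(1,2,4)] by simp
qed

lemma ses_factor_in:
  assumes s: "ses X Y Z i p" and f: "f \<in> Hom M Y" "\<And>x. x \<in> carrier M \<Longrightarrow> p (f x) = \<zero>\<^bsub>Z\<^esub>" and M: "rm M"
  obtains g where "g \<in> Hom M X" "\<And>x. x \<in> carrier M \<Longrightarrow> i (g x) = f x"
proof -
  have "f ` carrier M \<subseteq> i ` carrier X"
    using sesD(8)[OF s] f(2) homD(1)[OF f(1)] by blast
  from factor_inj[OF M sesD(2,1,4,5)[OF s] f(1) this] that show thesis by blast
qed

lemma ses_factor_out:
  assumes s: "ses X Y Z i p" and f: "f \<in> Hom Y N" "\<And>x. x \<in> carrier X \<Longrightarrow> f (i x) = \<zero>\<^bsub>N\<^esub>" and N: "rm N"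
  obtains g where "g \<in> Hom Z N" "\<And>y. y \<in> carrier Y \<Longrightarrow> g (p y) = f y"
proof -
  have "f y = \<zero>\<^bsub>N\<^esub>" if "y \<in> carrier Y" "p y = \<zero>\<^bsub>Z\<^esub>" for y
    using sesD(8)[OF s that] f(2) by auto
  from factor_surj[OF sesD(2)[OF s] N sesD(3,6,7)[OF s] f(1) this] that show thesis by blast
qed

lemma ses_Ker:
  assumes "rm M" "rm N" "p \<in> Hom M N" "p ` carrier M = carrier N"
  shows "ses (Ker M N p) M N (\<lambda>x. x) p"
  unfolding ses_def using assms rm_Ker[OF assms(1-3)] hom_incl by auto

lemma ses_quotient:
  assumes "rm X" "rm Y" "i \<in> Hom X Y" "inj_on i (carrier X)"
  shows "ses X Y (quotient_module Y (i ` carrier X)) i (\<lambda>y. i ` carrier X +>\<^bsub>Y\<^esub> y)"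
proof -
  note sub = submodule_image[OF assms(1-3) submodule_carrier[OF assms(1)]]
  show ?thesis
    unfolding ses_def
    using assms quotient_module[OF assms(2) sub] by (simp add: quotient_carrier)
qed

text \<open>Both lemmas extract from \<open>Ext\<^sup>1 = 0\<close> the surjectivity of a map of the long exact sequence.\<close>

lemma extr_lift:
  assumes s: "ses L E N i p" and cov: "cover P e M" and ext: "extr P e M L" and f: "f \<in> Hom M N"
  obtains f' where "f' \<in> Hom M E" "\<And>x. x \<in> carrier M \<Longrightarrow> p (f' x) = f x"
proof -
  note P = coverD[OF cov] and S = sesD[OF s]
  obtain \<phi> where \<phi>: "\<phi> \<in> Hom P E" "\<And>x. x \<in> carrier P \<Longrightarrow> p (\<phi> x) = f (e x)"
    by (rule proj_lift[OF P(2) S(3,2) hom_comp[OF P(4) f] S(6,7)]) (rule that)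
  have \<phi>K: "\<phi> \<in> Hom (Ker P M e) E" by (rule hom_restrict[OF \<phi>(1)]) auto
  obtain g where g: "g \<in> Hom (Ker P M e) L" "\<And>x. x \<in> carrier (Ker P M e) \<Longrightarrow> i (g x) = \<phi> x"
    by (rule ses_factor_in[OF s \<phi>K _ P(6)]) (auto simp: \<phi>(2) hom_zero[OF f P(1) S(3)] intro: that)
  obtain h where h: "h \<in> Hom P L" "\<And>x. x \<in> carrier P \<Longrightarrow> e x = \<zero>\<^bsub>M\<^esub> \<Longrightarrow> h x = g x"
    by (rule extrD[OF ext g(1)]) (rule that)
  \<comment> \<open>\<open>\<phi>\<close> and \<open>i\<close> after \<open>h\<close> agree on the
    kernel of \<open>e\<close>, so their difference descends to \<open>M\<close>; subtracting a map
    into the image of \<open>i\<close> does not change the composite with \<open>p\<close>.\<close>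
  have \<psi>: "(\<lambda>x. \<phi> x \<oplus>\<^bsub>E\<^esub> neg E (i (h x))) \<in> Hom P E"
    by (rule hom_sub[OF \<phi>(1) hom_comp[OF h(1) S(4)] S(2)])
  have ker: "\<phi> x \<oplus>\<^bsub>E\<^esub> neg E (i (h x)) = \<zero>\<^bsub>E\<^esub>" if "x \<in> carrier P" "e x = \<zero>\<^bsub>M\<^esub>" for x
    using that g(2)[of x] h(2)[of x] homD(1)[OF \<phi>(1)] S(2) by simp
  obtain f' where f': "f' \<in> Hom M E" "\<And>x. x \<in> carrier P \<Longrightarrow> f' (e x) = \<phi> x \<oplus>\<^bsub>E\<^esub> neg E (i (h x))"
    by (rule factor_surj[OF P(3) S(2) P(1,4,5) \<psi> ker]) (auto intro: that)
  have "p (f' y) = f y" if y: "y \<in> carrier M" for y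
  proof -
    from y P(5) obtain x where x: "x \<in> carrier P" "y = e x" by auto
    have c: "\<phi> x \<in> carrier E" "h x \<in> carrier L" "i (h x) \<in> carrier E" "f (e x) \<in> carrier N"
      using homD(1)[OF \<phi>(1) x(1)] homD(1)[OF h(1) x(1)] homD(1)[OF S(4)] homD(1)[OF hom_comp[OF P(4) f] x(1)]
      by simp_all
    show ?thesis
      using x c S(2,3) by (simp add: f'(2) homD[OF S(6)] \<phi>(2) S(9))
  qed
  with f'(1) show thesis by (rule that)
qed

lemma extr_extend:
  assumes s: "ses X Y Z i p" and cov: "cover P e Z" and ext: "extr P e Z W" and g: "g \<in> Hom X W"
    and W: "rm W"
  obtains g' where "g' \<in> Hom Y W" "\<And>x. x \<in> carrier X \<Longrightarrow> g' (i x) = g x"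
proof -
  note P = coverD[OF cov] and S = sesD[OF s]
  obtain \<phi> where \<phi>: "\<phi> \<in> Hom P Y" "\<And>x. x \<in> carrier P \<Longrightarrow> p (\<phi> x) = e x"
    by (rule proj_lift[OF P(2) S(3,2) P(4) S(6,7)]) (rule that)
  have \<phi>K: "\<phi> \<in> Hom (Ker P Z e) Y" by (rule hom_restrict[OF \<phi>(1)]) auto
  obtain k where k: "k \<in> Hom (Ker P Z e) X" "\<And>x. x \<in> carrier (Ker P Z e) \<Longrightarrow> i (k x) = \<phi> x"
    by (rule ses_factor_in[OF s \<phi>K _ P(6)]) (auto simp: \<phi>(2) intro: that)
  obtain h where h: "h \<in> Hom P W" "\<And>x. x \<in> carrier P \<Longrightarrow> e x = \<zero>\<^bsub>Z\<^esub> \<Longrightarrow> h x = g (k x)"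
    by (rule extrD[OF ext hom_comp[OF k(1) g]]) (rule that)
  \<comment> \<open>\<open>?\<sigma>\<close> presents \<open>Y\<close> as a quotient of X + P. The
    extension is induced by \<open>?\<tau>\<close>, which vanishes where \<open>?\<sigma>\<close>
    does: there i x = - \<phi> q forces x = - k q, while h q = g (k q).\<close>
  let ?D = "direct_sum X P"
  let ?\<sigma> = "\<lambda>u. i (fst u) \<oplus>\<^bsub>Y\<^esub> \<phi> (snd u)" and ?\<tau> = "\<lambda>u. g (fst u) \<oplus>\<^bsub>W\<^esub> h (snd u)"
  have D: "rm ?D" by (rule rm_direct_sum[OF S(1) P(3)])
  have \<sigma>: "?\<sigma> \<in> Hom ?D Y"
    by (rule hom_add[OF hom_comp[OF hom_fst S(4)] hom_comp[OF hom_snd \<phi>(1)] S(2)])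
  have \<tau>: "?\<tau> \<in> Hom ?D W"
    by (rule hom_add[OF hom_comp[OF hom_fst g] hom_comp[OF hom_snd h(1)] W])
  have surj: "?\<sigma> ` carrier ?D = carrier Y"
  proof (intro equalityI subsetI)
    show "y \<in> carrier Y" if "y \<in> ?\<sigma> ` carrier ?D" for y
      using that homD(1)[OF \<sigma>] by auto
    fix y assume y: "y \<in> carrier Y"
    have "p y \<in> carrier Z" using homD(1)[OF S(6) y] .
    then obtain q where q: "q \<in> carrier P" "e q = p y" using P(5) by (metis imageE)
    have \<phi>q: "\<phi> q \<in> carrier Y" using homD(1)[OF \<phi>(1) q(1)] .
    have "p (y \<oplus>\<^bsub>Y\<^esub> neg Y (\<phi> q)) = \<zero>\<^bsub>Z\<^esub>"
      using y \<phi>q q S(2,3) homD(1)[OF S(6) y] by (simp add: homD[OF S(6)] \<phi>(2))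
    then obtain x where x: "x \<in> carrier X" "i x = y \<oplus>\<^bsub>Y\<^esub> neg Y (\<phi> q)"
      using S(8)[of "y \<oplus>\<^bsub>Y\<^esub> neg Y (\<phi> q)"] y \<phi>q S(2) by auto
    have "y = ?\<sigma> (x, q)" using x y \<phi>q S(2) by (simp add: rm_add(4))
    then show "y \<in> ?\<sigma> ` carrier ?D" by (rule image_eqI) (use x q in simp)
  qed
  have ker: "?\<tau> u = \<zero>\<^bsub>W\<^esub>" if u: "u \<in> carrier ?D" "?\<sigma> u = \<zero>\<^bsub>Y\<^esub>" for u
  proof -
    obtain x q where uq: "u = (x, q)" "x \<in> carrier X" "q \<in> carrier P" using u(1) by (cases u) auto
    have c: "i x \<in> carrier Y" "\<phi> q \<in> carrier Y" "e q \<in> carrier Z"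
      using uq homD(1)[OF S(4)] homD(1)[OF \<phi>(1)] homD(1)[OF P(4)] by auto
    have "p (?\<sigma> u) = \<zero>\<^bsub>Z\<^esub>" using u(2) hom_zero[OF S(6,2,3)] by simp
    then have eq0: "e q = \<zero>\<^bsub>Z\<^esub>"
      using uq c S(3) by (simp add: homD(2)[OF S(6)] \<phi>(2) S(9))
    then have qK: "q \<in> carrier (Ker P Z e)" using uq by simp
    have kq: "k q \<in> carrier X" by (rule homD(1)[OF k(1) qK])
    have "i (x \<oplus>\<^bsub>X\<^esub> k q) = \<zero>\<^bsub>Y\<^esub>"
      using u(2) uq kq k(2)[OF qK] by (simp add: homD(2)[OF S(4)])
    then have z: "x \<oplus>\<^bsub>X\<^esub> k q = \<zero>\<^bsub>X\<^esub>" using S(10) uq kq S(1) by simp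
    have "?\<tau> u = g x \<oplus>\<^bsub>W\<^esub> g (k q)" using uq h(2)[OF uq(3) eq0] by simp
    also have "\<dots> = g (x \<oplus>\<^bsub>X\<^esub> k q)" using homD(2)[OF g uq(2) kq] by simp
    also have "\<dots> = \<zero>\<^bsub>W\<^esub>" using z hom_zero[OF g S(1) W] by simp
    finally show ?thesis .
  qed
  obtain g' where g': "g' \<in> Hom Y W" "\<And>u. u \<in> carrier ?D \<Longrightarrow> g' (?\<sigma> u) = ?\<tau> u"
    by (rule factor_surj[OF D W S(2) \<sigma> surj \<tau> ker]) (auto intro: that)
  have "g' (i x) = g x" if x: "x \<in> carrier X" for x
    using g'(2)[of "(x, \<zero>\<^bsub>P\<^esub>)"] x P(3) W S(2) homD(1)[OF S(4) x] homD(1)[OF g x]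
      hom_zero[OF \<phi>(1) P(3) S(2)] hom_zero[OF h(1) P(3) W] by simp
  with g'(1) show thesis by (rule that)
qed

lemma pp_lift:
  assumes "ses L E N i p" "pp n M L" "f \<in> Hom M N"
  obtains f' where "f' \<in> Hom M E" "\<And>x. x \<in> carrier M \<Longrightarrow> p (f' x) = f x"
proof -
  obtain P :: "'a fmodule" and e where P: "cover P e M" by (rule fg_cover[OF pp_fg[OF assms(2)]])
  show thesis
    by (rule extr_lift[OF assms(1) P pp_cover(1)[OF P assms(2) sesD(1)[OF assms(1)]] assms(3)]) (rule that)
qed

lemma pp_extend:
  assumes "ses X Y Z i p" "pp n Z W" "g \<in> Hom X W" "rm W"
  obtains g' where "g' \<in> Hom Y W" "\<And>x. x \<in> carrier X \<Longrightarrow> g' (i x) = g x"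
proof -
  obtain P :: "'a fmodule" and e where P: "cover P e Z" by (rule fg_cover[OF pp_fg[OF assms(2)]])
  show thesis
    by (rule extr_extend[OF assms(1) P pp_cover(1)[OF P assms(2,4)] assms(3,4)]) (rule that)
qed

section \<open>Two out of three\<close>

text \<open>Only the first step of the horseshoe is built: the kernel of the cover of
  \<open>Y\<close> is an extension of the two syzygies, so the induction can go on from
  there.\<close>

lemma horseshoe:
  assumes s: "ses X Y Z i p" and cP: "cover P e X" and cR: "cover R q Z"
  obtains \<epsilon> where "cover (direct_sum P R) \<epsilon> Y"
    "ses (Ker P X e) (Ker (direct_sum P R) Y \<epsilon>) (Ker R Z q) (\<lambda>x. (x, \<zero>\<^bsub>R\<^esub>)) snd"
proof -
  note P = coverD[OF cP] and R = coverD[OF cR] and S = sesD[OF s]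
  let ?D = "direct_sum P R"
  have D: "rm ?D" by (rule rm_direct_sum[OF P(3) R(3)])
  obtain \<sigma> where \<sigma>: "\<sigma> \<in> Hom R Y" "\<And>x. x \<in> carrier R \<Longrightarrow> p (\<sigma> x) = q x"
    by (rule proj_lift[OF R(2) S(3,2) R(4) S(6,7)]) (rule that)
  have \<sigma>0: "\<sigma> \<zero>\<^bsub>R\<^esub> = \<zero>\<^bsub>Y\<^esub>" by (rule hom_zero[OF \<sigma>(1) R(3) S(2)])
  define \<epsilon> where "\<epsilon> = (\<lambda>u. i (e (fst u)) \<oplus>\<^bsub>Y\<^esub> \<sigma> (snd u))"
  have \<epsilon>: "\<epsilon> \<in> Hom ?D Y" unfolding \<epsilon>_def
    by (rule hom_add[OF hom_comp[OF hom_comp[OF hom_fst P(4)] S(4)] hom_comp[OF hom_snd \<sigma>(1)] S(2)])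
  have ie: "e a \<in> carrier X" "i (e a) \<in> carrier Y" if "a \<in> carrier P" for a
    using homD(1)[OF P(4) that] homD(1)[OF S(4)] by auto
  have p\<epsilon>: "p (\<epsilon> u) = q (snd u)" if "u \<in> carrier ?D" for u
    using that ie homD(1)[OF \<sigma>(1)] homD(1)[OF R(4)] S(3)
    by (auto simp: \<epsilon>_def homD(2)[OF S(6)] S(9) \<sigma>(2))
  \<comment> \<open>Used for arbitrary \<open>y\<close>, to see that \<open>\<epsilon>\<close> is
    onto, and for \<open>y = 0\<close>, to see that its kernel maps onto the kernel of
    \<open>q\<close>.\<close>
  have hit: "\<exists>a\<in>carrier P. y = i (e a) \<oplus>\<^bsub>Y\<^esub> \<sigma> r"
    if y: "y \<in> carrier Y" "r \<in> carrier R" "p y = q r" for y r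
  proof -
    have \<sigma>r: "\<sigma> r \<in> carrier Y" using homD(1)[OF \<sigma>(1) y(2)] .
    have "p (y \<oplus>\<^bsub>Y\<^esub> neg Y (\<sigma> r)) = \<zero>\<^bsub>Z\<^esub>"
      using y \<sigma>r S(2,3) homD(1)[OF R(4) y(2)] by (simp add: homD[OF S(6)] \<sigma>(2))
    then obtain x where x: "x \<in> carrier X" "i x = y \<oplus>\<^bsub>Y\<^esub> neg Y (\<sigma> r)"
      using S(8)[of "y \<oplus>\<^bsub>Y\<^esub> neg Y (\<sigma> r)"] y \<sigma>r S(2) by auto
    obtain a where "a \<in> carrier P" "e a = x" using x(1) P(5) by (metis imageE)
    moreover have "y = i x \<oplus>\<^bsub>Y\<^esub> \<sigma> r" using x y \<sigma>r S(2) by (simp add: rm_add(4))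
    ultimately show ?thesis by blast
  qed
  have surj: "\<epsilon> ` carrier ?D = carrier Y"
  proof (intro equalityI subsetI)
    show "y \<in> carrier Y" if "y \<in> \<epsilon> ` carrier ?D" for y using that homD(1)[OF \<epsilon>] by auto
    fix y assume y: "y \<in> carrier Y"
    obtain r where r: "r \<in> carrier R" "p y = q r" using homD(1)[OF S(6) y] R(5) by (metis imageE)
    from hit[OF y r] obtain a where a: "a \<in> carrier P" "y = i (e a) \<oplus>\<^bsub>Y\<^esub> \<sigma> r" by auto
    show "y \<in> \<epsilon> ` carrier ?D"
      by (rule image_eqI[of _ _ "(a, r)"]) (use a r in \<open>simp_all add: \<epsilon>_def\<close>)
  qed
  have cov: "cover ?D \<epsilon> Y"
    unfolding cover_def
    by (intro conjI S(2) in_add_direct_sum P(2) R(2) rm_regular \<epsilon> surj)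
  note K = coverD(6)[OF cov]
  have "(\<lambda>x. (x, \<zero>\<^bsub>R\<^esub>)) \<in> Hom (Ker P X e) (Ker ?D Y \<epsilon>)"
    by (rule hom_corestrict[OF hom_restrict[OF hom_inl[OF R(3)]]])
      (use R(3) S(2) \<sigma>0 hom_zero[OF S(4,1,2)] in \<open>auto simp: \<epsilon>_def\<close>)
  moreover have "snd \<in> Hom (Ker ?D Y \<epsilon>) (Ker R Z q)"
  proof (rule hom_corestrict[OF hom_restrict[OF hom_snd]])
    show "snd ` carrier (Ker ?D Y \<epsilon>) \<subseteq> {x \<in> carrier R. q x = \<zero>\<^bsub>Z\<^esub>}"
      using p\<epsilon> hom_zero[OF S(6,2,3)] by (auto simp: image_subset_iff simp del: split_paired_All)
        (metis SigmaI direct_sum_simps(1) snd_conv)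
  qed auto
  moreover have "r \<in> snd ` carrier (Ker ?D Y \<epsilon>)" if r: "r \<in> carrier R" "q r = \<zero>\<^bsub>Z\<^esub>" for r
  proof -
    have "p \<zero>\<^bsub>Y\<^esub> = q r" using r hom_zero[OF S(6,2,3)] by simp
    from hit[OF rm_closed(1)[OF S(2)] r(1) this] obtain a
      where a: "a \<in> carrier P" "\<zero>\<^bsub>Y\<^esub> = i (e a) \<oplus>\<^bsub>Y\<^esub> \<sigma> r" by auto
    show ?thesis
      by (rule image_eqI[of _ _ "(a, r)"]) (use a r in \<open>simp_all add: \<epsilon>_def\<close>)
  qed
  moreover have "u \<in> (\<lambda>x. (x, \<zero>\<^bsub>R\<^esub>)) ` carrier (Ker P X e)"
    if u: "u \<in> carrier ?D" "\<epsilon> u = \<zero>\<^bsub>Y\<^esub>" "snd u = \<zero>\<^bsub>R\<^esub>" for u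
  proof -
    have a: "fst u \<in> carrier P" using u(1) by auto
    have "i (e (fst u)) = \<zero>\<^bsub>Y\<^esub>" using u ie(2)[OF a] \<sigma>0 S(2) by (simp add: \<epsilon>_def)
    then have "e (fst u) = \<zero>\<^bsub>X\<^esub>" using S(10)[OF ie(1)[OF a]] by simp
    then show ?thesis using a u(3) by (intro image_eqI[of _ _ "fst u"]) (simp_all add: prod_eq_iff)
  qed
  ultimately have "ses (Ker P X e) (Ker ?D Y \<epsilon>) (Ker R Z q) (\<lambda>x. (x, \<zero>\<^bsub>R\<^esub>)) snd"
    unfolding ses_def using P(6) R(6) K homD(1)[of snd "Ker ?D Y \<epsilon>" "Ker R Z q"]
    by (auto simp: inj_on_def)
  with cov show thesis by (rule that)
qed

lemma pp_middle_0:
  assumes s: "ses X Y Z i p" and "pp 0 X N" "pp 0 Z N"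
  shows "pp 0 Y N"
proof -
  note S = sesD[OF s]
  have X: "in_add A reg X" and Z: "in_add A reg Z" using assms by simp_all
  obtain \<sigma> where \<sigma>: "\<sigma> \<in> Hom Z Y" "\<And>x. x \<in> carrier Z \<Longrightarrow> p (\<sigma> x) = x"
    by (rule proj_lift[OF Z S(3,2) hom_id S(6,7)]) (rule that)
  let ?c = "\<lambda>y. y \<oplus>\<^bsub>Y\<^esub> neg Y (\<sigma> (p y))"
  have py: "p y \<in> carrier Z" "\<sigma> (p y) \<in> carrier Y" if "y \<in> carrier Y" for y
    using homD(1)[OF S(6) that] homD(1)[OF \<sigma>(1)] by auto
  have c: "?c \<in> Hom Y Y" by (rule hom_sub[OF hom_id hom_comp[OF S(6) \<sigma>(1)] S(2)])
  have pc: "p (?c y) = \<zero>\<^bsub>Z\<^esub>" if "y \<in> carrier Y" for y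
    using that py[OF that] S(2,3) by (simp add: homD[OF S(6)] \<sigma>(2))
  obtain r where r: "r \<in> Hom Y X" "\<And>y. y \<in> carrier Y \<Longrightarrow> i (r y) = ?c y"
    by (rule ses_factor_in[OF s c pc S(2)]) (auto intro: that)
  have 1: "thru reg Y Y (\<lambda>y. i (r y))"
    by (rule thru_comp_left[OF thru_comp_right[OF in_add_thru[OF X rm_regular] r(1)] S(4,2,1,2)])
  have 2: "thru reg Y Y (\<lambda>y. \<sigma> (p y))"
    by (rule thru_comp_left[OF thru_comp_right[OF in_add_thru[OF Z rm_regular] S(6)] \<sigma>(1) S(2,3,2)])
  have th: "thru reg Y Y (\<lambda>y. y)"
    by (rule thru.thru_cong[OF thru_add[OF 2 1 S(2,2)]]) (use py S(2) in \<open>simp add: r(2) rm_add(4)\<close>)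
  have "fg_module A Y" by (rule fg_thru[OF fg_regular th S(2,2)]) simp
  then show ?thesis using th by (simp add: in_add_iff[OF rm_regular])
qed

text \<open>Whatever the carrier of \<open>Y\<close>, the horseshoe produces a middle kernel on
  pairs with outer kernels on \<open>'a fmodule\<close>; the recursion therefore closes after one
  step, and the hypothesis \<open>IH\<close> is needed at these types only.\<close>

lemma pp_middle_Suc:
  fixes N :: "('a, 'n) module"
  assumes s: "ses X Y Z i p" and X: "pp (Suc n) X N" and Z: "pp (Suc n) Z N" and N: "rm N"
    and IH: "\<And>(K :: 'a fmodule) (K' :: ('a, (nat \<Rightarrow> 'a) \<times> (nat \<Rightarrow> 'a)) module)
      (K'' :: 'a fmodule) i p. ses K K' K'' i p \<Longrightarrow> pp n K N \<Longrightarrow> pp n K'' N \<Longrightarrow> pp n K' N"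
  shows "pp (Suc n) Y N"
proof -
  obtain P :: "'a fmodule" and e
    where P: "cover P e X" "extr P e X N" "pp (Suc n - 1) (Ker P X e) N"
    by (rule pp_obtain_cover[OF X N])
  obtain R :: "'a fmodule" and q
    where R: "cover R q Z" "extr R q Z N" "pp (Suc n - 1) (Ker R Z q) N"
    by (rule pp_obtain_cover[OF Z N])
  obtain \<epsilon> where \<epsilon>: "cover (direct_sum P R) \<epsilon> Y"
    "ses (Ker P X e) (Ker (direct_sum P R) Y \<epsilon>) (Ker R Z q) (\<lambda>x. (x, \<zero>\<^bsub>R\<^esub>)) snd"
    by (rule horseshoe[OF s P(1) R(1)])
  let ?D = "direct_sum P R"
  note K = sesD[OF \<epsilon>(2)] and P' = coverD[OF P(1)] and R' = coverD[OF R(1)]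
  have "extr ?D \<epsilon> Y N"
  proof (rule extrI)
    fix g assume g: "g \<in> Hom (Ker ?D Y \<epsilon>) N"
    obtain h where h: "h \<in> Hom P N" "\<And>x. x \<in> carrier P \<Longrightarrow> e x = \<zero>\<^bsub>X\<^esub> \<Longrightarrow> h x = g (x, \<zero>\<^bsub>R\<^esub>)"
      by (rule extrD[OF P(2) hom_comp[OF K(4) g]]) (rule that)
    \<comment> \<open>Once the part that extends over \<open>P\<close> is removed, the map vanishes
      on the first syzygy and descends to the third, where it extends over \<open>R\<close>.\<close>
    let ?g = "\<lambda>u. g u \<oplus>\<^bsub>N\<^esub> neg N (h (fst u))"
    have hf: "(\<lambda>u. h (fst u)) \<in> Hom ?D N" by (rule hom_comp[OF hom_fst h(1)])
    have hfK: "(\<lambda>u. h (fst u)) \<in> Hom (Ker ?D Y \<epsilon>) N" by (rule hom_restrict[OF hf]) auto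
    have g1: "?g \<in> Hom (Ker ?D Y \<epsilon>) N" by (rule hom_sub[OF g hfK N])
    have z: "?g (x, \<zero>\<^bsub>R\<^esub>) = \<zero>\<^bsub>N\<^esub>" if "x \<in> carrier (Ker P X e)" for x
      using that N homD(1)[OF h(1), of x] by (simp add: h(2)[symmetric])
    obtain l where l: "l \<in> Hom (Ker R Z q) N" "\<And>u. u \<in> carrier (Ker ?D Y \<epsilon>) \<Longrightarrow> l (snd u) = ?g u"
      by (rule ses_factor_out[OF \<epsilon>(2) g1 z N]) (auto intro: that)
    obtain l' where l': "l' \<in> Hom R N" "\<And>x. x \<in> carrier R \<Longrightarrow> q x = \<zero>\<^bsub>Z\<^esub> \<Longrightarrow> l' x = l x"
      by (rule extrD[OF R(2) l(1)]) (rule that)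
    have "h (fst u) \<oplus>\<^bsub>N\<^esub> l' (snd u) = g u" if u: "u \<in> carrier ?D" "\<epsilon> u = \<zero>\<^bsub>Y\<^esub>" for u
    proof -
      have uK: "u \<in> carrier (Ker ?D Y \<epsilon>)" using u by simp
      have "snd u \<in> carrier (Ker R Z q)" by (rule homD(1)[OF K(6) uK])
      then have "l' (snd u) = ?g u" using l'(2) l(2)[OF uK] by simp
      then show ?thesis using homD(1)[OF g uK] homD(1)[OF hfK uK] N by (simp add: rm_ac)
    qed
    then show "\<exists>k\<in>Hom ?D N. \<forall>u\<in>carrier ?D. \<epsilon> u = \<zero>\<^bsub>Y\<^esub> \<longrightarrow> k u = g u"
      by (intro bexI[OF _ hom_add[OF hf hom_comp[OF hom_snd l'(1)] N]]) simp
  qed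
  then show ?thesis
    by (rule pp_SucI[OF \<epsilon>(1) _ IH[OF \<epsilon>(2)] N]) (use P(3) R(3) in simp_all)
qed

lemma pp_middle_U:
  fixes X Z :: "'a fmodule" and Y :: "('a, (nat \<Rightarrow> 'a) \<times> (nat \<Rightarrow> 'a)) module"
  assumes "ses X Y Z i p" "pp n X N" "pp n Z N" "rm N"
  shows "pp n Y N"
  using assms(1-3)
proof (induction n arbitrary: X Y Z i p)
  case 0
  then show ?case by (rule pp_middle_0)
next
  case (Suc n)
  show ?case by (rule pp_middle_Suc[OF Suc.prems assms(4)]) (rule Suc.IH)
qed

lemma pp_middle:
  assumes "ses X Y Z i p" "pp n X N" "pp n Z N" "rm N"
  shows "pp n Y N"
proof (cases n)
  case 0
  show ?thesis unfolding 0 by (rule pp_middle_0[OF assms(1-3)[unfolded 0]])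
next
  case (Suc m)
  show ?thesis unfolding Suc
    by (rule pp_middle_Suc[OF assms(1) assms(2,3)[unfolded Suc] assms(4)])
       (rule pp_middle_U[OF _ _ _ assms(4)])
qed

text \<open>Rotation of a short exact sequence: \<open>X\<close> becomes the cokernel of the
  inclusion of the syzygy of \<open>Y\<close> into a syzygy of \<open>Z\<close>.\<close>

lemma ses_syzygy:
  assumes s: "ses X Y Z i p" and cP: "cover P e Y"
  obtains t where "cover P (\<lambda>x. p (e x)) Z"
    "ses (Ker P Y e) (Ker P Z (\<lambda>x. p (e x))) X (\<lambda>x. x) t"
    "\<And>x. x \<in> carrier P \<Longrightarrow> p (e x) = \<zero>\<^bsub>Z\<^esub> \<Longrightarrow> i (t x) = e x"
proof -
  note P = coverD[OF cP] and S = sesD[OF s]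
  let ?q = "\<lambda>x. p (e x)"
  have "?q ` carrier P = p ` e ` carrier P" by (simp add: image_image)
  then have "?q ` carrier P = carrier Z" by (simp only: P(5) S(7))
  then have cov: "cover P ?q Z"
    unfolding cover_def by (intro conjI S(3) P(2) hom_comp[OF P(4) S(6)])
  let ?K = "Ker P Z ?q"
  note K = coverD(6)[OF cov]
  have eK: "e \<in> Hom ?K Y" by (rule hom_restrict[OF P(4)]) auto
  have pK: "p (e x) = \<zero>\<^bsub>Z\<^esub>" if "x \<in> carrier ?K" for x using that by simp
  obtain t where t: "t \<in> Hom ?K X" "\<And>x. x \<in> carrier ?K \<Longrightarrow> i (t x) = e x"
    by (rule ses_factor_in[OF s eK pK K]) (auto intro: that)
  have "(\<lambda>x. x) \<in> Hom (Ker P Y e) ?K"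
    by (rule hom_corestrict[OF hom_incl]) (use hom_zero[OF S(6,2,3)] in auto)
  moreover have "t ` carrier ?K = carrier X"
  proof (intro equalityI subsetI)
    show "x \<in> carrier X" if "x \<in> t ` carrier ?K" for x using that homD(1)[OF t(1)] by auto
    fix x assume x: "x \<in> carrier X"
    obtain a where a: "a \<in> carrier P" "e a = i x" using homD(1)[OF S(4) x] P(5) by (metis imageE)
    then have aK: "a \<in> carrier ?K" using S(9)[OF x] by simp
    have "t a = x" by (rule inj_onD[OF S(5)]) (use t(2)[OF aK] a x homD(1)[OF t(1) aK] in simp_all)
    then show "x \<in> t ` carrier ?K" using aK by blast
  qed
  moreover have "t x = \<zero>\<^bsub>X\<^esub> \<longleftrightarrow> e x = \<zero>\<^bsub>Y\<^esub>" if "x \<in> carrier ?K" for x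
    using t(2)[OF that] S(10)[OF homD(1)[OF t(1) that]] hom_zero[OF S(4,1,2)] by auto
  ultimately have "ses (Ker P Y e) ?K X (\<lambda>x. x) t"
    unfolding ses_def using P(6) K S(1) t(1) hom_zero[OF S(6,2,3)]
    by (simp add: image_iff)
  with cov show thesis by (rule that) (use t(2) in simp)
qed

text \<open>Hypothesis \<open>ext\<close> says that Hom(Y, N) -> Hom(X, N) is onto. As Ext^1(Y, N) =
  0, this is what makes Ext^1(Z, N) vanish; the higher degrees are governed by the syzygy of
  \<open>Z\<close>, an extension of \<open>X\<close> by the syzygy of \<open>Y\<close>.\<close>

lemma pp_cokernel:
  fixes N :: "('a, 'n) module"
  assumes s: "ses X Y Z i p" and X: "pp n X N" and Y: "pp (Suc n) Y N" and N: "rm N"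
    and ext: "\<And>g. g \<in> Hom X N \<Longrightarrow> \<exists>h\<in>Hom Y N. \<forall>x\<in>carrier X. h (i x) = g x"
  shows "pp (Suc n) Z N"
proof -
  note S = sesD[OF s]
  obtain P :: "'a fmodule" and e
    where P: "cover P e Y" "extr P e Y N" "pp (Suc n - 1) (Ker P Y e) N"
    by (rule pp_obtain_cover[OF Y N])
  note P' = coverD[OF P(1)]
  obtain t where cov: "cover P (\<lambda>x. p (e x)) Z"
    and t: "ses (Ker P Y e) (Ker P Z (\<lambda>x. p (e x))) X (\<lambda>x. x) t"
    "\<And>x. x \<in> carrier P \<Longrightarrow> p (e x) = \<zero>\<^bsub>Z\<^esub> \<Longrightarrow> i (t x) = e x"
    by (rule ses_syzygy[OF s P(1)]) (rule that)
  let ?K = "Ker P Z (\<lambda>x. p (e x))"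
  note T = sesD[OF t(1)]
  have "extr P (\<lambda>x. p (e x)) Z N"
  proof (rule extrI)
    fix g assume g: "g \<in> Hom ?K N"
    obtain h where h: "h \<in> Hom P N" "\<And>x. x \<in> carrier P \<Longrightarrow> e x = \<zero>\<^bsub>Y\<^esub> \<Longrightarrow> h x = g x"
      by (rule extrD[OF P(2) hom_comp[OF T(4) g]]) (rule that)
    have hK: "h \<in> Hom ?K N" by (rule hom_restrict[OF h(1)]) auto
    let ?g = "\<lambda>x. g x \<oplus>\<^bsub>N\<^esub> neg N (h x)"
    have g1: "?g \<in> Hom ?K N" by (rule hom_sub[OF g hK N])
    have z: "?g x = \<zero>\<^bsub>N\<^esub>" if "x \<in> carrier (Ker P Y e)" for x
      using that N homD(1)[OF h(1), of x] by (simp add: h(2)[symmetric])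
    obtain l where l: "l \<in> Hom X N" "\<And>x. x \<in> carrier ?K \<Longrightarrow> l (t x) = ?g x"
      by (rule ses_factor_out[OF t(1) g1 z N]) (auto intro: that)
    from ext[OF l(1)] obtain l' where l': "l' \<in> Hom Y N" "\<And>x. x \<in> carrier X \<Longrightarrow> l' (i x) = l x" by auto
    have "h x \<oplus>\<^bsub>N\<^esub> l' (e x) = g x" if x: "x \<in> carrier P" "p (e x) = \<zero>\<^bsub>Z\<^esub>" for x
    proof -
      have xK: "x \<in> carrier ?K" using x by simp
      have "l' (e x) = ?g x"
        using t(2)[OF x] l'(2)[OF homD(1)[OF T(6) xK]] l(2)[OF xK] by simp
      then show ?thesis using homD(1)[OF g xK] homD(1)[OF h(1) x(1)] N by (simp add: rm_ac)
    qed
    then show "\<exists>k\<in>Hom P N. \<forall>x\<in>carrier P. p (e x) = \<zero>\<^bsub>Z\<^esub> \<longrightarrow> k x = g x"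
      by (intro bexI[OF _ hom_add[OF h(1) hom_comp[OF P'(4) l'(1)] N]]) simp
  qed
  moreover have "pp n ?K N" by (rule pp_middle[OF t(1) _ X N]) (use P(3) in simp)
  ultimately show ?thesis by (rule pp_SucI[OF cov _ _ N])
qed

text \<open>At \<open>n = 0\<close> the module \<open>Y\<close> is itself a cover of
  \<open>Z\<close> with kernel isomorphic to \<open>X\<close>. Otherwise \<open>X\<close> is a
  cokernel in the rotated sequence, and a map on the syzygy of \<open>Y\<close> extends even to
  \<open>P\<close>.\<close>

lemma pp_kernel:
  fixes N :: "('a, 'n) module"
  assumes s: "ses X Y Z i p" and Y: "pp n Y N" and Z: "pp (Suc n) Z N" and N: "rm N"
  shows "pp n X N"
proof (cases n)
  case 0
  note S = sesD[OF s]
  have cov: "cover Y p Z" using Y 0 S by (simp add: cover_def)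
  have K: "pp n (Ker Y Z p) N" using pp_cover(2)[OF cov Z N] by simp
  have i: "i \<in> Hom X (Ker Y Z p)"
    by (rule hom_corestrict[OF S(4)]) (use homD(1)[OF S(4)] S(9) in auto)
  obtain r where r: "r \<in> Hom (Ker Y Z p) X" "\<And>x. x \<in> carrier (Ker Y Z p) \<Longrightarrow> i (r x) = x"
    by (rule ses_factor_in[OF s hom_incl _ coverD(6)[OF cov]]) (auto intro: that)
  have "r (i x) = x" if x: "x \<in> carrier X" for x
    by (rule inj_onD[OF S(5)])
      (use r(2)[OF homD(1)[OF i x]] x homD(1)[OF r(1) homD(1)[OF i x]] in simp_all)
  then show ?thesis by (rule pp_retract[OF K i r(1) _ S(1) N])
next
  case (Suc m)
  obtain P :: "'a fmodule" and e
    where P: "cover P e Y" "extr P e Y N" "pp (n - 1) (Ker P Y e) N"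
    by (rule pp_obtain_cover[OF Y N])
  obtain t where cov: "cover P (\<lambda>x. p (e x)) Z"
    and t: "ses (Ker P Y e) (Ker P Z (\<lambda>x. p (e x))) X (\<lambda>x. x) t"
    by (rule ses_syzygy[OF s P(1)]) (rule that)
  have "pp (Suc m) X N"
  proof (rule pp_cokernel[OF t _ _ N])
    show "pp m (Ker P Y e) N" using P(3) Suc by simp
    show "pp (Suc m) (Ker P Z (\<lambda>x. p (e x))) N" using pp_cover(2)[OF cov Z N] Suc by simp
    fix g assume "g \<in> Hom (Ker P Y e) N"
    then obtain h where h: "h \<in> Hom P N" "\<And>x. x \<in> carrier P \<Longrightarrow> e x = \<zero>\<^bsub>Y\<^esub> \<Longrightarrow> h x = g x"
      by (rule extrD[OF P(2)]) (rule that)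
    then show "\<exists>h\<in>Hom (Ker P Z (\<lambda>x. p (e x))) N. \<forall>x\<in>carrier (Ker P Y e). h x = g x"
      by (intro bexI[OF _ hom_restrict[OF h(1)]]) auto
  qed
  then show ?thesis by (simp add: Suc)
qed

section \<open>Dimension shifting in the second variable\<close>

text \<open>A presentation that puts \<open>N\<close> into \<open>Fac\<^sub>m(Q)\<close>, with no restriction on the carrier type of the
  \<open>P\<^sub>i\<close>, and also meaningful for \<open>m = 0\<close>.\<close>

definition fac :: "('a, 'q) module \<Rightarrow> nat \<Rightarrow> ('a, 'n) module \<Rightarrow> (nat \<Rightarrow> ('a, 'p) module) \<Rightarrow>
    ('p \<Rightarrow> 'n) \<Rightarrow> (nat \<Rightarrow> 'p \<Rightarrow> 'p) \<Rightarrow> bool" where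
  "fac Q m N P e d \<longleftrightarrow> rm N \<and> (\<forall>i<m. in_add A Q (P i)) \<and> (0 < m \<longrightarrow> exact_left A N P e d (m - 1))"

lemma exact_left_mono: "exact_left A N P e d m \<Longrightarrow> k \<le> m \<Longrightarrow> exact_left A N P e d k"
  by (simp add: exact_left_def)

lemma exact_left_shift:
  assumes "exact_left A N P e d (Suc m)"
  shows "exact_left A (Ker (P 0) N e) (\<lambda>i. P (Suc i)) (d 1) (\<lambda>i. d (Suc i)) m"
proof -
  note E = assms[unfolded exact_left_def]
  have d1: "d 1 \<in> Hom (P 1) (P 0)" "d 1 ` carrier (P 1) = carrier (Ker (P 0) N e)"
    using E by auto
  have "kernel_from (Ker (P 0) N e) (\<lambda>i. P (Suc i)) (d 1) (\<lambda>i. d (Suc i)) i = kernel_from N P e d (Suc i)" for i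
    by (cases i) simp_all
  then show ?thesis
    unfolding exact_left_def using E d1 hom_corestrict[OF d1(1)] by simp
qed

lemma fac_mono: "fac Q m N P e d \<Longrightarrow> k \<le> m \<Longrightarrow> fac Q k N P e d"
  by (auto simp: fac_def intro: exact_left_mono)

lemma fac_Suc:
  assumes "fac Q (Suc k) N P e d"
  shows "in_add A Q (P 0)" and "ses (Ker (P 0) N e) (P 0) N (\<lambda>x. x) e"
    and "fac Q k (Ker (P 0) N e) (\<lambda>i. P (Suc i)) (d 1) (\<lambda>i. d (Suc i))"
proof -
  note F = assms[unfolded fac_def]
  show P0: "in_add A Q (P 0)" using F by simp
  show "ses (Ker (P 0) N e) (P 0) N (\<lambda>x. x) e"
    by (rule ses_Ker[OF in_add_rm[OF P0]]) (use F in \<open>simp_all add: exact_left_def\<close>)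
  then have "rm (Ker (P 0) N e)" by (rule sesD)
  then show "fac Q k (Ker (P 0) N e) (\<lambda>i. P (Suc i)) (d 1) (\<lambda>i. d (Suc i))"
    unfolding fac_def using F exact_left_shift[of N P e d "k - 1"] by simp
qed

text \<open>Let L be the kernel of \<open>P 0\<close> -> \<open>N\<close> and K the syzygy of
  \<open>M\<close>. A map K -> N lifts to \<open>P 0\<close> because Ext^1(K, L) = 0 (this is
  \<open>IH2\<close>, as L has a presentation shorter by one term), and the lift extends to the
  cover because Ext^1(M, P 0) = 0. The syzygy itself is handled by \<open>IH1\<close>, for the same
  \<open>N\<close> with one term of its presentation forgotten.\<close>

lemma pp_fac_Suc:
  fixes N :: "('a, 'n) module" and Q :: "('a, 'q) module"
  assumes M: "pp (Suc k) M Q" and Q: "rm Q" and F: "fac Q (Suc k) N P e d"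
    and IH1: "\<And>K :: 'a fmodule. pp k K Q \<Longrightarrow> pp k K N"
    and IH2: "\<And>K :: 'a fmodule. pp k K Q \<Longrightarrow> pp k K (Ker (P 0) N e)"
  shows "pp (Suc k) M N"
proof -
  note FS = fac_Suc[OF F]
  note N = sesD(3)[OF FS(2)]
  obtain R :: "'a fmodule" and q
    where R: "cover R q M" "extr R q M Q" "pp (Suc k - 1) (Ker R M q) Q"
    by (rule pp_obtain_cover[OF M Q])
  have K: "pp k (Ker R M q) Q" using R(3) by simp
  have ext0: "extr R q M (P 0)"
    by (rule extr_second[OF R(1,2) Q in_add_rm[OF FS(1)] in_add_thru[OF FS(1) Q]])
  have "extr R q M N"
  proof (rule extrI)
    fix g assume g: "g \<in> Hom (Ker R M q) N"
    obtain g' where g': "g' \<in> Hom (Ker R M q) (P 0)" "\<And>x. x \<in> carrier (Ker R M q) \<Longrightarrow> e (g' x) = g x"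
      by (rule pp_lift[OF FS(2) IH2[OF K] g]) (rule that)
    obtain h where h: "h \<in> Hom R (P 0)" "\<And>x. x \<in> carrier R \<Longrightarrow> q x = \<zero>\<^bsub>M\<^esub> \<Longrightarrow> h x = g' x"
      by (rule extrD[OF ext0 g'(1)]) (rule that)
    show "\<exists>h\<in>Hom R N. \<forall>x\<in>carrier R. q x = \<zero>\<^bsub>M\<^esub> \<longrightarrow> h x = g x"
      by (rule bexI[OF _ hom_comp[OF h(1) sesD(6)[OF FS(2)]]]) (simp add: h(2) g'(2))
  qed
  then show ?thesis by (rule pp_SucI[OF R(1) _ IH1[OF K] N])
qed

text \<open>In the recursion \<open>N\<close> turns into a kernel inside \<open>P 0\<close>, so here
  it lives on the type of the \<open>P i\<close>; \<open>pp_fac_V\<close> frees the carrier of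
  \<open>N\<close>, and \<open>pp_fac\<close> that of \<open>M\<close>.\<close>

lemma pp_fac_U:
  fixes M :: "'a fmodule" and N :: "('a, 'p) module" and P :: "nat \<Rightarrow> ('a, 'p) module"
  assumes "pp m M Q" "rm Q" "fac Q m N P e d"
  shows "pp m M N"
  using assms(1,3)
proof (induction m arbitrary: M N P e d)
  case (Suc k)
  show ?case
    by (rule pp_fac_Suc[OF Suc.prems(1) assms(2) Suc.prems(2)])
       (erule Suc.IH[OF _ fac_mono[OF Suc.prems(2)]], simp, erule Suc.IH[OF _ fac_Suc(3)[OF Suc.prems(2)]])
qed simp

lemma pp_fac_V:
  fixes M :: "'a fmodule"
  assumes "pp m M Q" "rm Q" "fac Q m N P e d"
  shows "pp m M N"
  using assms(1,3)
proof (induction m arbitrary: M)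
  case (Suc k)
  show ?case
    by (rule pp_fac_Suc[OF Suc.prems(1) assms(2) Suc.prems(2)])
       (erule Suc.IH[OF _ fac_mono[OF Suc.prems(2)]], simp,
        erule pp_fac_U[OF _ assms(2) fac_Suc(3)[OF Suc.prems(2)]])
qed simp

lemma pp_fac:
  assumes "pp m M Q" "rm Q" "fac Q m N P e d"
  shows "pp m M N"
proof (cases m)
  case (Suc k)
  note F = assms(3)[unfolded Suc]
  show ?thesis unfolding Suc
    by (rule pp_fac_Suc[OF assms(1)[unfolded Suc] assms(2) F])
       (erule pp_fac_V[OF _ assms(2) fac_mono[OF F]], simp, erule pp_fac_U[OF _ assms(2) fac_Suc(3)[OF F]])
qed (use assms in simp)

section \<open>Projective resolutions\<close>

text \<open>Since there are no extensions by the zero module, \<open>pp n M zm\<close> means \<open>pd M \<le> n\<close>.\<close>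

definition zm :: "('a, 'a) module" where
  "zm = reg\<lparr>carrier := {\<zero>\<^bsub>A\<^esub>}\<rparr>"

lemma zero_carrier_rm:
  assumes "rm M"
  shows "rm (M\<lparr>carrier := {\<zero>\<^bsub>M\<^esub>}\<rparr>)" and "zero_module (M\<lparr>carrier := {\<zero>\<^bsub>M\<^esub>}\<rparr>)"
proof -
  have "submodule {\<zero>\<^bsub>M\<^esub>} A M" using assms by (simp add: submodule_iff)
  then show "rm (M\<lparr>carrier := {\<zero>\<^bsub>M\<^esub>}\<rparr>)" by (rule rm_submodule[OF assms])
  show "zero_module (M\<lparr>carrier := {\<zero>\<^bsub>M\<^esub>}\<rparr>)" by (simp add: zero_module_def)
qed

lemma rm_zm: "rm zm"
  using zero_carrier_rm(1)[OF rm_regular] by (simp add: zm_def)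

text \<open>Exactness of \<open>Hom(P\<^sub>\<bullet>, N)\<close> in degree \<open>Suc j\<close>.\<close>

definition coexact :: "(nat \<Rightarrow> ('a, 'p) module) \<Rightarrow> (nat \<Rightarrow> 'p \<Rightarrow> 'p) \<Rightarrow> ('a, 'n) module \<Rightarrow> nat \<Rightarrow> bool" where
  "coexact P d N j \<longleftrightarrow>
     (\<forall>f\<in>Hom (P (Suc j)) N. (\<forall>x\<in>carrier (P (Suc (Suc j))). f (d (Suc (Suc j)) x) = \<zero>\<^bsub>N\<^esub>) \<longrightarrow>
       (\<exists>g\<in>Hom (P j) N. \<forall>x\<in>carrier (P (Suc j)). f x = g (d (Suc j) x)))"

section \<open>Resolutions and the exactness of Hom into a module\<close>

lemma resolution_cover:
  assumes "proj_resolution A M P e d" "rm M"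
  shows "cover (P 0) e M"
proof -
  have "exact_left A M P e d 0" "in_add A reg (P 0)" using assms(1) unfolding proj_resolution_def by blast+
  then show ?thesis using assms(2) by (simp add: cover_def exact_left_def)
qed

lemma resolution_shift:
  assumes "proj_resolution A M P e d"
  shows "proj_resolution A (Ker (P 0) M e) (\<lambda>i. P (Suc i)) (d 1) (\<lambda>i. d (Suc i))"
proof -
  have "exact_left A M P e d (Suc m)" "in_add A reg (P i)" for m i
    using assms unfolding proj_resolution_def by blast+
  then show ?thesis unfolding proj_resolution_def using exact_left_shift by blast
qed

lemma resolution_d1:
  assumes "proj_resolution A M P e d"
  shows "d 1 \<in> Hom (P 1) (Ker (P 0) M e)" and "d 1 ` carrier (P 1) = carrier (Ker (P 0) M e)"
    and "\<And>x. x \<in> carrier (P 1) \<Longrightarrow> d 1 x = \<zero>\<^bsub>P 0\<^esub> \<Longrightarrow> \<exists>y\<in>carrier (P 2). x = d 2 y"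
    and "\<And>y. y \<in> carrier (P 2) \<Longrightarrow> d 2 y \<in> carrier (P 1) \<and> d 1 (d 2 y) = \<zero>\<^bsub>P 0\<^esub>"
proof -
  have E: "exact_left A M P e d 2" using assms unfolding proj_resolution_def by blast
  have 1: "d 1 \<in> Hom (P 1) (P 0)" "d 1 ` carrier (P 1) = {x \<in> carrier (P 0). e x = \<zero>\<^bsub>M\<^esub>}"
    and 2: "d 2 ` carrier (P 2) = {x \<in> carrier (P 1). d 1 x = \<zero>\<^bsub>P 0\<^esub>}"
    using E[unfolded exact_left_def] by (auto simp: numeral_2_eq_2)
  show "d 1 \<in> Hom (P 1) (Ker (P 0) M e)" using hom_corestrict[OF 1(1)] 1(2) by simp
  show "d 1 ` carrier (P 1) = carrier (Ker (P 0) M e)" using 1(2) by simp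
  show "\<exists>y\<in>carrier (P 2). x = d 2 y" if "x \<in> carrier (P 1)" "d 1 x = \<zero>\<^bsub>P 0\<^esub>" for x
  proof -
    have "x \<in> d 2 ` carrier (P 2)" using 2 that by simp
    then show ?thesis by auto
  qed
  show "d 2 y \<in> carrier (P 1) \<and> d 1 (d 2 y) = \<zero>\<^bsub>P 0\<^esub>" if "y \<in> carrier (P 2)" for y
    using 2 that by auto
qed

text \<open>\<open>P 1\<close> maps onto the kernel of \<open>e\<close>, so a map on that kernel
  gives a 1-cocycle on \<open>P 1\<close>; writing it as a coboundary is extending the map to
  \<open>P 0\<close>.\<close>

lemma extr_of_coexact:
  assumes res: "proj_resolution A M P e d" and "rm M" "rm N" and co: "coexact P d N 0"
  shows "extr (P 0) e M N"
proof (rule extrI)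
  note P = coverD[OF resolution_cover[OF res assms(2)]] and D = resolution_d1[OF res]
  fix g assume g: "g \<in> Hom (Ker (P 0) M e) N"
  have "g (d 1 (d 2 y)) = \<zero>\<^bsub>N\<^esub>" if "y \<in> carrier (P 2)" for y
    using D(4)[OF that] hom_zero[OF g P(6) assms(3)] by simp
  with co hom_comp[OF D(1) g] obtain h where h: "h \<in> Hom (P 0) N"
    "\<And>x. x \<in> carrier (P 1) \<Longrightarrow> g (d 1 x) = h (d 1 x)"
    unfolding coexact_def by (auto simp: numeral_2_eq_2)
  have "h x = g x" if x: "x \<in> carrier (P 0)" "e x = \<zero>\<^bsub>M\<^esub>" for x
  proof -
    have "x \<in> d 1 ` carrier (P 1)" using D(2) x by simp
    then show ?thesis using h(2) by auto
  qed
  then show "\<exists>h\<in>Hom (P 0) N. \<forall>x\<in>carrier (P 0). e x = \<zero>\<^bsub>M\<^esub> \<longrightarrow> h x = g x"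
    by (intro bexI[OF _ h(1)]) simp
qed

lemma coexact_shift: "coexact (\<lambda>i. P (Suc i)) (\<lambda>i. d (Suc i)) N j = coexact P d N (Suc j)"
  by (simp add: coexact_def)

text \<open>Exactness is tested only in the cohomological degrees 1 to \<open>n\<close>; after
  \<open>n\<close> steps the syzygy is projective by the second hypothesis.\<close>

lemma pp_of_coexact_U:
  fixes M :: "'a fmodule" and P :: "nat \<Rightarrow> 'a fmodule"
  assumes "proj_resolution A M P e d" "pp n M Z" "rm Z" "rm M" "rm N" "\<And>j. j < n \<Longrightarrow> coexact P d N j"
  shows "pp n M N"
  using assms(1,2,4,6)
proof (induction n arbitrary: M P e d)
  case (Suc n)
  note cov = resolution_cover[OF Suc.prems(1,3)]
  have "pp n (Ker (P 0) M e) N"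
    by (rule Suc.IH[OF resolution_shift[OF Suc.prems(1)] _ coverD(6)[OF cov]])
       (use pp_cover(2)[OF cov Suc.prems(2) assms(3)] Suc.prems(4) in \<open>simp_all add: coexact_shift\<close>)
  then show ?case
    by (intro pp_SucI[OF cov extr_of_coexact[OF Suc.prems(1,3) assms(5) Suc.prems(4)]] assms(5)) simp
qed simp

lemma pp_of_coexact:
  fixes P :: "nat \<Rightarrow> 'a fmodule"
  assumes "proj_resolution A M P e d" "pp n M Z" "rm Z" "rm M" "rm N" "\<And>j. j < n \<Longrightarrow> coexact P d N j"
  shows "pp n M N"
proof (cases n)
  case (Suc m)
  note cov = resolution_cover[OF assms(1,4)]
  have "pp m (Ker (P 0) M e) N"
    by (rule pp_of_coexact_U[OF resolution_shift[OF assms(1)] _ assms(3) coverD(6)[OF cov] assms(5)])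
       (use pp_cover(2)[OF cov assms(2,3)] assms(6) Suc in \<open>simp_all add: coexact_shift\<close>)
  then show ?thesis unfolding Suc
    by (intro pp_SucI[OF cov extr_of_coexact[OF assms(1,4,5) assms(6)]] assms(5)) (simp_all add: Suc)
qed (use assms in simp)

lemma coexact_of_pp_0:
  assumes res: "proj_resolution A M P e d" and M: "pp n M N" and N: "rm N"
  shows "coexact P d N 0"
  unfolding coexact_def
proof (intro ballI impI)
  note cov = resolution_cover[OF res pp_rm[OF M]]
  note P = coverD[OF cov] and D = resolution_d1[OF res]
  have P1: "rm (P 1)" using res in_add_rm unfolding proj_resolution_def by blast
  fix f assume f: "f \<in> Hom (P (Suc 0)) N"
    and f0: "\<forall>x\<in>carrier (P (Suc (Suc 0))). f (d (Suc (Suc 0)) x) = \<zero>\<^bsub>N\<^esub>"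
  have ker: "f x = \<zero>\<^bsub>N\<^esub>" if "x \<in> carrier (P 1)" "d 1 x = \<zero>\<^bsub>Ker (P 0) M e\<^esub>" for x
    using D(3)[of x] that f0 by (auto simp: numeral_2_eq_2)
  have f': "f \<in> Hom (P 1) N" using f by simp
  obtain g where g: "g \<in> Hom (Ker (P 0) M e) N" "\<And>x. x \<in> carrier (P 1) \<Longrightarrow> g (d 1 x) = f x"
    by (rule factor_surj[OF P1 N P(6) D(1,2) f' ker]) (auto intro: that)
  obtain h where h: "h \<in> Hom (P 0) N" "\<And>x. x \<in> carrier (P 0) \<Longrightarrow> e x = \<zero>\<^bsub>M\<^esub> \<Longrightarrow> h x = g x"
    by (rule extrD[OF pp_cover(1)[OF cov M N] g(1)]) (rule that)
  have "f x = h (d 1 x)" if x: "x \<in> carrier (P 1)" for x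
    using homD(1)[OF D(1) x] h(2)[of "d 1 x"] g(2)[OF x] by simp
  then show "\<exists>g\<in>Hom (P 0) N. \<forall>x\<in>carrier (P (Suc 0)). f x = g (d (Suc 0) x)"
    by (intro bexI[OF _ h(1)]) simp
qed

lemma coexact_of_pp_U:
  fixes M :: "'a fmodule" and P :: "nat \<Rightarrow> 'a fmodule"
  assumes "proj_resolution A M P e d" "pp n M N" "rm N"
  shows "coexact P d N j"
  using assms(1,2)
proof (induction j arbitrary: M P e d n)
  case 0
  then show ?case by (intro coexact_of_pp_0 assms(3))
next
  case (Suc j)
  show ?case
    unfolding coexact_shift[symmetric]
    by (rule Suc.IH[OF resolution_shift[OF Suc.prems(1)]
          pp_cover(2)[OF resolution_cover[OF Suc.prems(1) pp_rm[OF Suc.prems(2)]] Suc.prems(2) assms(3)]])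
qed

lemma coexact_of_pp:
  fixes P :: "nat \<Rightarrow> 'a fmodule"
  assumes "proj_resolution A M P e d" "pp n M N" "rm N"
  shows "coexact P d N j"
proof (cases j)
  case 0
  then show ?thesis using coexact_of_pp_0[OF assms] by simp
next
  case (Suc k)
  show ?thesis
    unfolding Suc coexact_shift[symmetric]
    by (rule coexact_of_pp_U[OF resolution_shift[OF assms(1)]
          pp_cover(2)[OF resolution_cover[OF assms(1) pp_rm[OF assms(2)]] assms(2,3)] assms(3)])
qed

section \<open>Finite projective resolutions\<close>

lemma pp_of_finite_resolution_0:
  assumes res: "proj_resolution A M P e d" and zero: "zero_module (P 1)" and M: "rm M"
  shows "in_add A reg M"
proof -
  note P = coverD[OF resolution_cover[OF res M]] and D = resolution_d1[OF res]
  have P1: "rm (P 1)" using res in_add_rm unfolding proj_resolution_def by blast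
  have d0: "d 1 \<zero>\<^bsub>P 1\<^esub> = \<zero>\<^bsub>P 0\<^esub>" using hom_zero[OF D(1) P1 P(6)] by simp
  have "x = \<zero>\<^bsub>P 0\<^esub>" if "x \<in> carrier (P 0)" "e x = \<zero>\<^bsub>M\<^esub>" for x
  proof -
    have "x \<in> d 1 ` carrier (P 1)" using D(2) that by simp
    then show ?thesis using zero d0 by (simp add: zero_module_def)
  qed
  then have "inj_on e (carrier (P 0))" using hom_inj_iff[OF P(3,1,4)] by simp
  then have bij: "bij_betw e (carrier (P 0)) (carrier M)" using P(5) by (simp add: bij_betw_def)
  obtain g where g: "g \<in> Hom M (P 0)" "\<And>y. y \<in> carrier M \<Longrightarrow> e (g y) = y"
    by (rule mod_iso_inverse[OF P(3,1,4) bij]) (rule that)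
  show ?thesis by (rule in_add_retract[OF P(2) rm_regular M g(1) P(4)]) (erule g(2))
qed

lemma extr_zm: "cover P e M \<Longrightarrow> extr P e M zm"
  by (rule extrI, rule bexI[OF _ hom_const_zero[OF rm_zm]]) (auto simp: zm_def dest: homD(1))

lemma pp_of_finite_resolution_U:
  fixes M :: "'a fmodule" and P :: "nat \<Rightarrow> 'a fmodule"
  assumes "proj_resolution A M P e d" "\<And>i. i > n \<Longrightarrow> zero_module (P i)" "rm M"
  shows "pp n M zm"
  using assms
proof (induction n arbitrary: M P e d)
  case 0
  then show ?case using pp_of_finite_resolution_0[OF 0(1) _ 0(3)] by simp
next
  case (Suc n)
  note cov = resolution_cover[OF Suc.prems(1,3)]
  have "pp n (Ker (P 0) M e) zm"
    by (rule Suc.IH[OF resolution_shift[OF Suc.prems(1)] _ coverD(6)[OF cov]]) (simp add: Suc.prems(2))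
  then show ?case by (rule pp_SucI[OF cov extr_zm[OF cov] _ rm_zm])
qed

lemma pp_of_finite_resolution:
  fixes P :: "nat \<Rightarrow> 'a fmodule"
  assumes "proj_resolution A M P e d" "\<And>i. i > n \<Longrightarrow> zero_module (P i)" "rm M"
  shows "pp n M zm"
proof (cases n)
  case 0
  then show ?thesis using pp_of_finite_resolution_0[OF assms(1) _ assms(3)] assms(2) by simp
next
  case (Suc m)
  note cov = resolution_cover[OF assms(1,3)]
  have "pp m (Ker (P 0) M e) zm"
    by (rule pp_of_finite_resolution_U[OF resolution_shift[OF assms(1)] _ coverD(6)[OF cov]])
       (simp add: assms(2) Suc)
  then show ?thesis unfolding Suc by (rule pp_SucI[OF cov extr_zm[OF cov] _ rm_zm])
qed

lemma finite_resolution_0: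
  fixes M :: "('a, 'm) module"
  assumes M: "in_add A reg M"
  shows "\<exists>(P :: nat \<Rightarrow> 'a fmodule) e d. proj_resolution A M P e d \<and> (\<forall>i>0. zero_module (P i))"
proof -
  obtain M' :: "'a fmodule" and \<phi> \<psi>
    where M': "rm M'" "\<phi> \<in> Hom M M'" "\<psi> \<in> Hom M' M"
      "\<And>x. x \<in> carrier M \<Longrightarrow> \<psi> (\<phi> x) = x" "\<And>x. x \<in> carrier M' \<Longrightarrow> \<phi> (\<psi> x) = x"
    by (rule in_add_copy[OF M rm_regular]) (rule that)
  note rmM = in_add_rm[OF M]
  \<comment> \<open>The zero submodule of \<open>M'\<close> shares the zero of \<open>M'\<close>, so
    one constant map can serve as every differential.\<close>
  let ?Z = "M'\<lparr>carrier := {\<zero>\<^bsub>M'\<^esub>}\<rparr>"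
  define P where "P = (\<lambda>i :: nat. if i = 0 then M' else ?Z)"
  define d :: "nat \<Rightarrow> (nat \<Rightarrow> 'a) \<Rightarrow> (nat \<Rightarrow> 'a)" where "d = (\<lambda>_ _. \<zero>\<^bsub>M'\<^esub>)"
  note Z = zero_carrier_rm[OF M'(1)]
  have M'p: "in_add A reg M'" 
    by (rule in_add_retract[OF M rm_regular M'(1,3,2)]) (erule M'(5))
  have proj: "in_add A reg (P i)" for i
    using M'p in_add_zero[OF rm_regular Z] by (simp add: P_def)
  have surj: "\<psi> ` carrier M' = carrier M"
    using M'(4) homD(1)[OF M'(3)] homD(1)[OF M'(2)] by force
  have inj: "x = \<zero>\<^bsub>M'\<^esub>" if "x \<in> carrier M'" "\<psi> x = \<zero>\<^bsub>M\<^esub>" for x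
    using M'(5)[OF that(1)] that(2) hom_zero[OF M'(2) rmM M'(1)] by simp
  have d: "d (Suc i) \<in> Hom (P (Suc i)) (P i)" for i
    unfolding d_def by (rule homI) (use M'(1) Z(1) in \<open>simp_all add: P_def\<close>)
  have ker: "d (Suc i) ` carrier (P (Suc i)) = kernel_from M P \<psi> d i" for i
    using inj hom_zero[OF M'(3,1) rmM] M'(1) by (cases i) (auto simp: P_def d_def)
  have "proj_resolution A M P \<psi> d"
    unfolding proj_resolution_def exact_left_def
    using proj d ker M'(3) surj by (simp add: P_def)
  moreover have "\<forall>i>0. zero_module (P i)" using Z(2) by (simp add: P_def)
  ultimately show ?thesis by blast
qed

lemma finite_resolution_Suc:
  fixes M :: "('a, 'm) module" and P0 :: "'a fmodule" and P' :: "nat \<Rightarrow> 'a fmodule"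
  assumes cov: "cover P0 q M" and res: "proj_resolution A (Ker P0 M q) P' e' d'" "\<forall>i>n. zero_module (P' i)"
  shows "\<exists>(P :: nat \<Rightarrow> 'a fmodule) e d. proj_resolution A M P e d \<and> (\<forall>i>Suc n. zero_module (P i))"
proof -
  note C = coverD[OF cov]
  define P where "P = (\<lambda>i. case i of 0 \<Rightarrow> P0 | Suc i \<Rightarrow> P' i)"
  \<comment> \<open>Index 1 holds the splice: the augmentation onto the kernel, read as a map into
    \<open>P0\<close>. The value at index 0 is arbitrary.\<close>
  define d where "d = (\<lambda>i. case i of 0 \<Rightarrow> e' | Suc 0 \<Rightarrow> e' | Suc (Suc i) \<Rightarrow> d' (Suc i))"
  have E: "e' \<in> Hom (P' 0) (Ker P0 M q)" "e' ` carrier (P' 0) = carrier (Ker P0 M q)"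
    "\<And>i. d' (Suc i) \<in> Hom (P' (Suc i)) (P' i)"
    "\<And>i. d' (Suc i) ` carrier (P' (Suc i)) = kernel_from (Ker P0 M q) P' e' d' i"
    and proj: "\<And>i. in_add A reg (P' i)"
    using res(1) unfolding proj_resolution_def exact_left_def by (blast intro: lessI)+
  have "in_add A reg (P i)" for i using proj C(2) by (cases i) (simp_all add: P_def)
  moreover have "d (Suc i) \<in> Hom (P (Suc i)) (P i)" for i
    using E(3) hom_uncorestrict[OF E(1)] by (cases i) (auto simp: P_def d_def)
  moreover have "d (Suc i) ` carrier (P (Suc i)) = kernel_from M P q d i" for i
  proof (cases i)
    case 0
    then show ?thesis using E(2) by (simp add: P_def d_def)
  next
    case (Suc j)
    then show ?thesis using E(4)[of j] by (cases j) (simp_all add: P_def d_def)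
  qed
  ultimately have "proj_resolution A M P q d"
    unfolding proj_resolution_def exact_left_def using C(4,5) by (simp add: P_def)
  moreover have "\<forall>i>Suc n. zero_module (P i)"
    using res(2) by (auto simp: P_def split: nat.split)
  ultimately show ?thesis by blast
qed

lemma finite_resolution_U:
  fixes M :: "'a fmodule"
  assumes "pp n M N" "rm N"
  shows "\<exists>(P :: nat \<Rightarrow> 'a fmodule) e d. proj_resolution A M P e d \<and> (\<forall>i>n. zero_module (P i))"
  using assms(1)
proof (induction n arbitrary: M)
  case 0
  then show ?case by (intro finite_resolution_0) simp
next
  case (Suc n)
  obtain P :: "'a fmodule" and e
    where P: "cover P e M" "extr P e M N" "pp (Suc n - 1) (Ker P M e) N"
    by (rule pp_obtain_cover[OF Suc.prems assms(2)])
  then have "pp n (Ker P M e) N" by simp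
  from Suc.IH[OF this] show ?case using finite_resolution_Suc[OF P(1)] by blast
qed

lemma finite_resolution:
  fixes M :: "('a, 'm) module"
  assumes "pp n M N" "rm N"
  shows "\<exists>(P :: nat \<Rightarrow> 'a fmodule) e d. proj_resolution A M P e d \<and> (\<forall>i>n. zero_module (P i))"
proof (cases n)
  case 0
  then show ?thesis using finite_resolution_0[of M] assms(1) by simp
next
  case (Suc m)
  obtain P :: "'a fmodule" and e
    where P: "cover P e M" "extr P e M N" "pp (n - 1) (Ker P M e) N"
    by (rule pp_obtain_cover[OF assms])
  then have "pp m (Ker P M e) N" using Suc by simp
  from finite_resolution_U[OF this assms(2)] show ?thesis
    unfolding Suc using finite_resolution_Suc[OF P(1)] by blast
qed

section \<open>The defined \<open>pd\<close> and \<open>Ext\<close> in terms of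
  \<open>pp\<close>\<close>

lemma pd_le_imp_resolution:
  fixes M :: "('a, 'm) module"
  assumes "pd A M \<le> enat n"
  shows "\<exists>(P :: nat \<Rightarrow> 'a fmodule) e d. proj_resolution A M P e d \<and> (\<forall>i>n. zero_module (P i))"
proof -
  let ?S = "{enat n | n. \<exists>(P :: nat \<Rightarrow> 'a fmodule) e d.
    proj_resolution A M P e d \<and> (\<forall>i>n. zero_module (P i))}"
  \<comment> \<open>The infimum of the empty set would be infinite; for a nonempty set of extended
    naturals the infimum is attained.\<close>
  have "?S \<noteq> {}"
  proof
    assume "?S = {}"
    then have "pd A M = Inf {}" unfolding pd_def by (simp only:)
    then show False using assms by (simp add: Inf_enat_def)
  qed
  then have "Inf ?S \<in> ?S" unfolding Inf_enat_def by (metis (mono_tags, lifting) LeastI all_not_in_conv)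
  then have "pd A M \<in> ?S" unfolding pd_def .
  then obtain m and P :: "nat \<Rightarrow> 'a fmodule" and e d
    where m: "pd A M = enat m" "proj_resolution A M P e d" "\<forall>i>m. zero_module (P i)" by blast
  then have "m \<le> n" using assms by simp
  then have "\<forall>i>n. zero_module (P i)" using m(3) by simp
  then show ?thesis using m(2) by blast
qed

lemma pp_of_pd: "pd A M \<le> enat n \<Longrightarrow> rm M \<Longrightarrow> pp n M zm"
  using pd_le_imp_resolution pp_of_finite_resolution by blast

lemma pd_of_pp:
  assumes "pp n M N" "rm N"
  shows "pd A M \<le> enat n"
  unfolding pd_def by (rule Inf_lower) (use finite_resolution[OF assms] in blast)

text \<open>The resolution obtained is the very one chosen inside \<open>Ext\<close>, a true
  resolution because some resolution exists. Cosets are computed by hand in the Hom group, so that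
  triviality of the quotient becomes the equality of cocycles and coboundaries.\<close>

lemma trivial_Ext_iff:
  fixes M :: "('a, 'm) module" and N :: "('a, 'n) module"
  assumes M: "\<exists>(P :: nat \<Rightarrow> 'a fmodule) e d. proj_resolution A M P e d" and N: "rm N"
  obtains P :: "nat \<Rightarrow> 'a fmodule" and e d where "proj_resolution A M P e d"
    "\<And>j. trivial_group (Ext A (Suc j) M N) \<longleftrightarrow> coexact P d N j"
proof -
  define c :: "(nat \<Rightarrow> 'a fmodule) \<times> ((nat \<Rightarrow> 'a) \<Rightarrow> 'm) \<times> (nat \<Rightarrow> (nat \<Rightarrow> 'a) \<Rightarrow> (nat \<Rightarrow> 'a))"
    where "c = (SOME (P, e, d). proj_resolution A M P e d)"
  obtain P e d where c: "c = (P, e, d)" by (cases c) auto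
  have "\<exists>c. case c of (P :: nat \<Rightarrow> 'a fmodule, e, d) \<Rightarrow> proj_resolution A M P e d" using M by simp
  from someI_ex[OF this] have res: "proj_resolution A M P e d"
    using c unfolding c_def[symmetric] by simp
  have rmP: "rm (P i)" for i using res in_add_rm unfolding proj_resolution_def by blast
  have dh: "d (Suc i) \<in> Hom (P (Suc i)) (P i)" for i
    using res unfolding proj_resolution_def exact_left_def by (blast intro: lessI)
  have dd: "d (Suc i) (d (Suc (Suc i)) x) = \<zero>\<^bsub>P i\<^esub>" if "x \<in> carrier (P (Suc (Suc i)))" for i x
  proof -
    have "exact_left A M P e d (Suc (Suc i))" using res unfolding proj_resolution_def by blast
    then have "d (Suc (Suc i)) ` carrier (P (Suc (Suc i))) = kernel_from M P e d (Suc i)"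
      unfolding exact_left_def by blast
    then show ?thesis using that by auto
  qed
  have "trivial_group (Ext A (Suc j) M N) \<longleftrightarrow> coexact P d N j" for j
  proof -
    let ?Q = "P (Suc j)"
    let ?G = "hom_group A ?Q N" and ?Z = "cocycles A P d N (Suc j)" and ?B = "coboundaries A P d N (Suc j)"
    have Ext: "Ext A (Suc j) M N = (?G\<lparr>carrier := ?Z\<rparr>) Mod ?B"
      unfolding Ext_def using c[unfolded c_def] by simp
    have Z_iff: "f \<in> ?Z \<longleftrightarrow> f \<in> Hom ?Q N \<and> f \<in> extensional (carrier ?Q) \<and>
        (\<forall>x\<in>carrier (P (Suc (Suc j))). f (d (Suc (Suc j)) x) = \<zero>\<^bsub>N\<^esub>)" for f
      by (auto simp: cocycles_def hom_group_def)
    have B_iff: "f \<in> ?B \<longleftrightarrow> f \<in> extensional (carrier ?Q) \<and>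
        (\<exists>g\<in>Hom (P j) N. \<forall>x\<in>carrier ?Q. f x = g (d (Suc j) x))" for f
    proof
      assume "f \<in> ?B"
      then obtain g where "g \<in> Hom (P j) N" "f = compose (carrier ?Q) g (d (Suc j))"
        by (auto simp: hom_group_def)
      then show "f \<in> extensional (carrier ?Q) \<and> (\<exists>g\<in>Hom (P j) N. \<forall>x\<in>carrier ?Q. f x = g (d (Suc j) x))"
        by (intro conjI bexI[of _ g]) (simp_all add: compose_def)
    next
      assume "f \<in> extensional (carrier ?Q) \<and> (\<exists>g\<in>Hom (P j) N. \<forall>x\<in>carrier ?Q. f x = g (d (Suc j) x))"
      then obtain g where fe: "f \<in> extensional (carrier ?Q)" and g: "g \<in> Hom (P j) N"
        "\<And>x. x \<in> carrier ?Q \<Longrightarrow> f x = g (d (Suc j) x)" by auto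
      have "restrict g (carrier (P j)) \<in> Hom (P j) N"
        by (rule hom_cong[OF g(1) rmP]) simp
      then have r: "restrict g (carrier (P j)) \<in> carrier (hom_group A (P j) N)" by (simp add: hom_group_def)
      have "f = compose (carrier ?Q) (restrict g (carrier (P j))) (d (Suc j))"
        by (rule extensionalityI[OF fe]) (simp_all add: g(2) compose_def homD(1)[OF dh])
      then show "f \<in> ?B" using r by simp
    qed
    have zero_B: "\<one>\<^bsub>?G\<^esub> \<in> ?B"
      unfolding B_iff
      by (intro conjI bexI[of _ "\<lambda>_. \<zero>\<^bsub>N\<^esub>"]) (simp_all add: hom_group_def hom_const_zero[OF N])
    have one_mult: "\<one>\<^bsub>?G\<^esub> \<otimes>\<^bsub>?G\<^esub> f = f" if "f \<in> ?Z" for f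
      by (rule extensionalityI[of _ "carrier ?Q"])
        (use that N homD(1)[of f ?Q N] in \<open>auto simp: Z_iff hom_group_def\<close>)
    have carrier_Ext: "carrier (Ext A (Suc j) M N) = (\<lambda>f. (\<lambda>h. h \<otimes>\<^bsub>?G\<^esub> f) ` ?B) ` ?Z"
      unfolding Ext by (auto simp: FactGroup_def RCOSETS_def r_coset_def)
    have one_Ext: "\<one>\<^bsub>Ext A (Suc j) M N\<^esub> = ?B" unfolding Ext by (simp add: FactGroup_def)
    \<comment> \<open>Translation by a cocycle permutes the cocycles. Once cocycles and coboundaries
      coincide, this collapses all cosets to one.\<close>
    have Z_coset: "(\<lambda>h. h \<otimes>\<^bsub>?G\<^esub> f) ` ?Z = ?Z" if f: "f \<in> ?Z" for f
    proof (intro equalityI subsetI)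
      have fh: "f \<in> Hom ?Q N" using f Z_iff by blast
      fix k assume "k \<in> (\<lambda>h. h \<otimes>\<^bsub>?G\<^esub> f) ` ?Z"
      then obtain h where h: "h \<in> ?Z" "k = (\<lambda>x\<in>carrier ?Q. h x \<oplus>\<^bsub>N\<^esub> f x)" by (auto simp: hom_group_def)
      have hh: "h \<in> Hom ?Q N" using h Z_iff by blast
      have "k \<in> Hom ?Q N" by (rule hom_cong[OF hom_add[OF hh fh N] rmP]) (simp add: h(2))
      moreover have "d (Suc (Suc j)) x \<in> carrier ?Q" if "x \<in> carrier (P (Suc (Suc j)))" for x
        using homD(1)[OF dh that] .
      ultimately show "k \<in> ?Z" using h f N by (simp add: Z_iff)
    next
      have fh: "f \<in> Hom ?Q N" using f Z_iff by blast
      fix k assume k: "k \<in> ?Z"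
      then have kh: "k \<in> Hom ?Q N" using Z_iff by blast
      let ?h = "\<lambda>x\<in>carrier ?Q. k x \<oplus>\<^bsub>N\<^esub> neg N (f x)"
      have "?h \<in> Hom ?Q N" by (rule hom_cong[OF hom_sub[OF kh fh N] rmP]) simp
      moreover have "d (Suc (Suc j)) x \<in> carrier ?Q" if "x \<in> carrier (P (Suc (Suc j)))" for x
        using homD(1)[OF dh that] .
      ultimately have "?h \<in> ?Z" using k f N by (simp add: Z_iff)
      moreover have "k = ?h \<otimes>\<^bsub>?G\<^esub> f"
        by (rule extensionalityI[of _ "carrier ?Q"])
          (use k Z_iff homD(1)[OF kh] homD(1)[OF fh] N in \<open>simp_all add: hom_group_def rm_add(4)\<close>)
      ultimately show "k \<in> (\<lambda>h. h \<otimes>\<^bsub>?G\<^esub> f) ` ?Z" by blast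
    qed
    show ?thesis
    proof
      assume "trivial_group (Ext A (Suc j) M N)"
      then have cB: "carrier (Ext A (Suc j) M N) = {?B}" using one_Ext by (simp add: trivial_group_def)
      show "coexact P d N j"
        unfolding coexact_def
      proof (intro ballI impI)
        fix f assume f: "f \<in> Hom ?Q N"
          and f0: "\<forall>x\<in>carrier (P (Suc (Suc j))). f (d (Suc (Suc j)) x) = \<zero>\<^bsub>N\<^esub>"
        let ?f = "restrict f (carrier ?Q)"
        have "?f \<in> Hom ?Q N" by (rule hom_cong[OF f rmP]) simp
        then have fZ: "?f \<in> ?Z" using f0 homD(1)[OF dh] by (simp add: Z_iff)
        have "(\<lambda>h. h \<otimes>\<^bsub>?G\<^esub> ?f) ` ?B \<in> carrier (Ext A (Suc j) M N)"
          unfolding carrier_Ext by (rule image_eqI[OF refl fZ])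
        then have eq: "(\<lambda>h. h \<otimes>\<^bsub>?G\<^esub> ?f) ` ?B = ?B" unfolding cB by (rule singletonD)
        \<comment> \<open>The coset of the cocycle contains the cocycle itself, zero being a
          coboundary; as the coset equals the coboundaries, the cocycle is one.\<close>
        have "\<one>\<^bsub>?G\<^esub> \<otimes>\<^bsub>?G\<^esub> ?f \<in> (\<lambda>h. h \<otimes>\<^bsub>?G\<^esub> ?f) ` ?B" by (rule image_eqI[OF refl zero_B])
        then have "?f \<in> ?B" unfolding eq one_mult[OF fZ] .
        then obtain g where "g \<in> Hom (P j) N" "\<forall>x\<in>carrier ?Q. ?f x = g (d (Suc j) x)"
          unfolding B_iff by (elim conjE bexE)
        then show "\<exists>g\<in>Hom (P j) N. \<forall>x\<in>carrier ?Q. f x = g (d (Suc j) x)"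
          by (intro bexI[of _ g]) simp_all
      qed
    next
      assume co: "coexact P d N j"
      have "?Z = ?B"
      proof (intro equalityI subsetI)
        fix f assume "f \<in> ?Z"
        then show "f \<in> ?B" using co unfolding coexact_def Z_iff B_iff by simp
      next
        fix f assume fB: "f \<in> ?B"
        then obtain g where g: "g \<in> Hom (P j) N" "\<And>x. x \<in> carrier ?Q \<Longrightarrow> f x = g (d (Suc j) x)"
          unfolding B_iff by auto
        have "f \<in> Hom ?Q N" by (rule hom_cong[OF hom_comp[OF dh g(1)] rmP]) (simp add: g(2))
        moreover have "f (d (Suc (Suc j)) x) = \<zero>\<^bsub>N\<^esub>" if "x \<in> carrier (P (Suc (Suc j)))" for x
          using g(2)[OF homD(1)[OF dh that]] dd[OF that] hom_zero[OF g(1) rmP N] by simp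
        ultimately show "f \<in> ?Z" using fB unfolding Z_iff B_iff by simp
      qed
      then have coset: "(\<lambda>h. h \<otimes>\<^bsub>?G\<^esub> f) ` ?B = ?B" if "f \<in> ?Z" for f
        using Z_coset[OF that] by (simp only:)
      have "?Z \<noteq> {}" unfolding \<open>?Z = ?B\<close> using zero_B by (metis empty_iff)
      have "carrier (Ext A (Suc j) M N) = (\<lambda>_. ?B) ` ?Z"
        unfolding carrier_Ext by (rule image_cong[OF refl coset])
      then have car: "carrier (Ext A (Suc j) M N) = {?B}"
        using \<open>?Z \<noteq> {}\<close> by (simp only: image_constant_conv if_False)
      have "?B <#>\<^bsub>?G\<^esub> ?B = (\<Union>f\<in>?Z. (\<lambda>h. h \<otimes>\<^bsub>?G\<^esub> f) ` ?B)"
        unfolding set_mult_def \<open>?Z = ?B\<close> by blast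
      also have "\<dots> = ?B" by (rule SUP_eq_const[OF \<open>?Z \<noteq> {}\<close> coset])
      finally have "?B <#>\<^bsub>?G\<^esub> ?B = ?B" .
      then have mult: "?B \<otimes>\<^bsub>Ext A (Suc j) M N\<^esub> ?B = ?B"
        unfolding Ext by (simp add: FactGroup_def set_mult_def)
      have "group (Ext A (Suc j) M N)"
        by (rule groupI) (simp_all add: car one_Ext mult del: coboundaries.simps)
      then show "trivial_group (Ext A (Suc j) M N)" using car one_Ext by (simp add: trivial_group_def)
    qed
  qed
  with res show thesis by (rule that)
qed

lemma pp_of_Ext:
  assumes "pd A M \<le> enat n" "\<And>i. 1 \<le> i \<Longrightarrow> i \<le> n \<Longrightarrow> trivial_group (Ext A i M N)" "rm M" "rm N"
  shows "pp n M N"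
proof -
  have ex: "\<exists>(P :: nat \<Rightarrow> 'a fmodule) e d. proj_resolution A M P e d"
    using pd_le_imp_resolution[OF assms(1)] by blast
  obtain P :: "nat \<Rightarrow> 'a fmodule" and e d where P: "proj_resolution A M P e d"
    "\<And>j. trivial_group (Ext A (Suc j) M N) \<longleftrightarrow> coexact P d N j"
    by (rule trivial_Ext_iff[OF ex assms(4)]) (rule that)
  show ?thesis
    by (rule pp_of_coexact[OF P(1) pp_of_pd[OF assms(1,3)] rm_zm assms(3,4)])
       (use assms(2) in \<open>simp add: P(2)[symmetric]\<close>)
qed

lemma Ext_of_pp:
  assumes "pp n M N" "rm N" "1 \<le> i"
  shows "trivial_group (Ext A i M N)"
proof -
  have ex: "\<exists>(P :: nat \<Rightarrow> 'a fmodule) e d. proj_resolution A M P e d"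
    using finite_resolution[OF assms(1,2)] by blast
  obtain P :: "nat \<Rightarrow> 'a fmodule" and e d where P: "proj_resolution A M P e d"
    "\<And>j. trivial_group (Ext A (Suc j) M N) \<longleftrightarrow> coexact P d N j"
    by (rule trivial_Ext_iff[OF ex assms(2)]) (rule that)
  show ?thesis
    using P(2)[of "i - 1"] coexact_of_pp[OF P(1) assms(1,2)] assms(3) by simp
qed

section \<open>Transport along isomorphisms\<close>

definition iso_pair :: "('a, 'm) module \<Rightarrow> ('a, 'n) module \<Rightarrow> ('m \<Rightarrow> 'n) \<Rightarrow> ('n \<Rightarrow> 'm) \<Rightarrow> bool" where
  "iso_pair M N \<phi> \<psi> \<longleftrightarrow> rm M \<and> rm N \<and> \<phi> \<in> Hom M N \<and> \<psi> \<in> Hom N M \<and>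
     (\<forall>x\<in>carrier M. \<psi> (\<phi> x) = x) \<and> (\<forall>y\<in>carrier N. \<phi> (\<psi> y) = y)"

lemma iso_pairD:
  assumes "iso_pair M N \<phi> \<psi>"
  shows "rm M" "rm N" "\<phi> \<in> Hom M N" "\<psi> \<in> Hom N M" "x \<in> carrier M \<Longrightarrow> \<psi> (\<phi> x) = x"
    "y \<in> carrier N \<Longrightarrow> \<phi> (\<psi> y) = y" "\<phi> ` carrier M = carrier N" "\<psi> ` carrier N = carrier M"
    "x \<in> carrier M \<Longrightarrow> \<phi> x = \<zero>\<^bsub>N\<^esub> \<longleftrightarrow> x = \<zero>\<^bsub>M\<^esub>" "y \<in> carrier N \<Longrightarrow> \<psi> y = \<zero>\<^bsub>M\<^esub> \<longleftrightarrow> y = \<zero>\<^bsub>N\<^esub>"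
proof -
  show 1: "rm M" "rm N" "\<phi> \<in> Hom M N" "\<psi> \<in> Hom N M"
    using assms by (simp_all add: iso_pair_def)
  have 2: "\<psi> (\<phi> x) = x" if "x \<in> carrier M" for x using assms that by (simp add: iso_pair_def)
  have 3: "\<phi> (\<psi> y) = y" if "y \<in> carrier N" for y using assms that by (simp add: iso_pair_def)
  show "x \<in> carrier M \<Longrightarrow> \<psi> (\<phi> x) = x" "y \<in> carrier N \<Longrightarrow> \<phi> (\<psi> y) = y" using 2 3 by auto
  show "\<phi> ` carrier M = carrier N"
  proof (intro equalityI subsetI)
    show "y \<in> carrier N" if "y \<in> \<phi> ` carrier M" for y using that homD(1)[OF 1(3)] by auto
    show "y \<in> \<phi> ` carrier M" if "y \<in> carrier N" for y
      by (rule image_eqI[of _ _ "\<psi> y"]) (use 3[OF that] homD(1)[OF 1(4) that] in simp_all)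
  qed
  show "\<psi> ` carrier N = carrier M"
  proof (intro equalityI subsetI)
    show "x \<in> carrier M" if "x \<in> \<psi> ` carrier N" for x using that homD(1)[OF 1(4)] by auto
    show "x \<in> \<psi> ` carrier N" if "x \<in> carrier M" for x
      by (rule image_eqI[of _ _ "\<phi> x"]) (use 2[OF that] homD(1)[OF 1(3) that] in simp_all)
  qed
  show "x \<in> carrier M \<Longrightarrow> \<phi> x = \<zero>\<^bsub>N\<^esub> \<longleftrightarrow> x = \<zero>\<^bsub>M\<^esub>"
    using 2[of x] hom_zero[OF 1(4,2,1)] hom_zero[OF 1(3,1,2)] by auto
  show "y \<in> carrier N \<Longrightarrow> \<psi> y = \<zero>\<^bsub>M\<^esub> \<longleftrightarrow> y = \<zero>\<^bsub>N\<^esub>"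
    using 3[of y] hom_zero[OF 1(4,2,1)] hom_zero[OF 1(3,1,2)] by auto
qed

lemma iso_pair_bij: "iso_pair M N \<phi> \<psi> \<Longrightarrow> bij_betw \<phi> (carrier M) (carrier N)"
  by (rule bij_betw_byWitness[of _ \<psi>]) (auto simp: iso_pair_def dest: homD(1))

lemma iso_pair_sym: "iso_pair M N \<phi> \<psi> \<Longrightarrow> iso_pair N M \<psi> \<phi>"
  by (simp add: iso_pair_def)

lemma in_add_iso:
  assumes "in_add A Q X" "rm Q" "iso_pair X Y \<phi> \<psi>"
  shows "in_add A Q Y"
  by (rule in_add_retract[OF assms(1,2) iso_pairD(2,4,3)[OF assms(3)]]) (erule iso_pairD(6)[OF assms(3)])

lemma zero_module_iso:
  assumes "iso_pair X Y \<phi> \<psi>" "zero_module Y"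
  shows "zero_module X"
proof -
  have "carrier X = \<psi> ` {\<zero>\<^bsub>Y\<^esub>}" using iso_pairD(8)[OF assms(1)] assms(2) by (simp add: zero_module_def)
  then show ?thesis
    using hom_zero[OF iso_pairD(4,2,1)[OF assms(1)]] by (simp add: zero_module_def)
qed

lemma in_add_iso_copy:
  fixes Q :: "('a, 'q) module"
  assumes "in_add A Q X" "rm Q"
  obtains X' :: "('a, nat \<Rightarrow> 'q) module" and \<phi> \<psi> where "iso_pair X X' \<phi> \<psi>"
proof -
  obtain X' :: "('a, nat \<Rightarrow> 'q) module" and \<phi> \<psi> where "rm X'" "\<phi> \<in> Hom X X'" "\<psi> \<in> Hom X' X"
    "\<And>x. x \<in> carrier X \<Longrightarrow> \<psi> (\<phi> x) = x" "\<And>x. x \<in> carrier X' \<Longrightarrow> \<phi> (\<psi> x) = x"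
    by (rule in_add_copy[OF assms]) (rule that)
  then have "iso_pair X X' \<phi> \<psi>" using in_add_rm[OF assms(1)] by (simp add: iso_pair_def)
  then show thesis by (rule that)
qed

lemma in_add_iso_copies:
  fixes Q :: "('a, 'q) module"
  assumes "\<And>i. i < m \<Longrightarrow> in_add A Q (X i)" "rm Q"
  obtains X' :: "nat \<Rightarrow> ('a, nat \<Rightarrow> 'q) module" and \<phi> \<psi>
    where "\<And>i. i < m \<Longrightarrow> iso_pair (X i) (X' i) (\<phi> i) (\<psi> i)"
proof -
  have "\<forall>i. \<exists>c. i < m \<longrightarrow> iso_pair (X i) (fst c :: ('a, nat \<Rightarrow> 'q) module) (fst (snd c)) (snd (snd c))"
  proof
    fix i
    show "\<exists>c. i < m \<longrightarrow> iso_pair (X i) (fst c :: ('a, nat \<Rightarrow> 'q) module) (fst (snd c)) (snd (snd c))"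
    proof (cases "i < m")
      case True
      obtain X' :: "('a, nat \<Rightarrow> 'q) module" and \<phi> \<psi> where "iso_pair (X i) X' \<phi> \<psi>"
        by (rule in_add_iso_copy[OF assms(1)[OF True] assms(2)])
      then show ?thesis by (intro exI[of _ "(X', \<phi>, \<psi>)"]) simp
    qed simp
  qed
  from choice[OF this] obtain c where
    "\<forall>i. i < m \<longrightarrow> iso_pair (X i) (fst (c i) :: ('a, nat \<Rightarrow> 'q) module) (fst (snd (c i))) (snd (snd (c i)))" ..
  then show thesis
    by (intro that[of "\<lambda>i. fst (c i)" "\<lambda>i. fst (snd (c i))" "\<lambda>i. snd (snd (c i))"]) simp
qed

text \<open>Conjugation by the isomorphisms. The truncated \<open>i - 1\<close> at
  \<open>i = 0\<close> does no harm, since the map with index 0 is never read.\<close>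

lemma exact_right_copy:
  assumes ex: "exact_right A X Y f0 f m" and X: "rm X"
    and iso: "\<And>i. i \<le> m \<Longrightarrow> iso_pair (Y i) (Y' i) (\<phi> i) (\<psi> i)"
  defines "f0' \<equiv> \<lambda>x. \<phi> 0 (f0 x)" and "f' \<equiv> \<lambda>i y. \<phi> i (f i (\<psi> (i - 1) y))"
  shows "exact_right A X Y' f0' f' m"
    and "i \<le> m \<Longrightarrow> image_into X Y' f0' f' i = \<phi> i ` image_into X Y f0 f i"
proof -
  note E = ex[unfolded exact_right_def]
  have img: "image_into X Y' f0' f' i = \<phi> i ` image_into X Y f0 f i" if "i \<le> m" for i
  proof (cases i)
    case 0
    then show ?thesis by (simp add: f0'_def image_image)
  next
    case (Suc j)
    have "f' i ` carrier (Y' j) = (\<lambda>y. \<phi> i (f i y)) ` (\<psi> j ` carrier (Y' j))"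
      by (simp add: f'_def Suc image_image)
    then show ?thesis
      using iso_pairD(8)[OF iso, of j] that Suc by (simp add: image_image)
  qed
  show "i \<le> m \<Longrightarrow> image_into X Y' f0' f' i = \<phi> i ` image_into X Y f0 f i" by (rule img)
  note I0 = iso_pairD[OF iso[of 0, simplified]]
  have f0: "f0 \<in> Hom X (Y 0)" "inj_on f0 (carrier X)" using E by simp_all
  have "inj_on f0' (carrier X)"
    unfolding f0'_def
    by (rule inj_onI, rule inj_onD[OF f0(2)])
      (use homD(1)[OF f0(1)] I0(5) in \<open>metis+\<close>)
  moreover have "f0' \<in> Hom X (Y' 0)" unfolding f0'_def by (rule hom_comp[OF f0(1) I0(3)])
  moreover have "f' (Suc i) \<in> Hom (Y' i) (Y' (Suc i)) \<and>
      image_into X Y' f0' f' i = a_kernel (Y' i) (Y' (Suc i)) (f' (Suc i))" if i: "i < m" for i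
  proof
    note I1 = iso_pairD[OF iso[of i]] and I2 = iso_pairD[OF iso[of "Suc i"]]
    have fi: "f (Suc i) \<in> Hom (Y i) (Y (Suc i))" and im: "image_into X Y f0 f i = a_kernel (Y i) (Y (Suc i)) (f (Suc i))"
      using E i by simp_all
    have fS: "f' (Suc i) = (\<lambda>y. \<phi> (Suc i) (f (Suc i) (\<psi> i y)))" by (simp add: f'_def)
    show "f' (Suc i) \<in> Hom (Y' i) (Y' (Suc i))"
      unfolding fS using hom_comp[OF hom_comp[OF I1(4) fi] I2(3)] i by simp
    have "\<phi> i ` {y \<in> carrier (Y i). f (Suc i) y = \<zero>\<^bsub>Y (Suc i)\<^esub>} = {y \<in> carrier (Y' i). f' (Suc i) y = \<zero>\<^bsub>Y' (Suc i)\<^esub>}"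
    proof (intro equalityI subsetI)
      fix z assume "z \<in> \<phi> i ` {y \<in> carrier (Y i). f (Suc i) y = \<zero>\<^bsub>Y (Suc i)\<^esub>}"
      then obtain y where y: "y \<in> carrier (Y i)" "f (Suc i) y = \<zero>\<^bsub>Y (Suc i)\<^esub>" "z = \<phi> i y" by auto
      then show "z \<in> {y \<in> carrier (Y' i). f' (Suc i) y = \<zero>\<^bsub>Y' (Suc i)\<^esub>}"
        using i I1(5) homD(1)[OF I1(3)] hom_zero[OF I2(3,1,2)] by (simp add: fS)
    next
      fix z assume z: "z \<in> {y \<in> carrier (Y' i). f' (Suc i) y = \<zero>\<^bsub>Y' (Suc i)\<^esub>}"
      then have z': "z \<in> carrier (Y' i)" "\<phi> (Suc i) (f (Suc i) (\<psi> i z)) = \<zero>\<^bsub>Y' (Suc i)\<^esub>"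
        by (simp_all add: fS)
      have "\<psi> i z \<in> carrier (Y i)" "z = \<phi> i (\<psi> i z)"
        using i I1(6) homD(1)[OF I1(4)] z'(1) by simp_all
      moreover from this have "f (Suc i) (\<psi> i z) = \<zero>\<^bsub>Y (Suc i)\<^esub>"
        using I2(9)[of "f (Suc i) (\<psi> i z)"] homD(1)[OF fi] z'(2) i by simp
      ultimately have "\<psi> i z \<in> carrier (Y i)" "f (Suc i) (\<psi> i z) = \<zero>\<^bsub>Y (Suc i)\<^esub>" "z = \<phi> i (\<psi> i z)"
        by blast+
      then show "z \<in> \<phi> i ` {y \<in> carrier (Y i). f (Suc i) y = \<zero>\<^bsub>Y (Suc i)\<^esub>}" by blast
    qed
    then show "image_into X Y' f0' f' i = a_kernel (Y' i) (Y' (Suc i)) (f' (Suc i))"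
      using img[of i] im i by simp
  qed
  ultimately show "exact_right A X Y' f0' f' m" unfolding exact_right_def by blast
qed

lemma image_into_cong:
  assumes "\<And>j. j < i \<Longrightarrow> Y j = Y' j" "\<And>j. j \<le> i \<Longrightarrow> f j = f' j"
  shows "image_into X Y f0 f i = image_into X Y' f0 f' i"
  using assms by (cases i) simp_all

lemma exact_right_extend:
  assumes ex: "exact_right A X Y f0 f m" and p: "p \<in> Hom (Y m) Z"
    and ker: "image_into X Y f0 f m = a_kernel (Y m) Z p"
  shows "exact_right A X (Y(Suc m := Z)) f0 (f(Suc m := p)) (Suc m)"
    and "image_into X (Y(Suc m := Z)) f0 (f(Suc m := p)) (Suc m) = p ` carrier (Y m)"
    and "i \<le> m \<Longrightarrow> image_into X (Y(Suc m := Z)) f0 (f(Suc m := p)) i = image_into X Y f0 f i"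
proof -
  have im: "image_into X (Y(Suc m := Z)) f0 (f(Suc m := p)) i = image_into X Y f0 f i" if "i \<le> m" for i
    by (rule image_into_cong) (use that in auto)
  show "i \<le> m \<Longrightarrow> image_into X (Y(Suc m := Z)) f0 (f(Suc m := p)) i = image_into X Y f0 f i" by (rule im)
  show "image_into X (Y(Suc m := Z)) f0 (f(Suc m := p)) (Suc m) = p ` carrier (Y m)" by simp
  note E = ex[unfolded exact_right_def]
  show "exact_right A X (Y(Suc m := Z)) f0 (f(Suc m := p)) (Suc m)"
    unfolding exact_right_def
  proof (intro conjI allI impI)
    show "f0 \<in> Hom X ((Y(Suc m := Z)) 0)" "inj_on f0 (carrier X)" using E by simp_all
    fix i assume i: "i < Suc m"
    show "(f(Suc m := p)) (Suc i) \<in> Hom ((Y(Suc m := Z)) i) ((Y(Suc m := Z)) (Suc i))"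
      using i E p by (cases "i = m") auto
    show "image_into X (Y(Suc m := Z)) f0 (f(Suc m := p)) i =
        a_kernel ((Y(Suc m := Z)) i) ((Y(Suc m := Z)) (Suc i)) ((f(Suc m := p)) (Suc i))"
      using i E ker im[of i] by (cases "i = m") auto
  qed
qed

lemma fac_copy:
  fixes Q :: "('a, 'q) module"
  assumes F: "fac Q m N P e d" and Q: "rm Q"
  shows "\<exists>(P' :: nat \<Rightarrow> ('a, nat \<Rightarrow> 'q) module) e' d'. fac Q m N P' e' d'"
proof -
  note F' = F[unfolded fac_def]
  obtain P' :: "nat \<Rightarrow> ('a, nat \<Rightarrow> 'q) module" and \<phi> \<psi>
    where iso: "\<And>i. i < m \<Longrightarrow> iso_pair (P i) (P' i) (\<phi> i) (\<psi> i)"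
    by (rule in_add_iso_copies[of m Q P]) (use F' Q in \<open>auto intro: that\<close>)
  define e' where "e' = (\<lambda>x. e (\<psi> 0 x))"
  define d' where "d' = (\<lambda>i x. \<phi> (i - 1) (d i (\<psi> i x)))"
  have add: "in_add A Q (P' i)" if "i < m" for i
    by (rule in_add_iso[OF _ Q iso[OF that]]) (use F' that in simp)
  have "exact_left A N P' e' d' (m - 1)" if m: "0 < m"
  proof -
    have E: "exact_left A N P e d (m - 1)" using F' m by simp
    note E' = E[unfolded exact_left_def]
    note I0 = iso_pairD[OF iso[OF m]]
    have e: "e \<in> Hom (P 0) N" "e ` carrier (P 0) = carrier N" using E' by simp_all
    have ker: "kernel_from N P' e' d' i = \<phi> i ` kernel_from N P e d i" if i: "i < m" for i
    proof -
      note I = iso_pairD[OF iso[OF i]]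
      have *: "{y \<in> carrier (P' i). g (\<psi> i y)} = \<phi> i ` {x \<in> carrier (P i). g x}" for g
      proof (intro equalityI subsetI)
        fix y assume "y \<in> {y \<in> carrier (P' i). g (\<psi> i y)}"
        then show "y \<in> \<phi> i ` {x \<in> carrier (P i). g x}"
          using I(6)[of y] homD(1)[OF I(4), of y] by (intro image_eqI[of _ _ "\<psi> i y"]) simp_all
      next
        fix y assume "y \<in> \<phi> i ` {x \<in> carrier (P i). g x}"
        then show "y \<in> {y \<in> carrier (P' i). g (\<psi> i y)}" using I(5) homD(1)[OF I(3)] by auto
      qed
      show ?thesis
      proof (cases i)
        case 0
        then show ?thesis using *[of "\<lambda>x. e x = \<zero>\<^bsub>N\<^esub>"] by (simp add: e'_def)
      next
        case (Suc j)
        note J = iso_pairD[OF iso[of j]]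
        have dh: "d (Suc j) \<in> Hom (P (Suc j)) (P j)" using E' i Suc by simp
        have "d' i y = \<zero>\<^bsub>P' j\<^esub> \<longleftrightarrow> d i (\<psi> i y) = \<zero>\<^bsub>P j\<^esub>" if "y \<in> carrier (P' i)" for y
          using J(9) homD(1)[OF dh] homD(1)[OF I(4) that] i Suc by (simp add: d'_def)
        then have "{y \<in> carrier (P' i). d' i y = \<zero>\<^bsub>P' j\<^esub>} = {y \<in> carrier (P' i). d i (\<psi> i y) = \<zero>\<^bsub>P j\<^esub>}"
          by auto
        then show ?thesis using *[of "\<lambda>x. d i x = \<zero>\<^bsub>P j\<^esub>"] Suc by simp
      qed
    qed
    have "e' ` carrier (P' 0) = e ` (\<psi> 0 ` carrier (P' 0))" by (simp add: e'_def image_image)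
    then have "e' ` carrier (P' 0) = carrier N" using I0(8) e(2) by simp
    moreover have "e' \<in> Hom (P' 0) N" unfolding e'_def by (rule hom_comp[OF I0(4) e(1)])
    moreover have "d' (Suc i) \<in> Hom (P' (Suc i)) (P' i) \<and> d' (Suc i) ` carrier (P' (Suc i)) = kernel_from N P' e' d' i"
      if i: "i < m - 1" for i
    proof
      have i': "i < m" "Suc i < m" using i by simp_all
      note I = iso_pairD[OF iso[OF i'(1)]] and IS = iso_pairD[OF iso[OF i'(2)]]
      have dh: "d (Suc i) \<in> Hom (P (Suc i)) (P i)"
        and dim: "d (Suc i) ` carrier (P (Suc i)) = kernel_from N P e d i" using E' i by simp_all
      have d'S: "d' (Suc i) = (\<lambda>x. \<phi> i (d (Suc i) (\<psi> (Suc i) x)))" by (simp add: d'_def)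
      show "d' (Suc i) \<in> Hom (P' (Suc i)) (P' i)"
        unfolding d'S by (rule hom_comp[OF hom_comp[OF IS(4) dh] I(3)])
      have "d' (Suc i) ` carrier (P' (Suc i)) = \<phi> i ` d (Suc i) ` \<psi> (Suc i) ` carrier (P' (Suc i))"
        by (simp only: d'S image_image)
      also have "\<dots> = \<phi> i ` kernel_from N P e d i" by (simp only: IS(8) dim)
      finally show "d' (Suc i) ` carrier (P' (Suc i)) = kernel_from N P' e' d' i"
        by (simp only: ker[OF i'(1)])
    qed
    ultimately show ?thesis unfolding exact_left_def by blast
  qed
  then have "fac Q m N P' e' d'" using F' add by (simp add: fac_def)
  then show ?thesis by blast
qed

text \<open>\<open>Y\<close> is added to the term of index 0 alone and mapped identically, so the
  kernel of the augmentation stays the same up to isomorphism and the rest of the presentation can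
  be kept.\<close>

lemma fac_direct_sum:
  fixes Q :: "('a, 'q) module"
  assumes F: "fac Q (Suc k) N P e d" and Q: "rm Q" and Y: "in_add A Q Y"
  shows "\<exists>(P' :: nat \<Rightarrow> ('a, nat \<Rightarrow> 'q) module) e' d'. fac Q (Suc k) (direct_sum N Y) P' e' d'"
proof -
  from fac_copy[OF F Q] obtain P1 :: "nat \<Rightarrow> ('a, nat \<Rightarrow> 'q) module" and e1 d1
    where F1: "fac Q (Suc k) N P1 e1 d1" by blast
  note F' = F1[unfolded fac_def]
  have N: "rm N" and E: "exact_left A N P1 e1 d1 k" and P0: "in_add A Q (P1 0)" using F' by simp_all
  note E' = E[unfolded exact_left_def]
  have e1: "e1 \<in> Hom (P1 0) N" "e1 ` carrier (P1 0) = carrier N" using E' by simp_all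
  note rY = in_add_rm[OF Y] and rP = in_add_rm[OF P0]
  let ?S = "direct_sum (P1 0) Y"
  have S: "in_add A Q ?S" by (rule in_add_direct_sum[OF P0 Y Q])
  obtain R :: "('a, nat \<Rightarrow> 'q) module" and \<phi> \<psi> where iso: "iso_pair ?S R \<phi> \<psi>"
    by (rule in_add_iso_copy[OF S Q])
  note I = iso_pairD[OF iso]
  define P' where "P' = P1(0 := R)"
  define e' where "e' = (\<lambda>r. (e1 (fst (\<psi> r)), snd (\<psi> r)))"
  define d' where "d' = d1(1 := \<lambda>x. \<phi> (d1 1 x, \<zero>\<^bsub>Y\<^esub>))"
  have e': "e' \<in> Hom R (direct_sum N Y)"
    unfolding e'_def by (rule hom_pair[OF hom_comp[OF hom_comp[OF I(4) hom_fst] e1(1)] hom_comp[OF I(4) hom_snd]])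
  have "e' ` carrier R = (\<lambda>u. (e1 (fst u), snd u)) ` \<psi> ` carrier R" by (simp add: e'_def image_image)
  also have "\<dots> = (\<lambda>u. (e1 (fst u), snd u)) ` (carrier (P1 0) \<times> carrier Y)" by (simp only: I(8) direct_sum_simps)
  also have "\<dots> = carrier N \<times> carrier Y" unfolding e1(2)[symmetric] by force
  finally have surj: "e' ` carrier R = carrier (direct_sum N Y)" by simp
  have ker0: "kernel_from (direct_sum N Y) P' e' d' 0 = \<phi> ` ({x \<in> carrier (P1 0). e1 x = \<zero>\<^bsub>N\<^esub>} \<times> {\<zero>\<^bsub>Y\<^esub>})"
  proof (intro equalityI subsetI)
    fix r assume "r \<in> kernel_from (direct_sum N Y) P' e' d' 0"
    then have r: "r \<in> carrier R" "e1 (fst (\<psi> r)) = \<zero>\<^bsub>N\<^esub>" "snd (\<psi> r) = \<zero>\<^bsub>Y\<^esub>"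
      by (simp_all add: P'_def e'_def)
    have "fst (\<psi> r) \<in> carrier (P1 0)" using homD(1)[OF I(4) r(1)] by auto
    then show "r \<in> \<phi> ` ({x \<in> carrier (P1 0). e1 x = \<zero>\<^bsub>N\<^esub>} \<times> {\<zero>\<^bsub>Y\<^esub>})"
      using r I(6)[OF r(1)] by (intro image_eqI[of _ _ "\<psi> r"]) (simp_all add: mem_Times_iff)
  next
    fix r assume "r \<in> \<phi> ` ({x \<in> carrier (P1 0). e1 x = \<zero>\<^bsub>N\<^esub>} \<times> {\<zero>\<^bsub>Y\<^esub>})"
    then obtain x where x: "x \<in> carrier (P1 0)" "e1 x = \<zero>\<^bsub>N\<^esub>" "r = \<phi> (x, \<zero>\<^bsub>Y\<^esub>)" by auto
    have u: "(x, \<zero>\<^bsub>Y\<^esub>) \<in> carrier ?S" using x rY by simp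
    show "r \<in> kernel_from (direct_sum N Y) P' e' d' 0"
      using x(2,3) I(5)[OF u] homD(1)[OF I(3) u] by (simp add: P'_def e'_def)
  qed
  have "d' (Suc i) \<in> Hom (P' (Suc i)) (P' i) \<and> d' (Suc i) ` carrier (P' (Suc i)) = kernel_from (direct_sum N Y) P' e' d' i"
    if i: "i < k" for i
  proof (cases i)
    case 0
    have dh: "d1 1 \<in> Hom (P1 1) (P1 0)" and dim: "d1 1 ` carrier (P1 1) = {x \<in> carrier (P1 0). e1 x = \<zero>\<^bsub>N\<^esub>}"
      using E' i 0 by auto
    have "d' 1 \<in> Hom (P1 1) R"
      unfolding d'_def using hom_comp[OF hom_comp[OF dh hom_inl[OF rY]] I(3)] by simp
    moreover have "d' 1 ` carrier (P1 1) = (\<lambda>x. \<phi> (x, \<zero>\<^bsub>Y\<^esub>)) ` d1 1 ` carrier (P1 1)"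
      by (simp add: d'_def image_image)
    then have "d' 1 ` carrier (P1 1) = kernel_from (direct_sum N Y) P' e' d' 0"
      unfolding ker0 dim by force
    ultimately show ?thesis using 0 by (simp add: P'_def)
  next
    case (Suc j)
    have dh: "d1 (Suc i) \<in> Hom (P1 (Suc i)) (P1 i)" and dim: "d1 (Suc i) ` carrier (P1 (Suc i)) = kernel_from N P1 e1 d1 i"
      using E' i by auto
    have "kernel_from (direct_sum N Y) P' e' d' i = kernel_from N P1 e1 d1 i"
    proof (cases j)
      case 0
      have dh1: "d1 1 \<in> Hom (P1 1) (P1 0)" using E' i Suc 0 by auto
      have "\<phi> (d1 1 x, \<zero>\<^bsub>Y\<^esub>) = \<zero>\<^bsub>R\<^esub> \<longleftrightarrow> d1 1 x = \<zero>\<^bsub>P1 0\<^esub>" if "x \<in> carrier (P1 1)" for x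
        using I(9)[of "(d1 1 x, \<zero>\<^bsub>Y\<^esub>)"] homD(1)[OF dh1 that] rY by simp
      then have "{x \<in> carrier (P1 1). \<phi> (d1 1 x, \<zero>\<^bsub>Y\<^esub>) = \<zero>\<^bsub>R\<^esub>} = {x \<in> carrier (P1 1). d1 1 x = \<zero>\<^bsub>P1 0\<^esub>}"
        by auto
      then show ?thesis using Suc 0 by (simp add: P'_def d'_def)
    next
      case (Suc l)
      then show ?thesis using \<open>i = Suc j\<close> by (simp add: P'_def d'_def)
    qed
    then show ?thesis using Suc dh dim by (simp add: P'_def d'_def)
  qed
  then have "exact_left A (direct_sum N Y) P' e' d' k"
    unfolding exact_left_def using e' surj by (simp add: P'_def)
  moreover have "in_add A Q (P' i)" if "i < Suc k" for i
    using F' that in_add_iso[OF S Q iso] by (simp add: P'_def)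
  ultimately have "fac Q (Suc k) (direct_sum N Y) P' e' d'"
    using rm_direct_sum[OF N rY] by (simp add: fac_def)
  then show ?thesis by blast
qed

section \<open>Minimal approximations\<close>

text \<open>Since Ext^1(Z, X) = 0, the map \<open>i\<close> has a retraction \<open>r\<close>. The
  endomorphism \<open>i\<close> after \<open>r\<close> fixes the image of \<open>i\<close>, hence is
  bijective by minimality, and so \<open>i\<close> is onto.\<close>

lemma minimal_nonsplit:
  assumes s: "ses X Y Z i p" and min: "left_minimal A X Y i" and ext: "pp n Z X"
  shows "zero_module Z"
proof -
  note S = sesD[OF s]
  obtain r where r: "r \<in> Hom Y X" "\<And>x. x \<in> carrier X \<Longrightarrow> r (i x) = x"
    by (rule pp_extend[OF s ext hom_id S(1)]) (rule that)
  have "(\<lambda>y. i (r y)) \<in> Hom Y Y" by (rule hom_comp[OF r(1) S(4)])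
  moreover have "\<forall>x\<in>carrier X. i (r (i x)) = i x" using r(2) by simp
  ultimately have "bij_betw (\<lambda>y. i (r y)) (carrier Y) (carrier Y)"
    by (rule conjunct2[OF min[unfolded left_minimal_def], THEN bspec, THEN mp])
  then have im: "(\<lambda>y. i (r y)) ` carrier Y = carrier Y" by (rule bij_betw_imp_surj_on)
  have "p y = \<zero>\<^bsub>Z\<^esub>" if "y \<in> carrier Y" for y
  proof -
    have "y \<in> (\<lambda>y. i (r y)) ` carrier Y" using that im by simp
    then obtain y' where "y' \<in> carrier Y" "y = i (r y')" by auto
    then show ?thesis using S(9) homD(1)[OF r(1)] by simp
  qed
  then have "carrier Z \<subseteq> {\<zero>\<^bsub>Z\<^esub>}" using S(7) by auto
  then show ?thesis using rm_closed(1)[OF S(3)] by (auto simp: zero_module_def)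
qed

text \<open>The zero endomorphism of \<open>Y\<close> is compatible with a map out of the zero
  module, so minimality makes it bijective.\<close>

lemma minimal_zero:
  assumes min: "left_minimal A X Y i" and X: "zero_module X" and rm: "rm X" "rm Y"
  shows "zero_module Y"
proof -
  have i: "i \<in> Hom X Y" using min by (simp add: left_minimal_def)
  have "\<forall>x\<in>carrier X. \<zero>\<^bsub>Y\<^esub> = i x" using X hom_zero[OF i rm] by (simp add: zero_module_def)
  then have "bij_betw (\<lambda>_. \<zero>\<^bsub>Y\<^esub>) (carrier Y) (carrier Y)"
    by (rule conjunct2[OF min[unfolded left_minimal_def], THEN bspec, OF hom_const_zero[OF rm(2)], THEN mp])
  then have "(\<lambda>_. \<zero>\<^bsub>Y\<^esub>) ` carrier Y = carrier Y" by (rule bij_betw_imp_surj_on)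
  then show ?thesis using rm_closed(1)[OF rm(2)] by (auto simp: zero_module_def)
qed

lemma minimal_left_approx_iso:
  assumes min: "minimal_left_approx A Q X Y f" and Q: "rm Q" and iso: "iso_pair Y Y' \<phi> \<psi>"
  shows "minimal_left_approx A Q X Y' (\<lambda>x. \<phi> (f x))"
proof -
  note I = iso_pairD[OF iso]
  have f: "f \<in> Hom X Y" and Y: "in_add A Q Y"
    and ap: "\<And>h. h \<in> Hom X Q \<Longrightarrow> \<exists>g\<in>Hom Y Q. \<forall>x\<in>carrier X. g (f x) = h x"
    and mi: "\<And>g. g \<in> Hom Y Y \<Longrightarrow> \<forall>x\<in>carrier X. g (f x) = f x \<Longrightarrow> bij_betw g (carrier Y) (carrier Y)"
    using min unfolding minimal_left_approx_def left_approx_def left_minimal_def by simp_all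
  have f': "(\<lambda>x. \<phi> (f x)) \<in> Hom X Y'" by (rule hom_comp[OF f I(3)])
  have fx: "f x \<in> carrier Y" if "x \<in> carrier X" for x by (rule homD(1)[OF f that])
  have "\<exists>g\<in>Hom Y' Q. \<forall>x\<in>carrier X. g (\<phi> (f x)) = h x" if h: "h \<in> Hom X Q" for h
  proof -
    from ap[OF h] obtain g where g: "g \<in> Hom Y Q" "\<forall>x\<in>carrier X. g (f x) = h x" by auto
    show ?thesis
      by (rule bexI[OF _ hom_comp[OF I(4) g(1)]]) (use g(2) I(5) fx in simp)
  qed
  moreover have "bij_betw g (carrier Y') (carrier Y')"
    if g: "g \<in> Hom Y' Y'" "\<forall>x\<in>carrier X. g (\<phi> (f x)) = \<phi> (f x)" for g
  proof -
    have "bij_betw (\<lambda>y. \<psi> (g (\<phi> y))) (carrier Y) (carrier Y)"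
      by (rule mi[OF hom_comp[OF hom_comp[OF I(3) g(1)] I(4)]]) (use g(2) I(5) fx in simp)
    then have "bij_betw (\<phi> \<circ> ((\<lambda>y. \<psi> (g (\<phi> y))) \<circ> \<psi>)) (carrier Y') (carrier Y')"
      by (rule bij_betw_trans[OF bij_betw_trans[OF iso_pair_bij[OF iso_pair_sym[OF iso]]] iso_pair_bij[OF iso]])
    then show ?thesis
      by (rule bij_betw_cong[THEN iffD1, rotated]) (use I(6) homD(1)[OF g(1)] in simp)
  qed
  ultimately show ?thesis
    unfolding minimal_left_approx_def left_approx_def left_minimal_def
    using f' in_add_iso[OF Y Q iso] by blast
qed

lemma cokernel_iso:
  assumes s: "ses X Y Z i p" and s': "ses X Y' Z' (\<lambda>x. \<phi> (i x)) p'" and iso: "iso_pair Y Y' \<phi> \<psi>"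
  obtains a b where "iso_pair Z Z' a b"
proof -
  note S = sesD[OF s] and S' = sesD[OF s'] and I = iso_pairD[OF iso]
  obtain a where a: "a \<in> Hom Z Z'" "\<And>y. y \<in> carrier Y \<Longrightarrow> a (p y) = p' (\<phi> y)"
    by (rule ses_factor_out[OF s hom_comp[OF I(3) S'(6)] S'(9) S'(3)]) (auto intro: that)
  have z: "p (\<psi> (\<phi> (i x))) = \<zero>\<^bsub>Z\<^esub>" if "x \<in> carrier X" for x
    using I(5)[OF homD(1)[OF S(4) that]] S(9)[OF that] by simp
  obtain b where b: "b \<in> Hom Z' Z" "\<And>y. y \<in> carrier Y' \<Longrightarrow> b (p' y) = p (\<psi> y)"
    by (rule ses_factor_out[OF s' hom_comp[OF I(4) S(6)] z S(3)]) (auto intro: that)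
  have "b (a z) = z" if "z \<in> carrier Z" for z
  proof -
    have "z \<in> p ` carrier Y" using that S(7) by simp
    then obtain y where y: "y \<in> carrier Y" "z = p y" by auto
    then show ?thesis using a(2) b(2) I(5) homD(1)[OF I(3)] by simp
  qed
  moreover have "a (b z) = z" if "z \<in> carrier Z'" for z
  proof -
    have "z \<in> p' ` carrier Y'" using that S'(7) by simp
    then obtain y where y: "y \<in> carrier Y'" "z = p' y" by auto
    then show ?thesis using a(2) b(2) I(6) homD(1)[OF I(4)] by simp
  qed
  ultimately have "iso_pair Z Z' a b" using a(1) b(1) S(3) S'(3) by (simp add: iso_pair_def)
  then show thesis by (rule that)
qed

section \<open>Coresolutions\<close>

lemma submodule_image_into:
  assumes ex: "exact_right A X Y f0 f n" and X: "rm X" and Y: "\<And>i. i \<le> n \<Longrightarrow> rm (Y i)" and i: "i \<le> n"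
  shows "submodule (image_into X Y f0 f i) A (Y i)"
proof (cases i)
  case 0
  show ?thesis
    using submodule_image[OF X Y[of 0] _ submodule_carrier[OF X], of f0] ex 0 by (simp add: exact_right_def)
next
  case (Suc j)
  have "f (Suc j) \<in> Hom (Y j) (Y (Suc j))" using ex i Suc by (simp add: exact_right_def)
  from submodule_image[OF _ _ this submodule_carrier] show ?thesis using Y i Suc by simp
qed

text \<open>The coresolution read backwards from \<open>Y k\<close>: its terms become a presentation
  of the cokernel, and nothing is required at \<open>Y 0\<close>, the left-hand end of that
  presentation.\<close>

lemma fac_of_exact_right:
  assumes ex: "exact_right A X Y f0 f n" and k: "k \<le> n" and add: "\<And>i. i \<le> k \<Longrightarrow> in_add A Q (Y i)"
    and e: "e \<in> Hom (Y k) N" "e ` carrier (Y k) = carrier N" and N: "rm N"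
    and ker: "{y \<in> carrier (Y k). e y = \<zero>\<^bsub>N\<^esub>} = image_into X Y f0 f k"
  shows "fac Q (Suc k) N (\<lambda>i. Y (k - i)) e (\<lambda>i. f (Suc k - i))"
proof -
  note E = ex[unfolded exact_right_def]
  have "f (Suc k - Suc i) \<in> Hom (Y (k - Suc i)) (Y (k - i)) \<and>
      f (Suc k - Suc i) ` carrier (Y (k - Suc i)) =
        kernel_from N (\<lambda>i. Y (k - i)) e (\<lambda>i. f (Suc k - i)) i" if i: "i < k" for i
  proof
    obtain l where l: "k = Suc (l + i)" using less_imp_Suc_add[OF i] by (auto simp: add.commute)
    have fl: "f (Suc l) \<in> Hom (Y l) (Y (Suc l))" using E k l by simp
    have eqs: "Suc k - Suc i = Suc l" "k - Suc i = l" "k - i = Suc l" using l by simp_all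
    show "f (Suc k - Suc i) \<in> Hom (Y (k - Suc i)) (Y (k - i))" unfolding eqs by (rule fl)
    show "f (Suc k - Suc i) ` carrier (Y (k - Suc i)) =
        kernel_from N (\<lambda>i. Y (k - i)) e (\<lambda>i. f (Suc k - i)) i"
    proof (cases i)
      case 0
      then show ?thesis using ker l by simp
    next
      case (Suc j)
      have eqs': "k - Suc j = Suc l" "k - j = Suc (Suc l)" "Suc k - Suc j = Suc (Suc l)"
        using l Suc by simp_all
      have "Suc l < n" using l k Suc by simp
      then have "image_into X Y f0 f (Suc l) = a_kernel (Y (Suc l)) (Y (Suc (Suc l))) (f (Suc (Suc l)))"
        using E by blast
      moreover have "kernel_from N (\<lambda>i. Y (k - i)) e (\<lambda>i. f (Suc k - i)) i =
          a_kernel (Y (Suc l)) (Y (Suc (Suc l))) (f (Suc (Suc l)))"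
        by (simp only: Suc kernel_from.simps eqs')
      ultimately show ?thesis unfolding eqs(1,2) by (simp only: image_into.simps)
    qed
  qed
  then have "exact_left A N (\<lambda>i. Y (k - i)) e (\<lambda>i. f (Suc k - i)) k"
    unfolding exact_left_def using e by simp
  then show ?thesis using add N by (simp add: fac_def)
qed

lemma cokernel_Suc: "cokernel X Y f0 f (Suc k) = quotient_module (Y k) (image_into X Y f0 f k)"
  by (simp add: cokernel_def)

lemma quotient_surj: "(\<lambda>y. I +>\<^bsub>M\<^esub> y) ` carrier M = carrier (quotient_module M I)"
  by (simp add: quotient_carrier)

lemma quotient_kernel:
  assumes "rm M" "submodule I A M"
  shows "{y \<in> carrier M. I +>\<^bsub>M\<^esub> y = \<zero>\<^bsub>quotient_module M I\<^esub>} = I"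
  using quotient_eq_zero_iff[OF assms] submoduleD(1)[OF assms] by auto

text \<open>The image that is factored out is the kernel of the next map, which is therefore
  constant on cosets. Thus \<open>the_elem\<close> of the image of a coset is the value of the
  induced inclusion of the cokernel into the next term.\<close>

lemma the_elem_induced:
  assumes ex: "exact_right A X Y f0 f n" and X: "rm X" and Y: "\<And>i. i \<le> n \<Longrightarrow> rm (Y i)" and k: "Suc k \<le> n"
    and y: "y \<in> carrier (Y k)"
  shows "the_elem (f (Suc k) ` (image_into X Y f0 f k +>\<^bsub>Y k\<^esub> y)) = f (Suc k) y"
proof -
  let ?I = "image_into X Y f0 f k"
  have f: "f (Suc k) \<in> Hom (Y k) (Y (Suc k))"
    and I: "?I = {z \<in> carrier (Y k). f (Suc k) z = \<zero>\<^bsub>Y (Suc k)\<^esub>}"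
    using ex k by (simp_all add: exact_right_def)
  have sub: "submodule ?I A (Y k)" by (rule submodule_image_into[OF ex X Y]) (use k in simp_all)
  have rY: "rm (Y k)" "rm (Y (Suc k))" using Y k by simp_all
  have "f (Suc k) w = f (Suc k) y" if w: "w \<in> ?I +>\<^bsub>Y k\<^esub> y" for w
  proof -
    obtain z where z: "z \<in> ?I" "w = z \<oplus>\<^bsub>Y k\<^esub> y" using w unfolding a_r_coset_def' by blast
    then have "z \<in> carrier (Y k)" "f (Suc k) z = \<zero>\<^bsub>Y (Suc k)\<^esub>" using I by simp_all
    then show ?thesis using z(2) y rY homD(1)[OF f y] by (simp add: homD(2)[OF f])
  qed
  moreover have "y \<in> ?I +>\<^bsub>Y k\<^esub> y" by (rule coset_self[OF rY(1) sub y])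
  ultimately have "f (Suc k) ` (?I +>\<^bsub>Y k\<^esub> y) = {f (Suc k) y}"
    by (intro equalityI subsetI) (blast intro: singletonI)+
  then show ?thesis by simp
qed

lemma ses_cokernel_0:
  assumes "exact_right A X Y f0 f n" "rm X" "rm (Y 0)"
  shows "ses X (Y 0) (cokernel X Y f0 f (Suc 0)) f0 (\<lambda>y. image_into X Y f0 f 0 +>\<^bsub>Y 0\<^esub> y)"
  using ses_quotient[OF assms(2,3), of f0] assms(1) by (simp add: exact_right_def cokernel_Suc)

text \<open>By exactness the induced map is injective; its image is that of
  \<open>f (Suc k)\<close>, so its cokernel is the next module of the sequence.\<close>

lemma ses_cokernel_Suc:
  assumes ex: "exact_right A X Y f0 f n" and X: "rm X" and Y: "\<And>i. i \<le> n \<Longrightarrow> rm (Y i)" and k: "Suc k \<le> n"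
    and \<iota>: "(\<lambda>C. the_elem (f (Suc k) ` C)) \<in> Hom (cokernel X Y f0 f (Suc k)) (Y (Suc k))"
  shows "ses (cokernel X Y f0 f (Suc k)) (Y (Suc k)) (cokernel X Y f0 f (Suc (Suc k)))
    (\<lambda>C. the_elem (f (Suc k) ` C)) (\<lambda>y. image_into X Y f0 f (Suc k) +>\<^bsub>Y (Suc k)\<^esub> y)"
proof -
  let ?I = "image_into X Y f0 f k" and ?C = "cokernel X Y f0 f (Suc k)"
  let ?\<iota> = "\<lambda>C. the_elem (f (Suc k) ` C)" and ?\<pi> = "\<lambda>y. ?I +>\<^bsub>Y k\<^esub> y"
  have rY: "rm (Y k)" "rm (Y (Suc k))" using Y k by simp_all
  have I: "?I = {z \<in> carrier (Y k). f (Suc k) z = \<zero>\<^bsub>Y (Suc k)\<^esub>}"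
    using ex k by (simp_all add: exact_right_def)
  have sub: "submodule ?I A (Y k)" by (rule submodule_image_into[OF ex X Y]) (use k in simp_all)
  have ind: "?\<iota> (?\<pi> y) = f (Suc k) y" if "y \<in> carrier (Y k)" for y
    by (rule the_elem_induced[OF ex X Y k that])
  have C: "rm ?C" unfolding cokernel_Suc by (rule rm_quotient[OF rY(1) sub])
  have car: "carrier ?C = ?\<pi> ` carrier (Y k)" by (simp add: cokernel_Suc quotient_carrier)
  have "inj_on ?\<iota> (carrier ?C)"
    unfolding hom_inj_iff[OF C rY(2) \<iota>]
  proof (intro ballI impI)
    fix c assume c: "c \<in> carrier ?C" "?\<iota> c = \<zero>\<^bsub>Y (Suc k)\<^esub>"
    then obtain y where y: "y \<in> carrier (Y k)" "c = ?\<pi> y" using car by auto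
    then have "f (Suc k) y = \<zero>\<^bsub>Y (Suc k)\<^esub>" using c(2) ind[OF y(1)] by simp
    then have "y \<in> ?I" using I y(1) by simp
    then show "c = \<zero>\<^bsub>?C\<^esub>" using quotient_eq_zero_iff[OF rY(1) sub y(1)] y(2) by (simp add: cokernel_Suc)
  qed
  from ses_quotient[OF C rY(2) \<iota> this]
  have "ses ?C (Y (Suc k)) (quotient_module (Y (Suc k)) (?\<iota> ` carrier ?C)) ?\<iota>
      (\<lambda>y. ?\<iota> ` carrier ?C +>\<^bsub>Y (Suc k)\<^esub> y)" .
  moreover have "?\<iota> ` carrier ?C = (\<lambda>y. ?\<iota> (?\<pi> y)) ` carrier (Y k)" unfolding car image_image ..
  then have "?\<iota> ` carrier ?C = image_into X Y f0 f (Suc k)"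
    by (simp only: image_cong[OF refl ind] image_into.simps)
  ultimately show ?thesis by (simp only: cokernel_Suc)
qed

section \<open>Tilting modules from minimal approximations\<close>

lemma ses_direct_sum:
  assumes "rm X" "rm Z"
  shows "ses X (direct_sum X Z) Z (\<lambda>x. (x, \<zero>\<^bsub>Z\<^esub>)) snd"
proof -
  have "carrier X \<noteq> {}" using rm_closed(1)[OF assms(1)] by blast
  then show ?thesis
    unfolding ses_def
    using assms rm_direct_sum[OF assms] hom_inl[OF assms(2), of X] hom_snd[of X Z]
    by (auto simp: inj_on_def image_iff)
qed

context
  fixes Q :: "('a, 'q) module" and Q' :: "nat \<Rightarrow> ('a, 'm) module" and f0 f and n :: nat
  assumes Q: "fg_module A Q" and Q1: "pp 1 Q Q"
    and ex: "exact_right A reg Q' f0 f n"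
    and add: "\<And>i. i \<le> n \<Longrightarrow> in_add A Q (Q' i)"
    and nz: "\<And>i. i \<le> n \<Longrightarrow> \<not> zero_module (Q' i)"
    and min0: "minimal_left_approx A Q reg (Q' 0) f0"
    and minS: "\<And>i. 1 \<le> i \<Longrightarrow> i \<le> n \<Longrightarrow>
      minimal_left_approx A Q (cokernel reg Q' f0 f i) (Q' i) (\<lambda>C. the_elem (f i ` C))"
    and nsurj: "image_into reg Q' f0 f n \<noteq> carrier (Q' n)"
begin

text \<open>The index is lowered by one: \<open>cok k\<close> is A^(k+1) and \<open>TT k\<close>
  below is T^(k+1).\<close>

abbreviation cok :: "nat \<Rightarrow> ('a, 'm set) module" where "cok k \<equiv> cokernel reg Q' f0 f (Suc k)"
abbreviation cproj :: "nat \<Rightarrow> 'm \<Rightarrow> 'm set" where "cproj k \<equiv> \<lambda>y. image_into reg Q' f0 f k +>\<^bsub>Q' k\<^esub> y"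
abbreviation cinc :: "nat \<Rightarrow> 'm set \<Rightarrow> 'm" where "cinc i \<equiv> \<lambda>C. the_elem (f i ` C)"

lemma rmQ: "rm Q" by (rule fg_moduleD[OF Q])

lemma rmQ': "i \<le> n \<Longrightarrow> rm (Q' i)" by (rule in_add_rm[OF add])

lemma minD:
  assumes "minimal_left_approx A Q X Y i"
  shows "i \<in> Hom X Y" "left_minimal A X Y i"
    "\<And>h. h \<in> Hom X Q \<Longrightarrow> \<exists>g\<in>Hom Y Q. \<forall>x\<in>carrier X. g (i x) = h x"
  using assms by (simp_all add: minimal_left_approx_def left_approx_def)

lemma ses_0: "ses reg (Q' 0) (cok 0) f0 (cproj 0)"
  by (rule ses_cokernel_0[OF ex rm_regular rmQ']) simp

lemma ses_S: "Suc k \<le> n \<Longrightarrow> ses (cok k) (Q' (Suc k)) (cok (Suc k)) (cinc (Suc k)) (cproj (Suc k))"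
  by (rule ses_cokernel_Suc[OF ex rm_regular rmQ' _ minD(1)[OF minS]]) simp_all

lemma pp_Q': "i \<le> n \<Longrightarrow> pp (Suc k) (Q' i) Q"
  by (rule pp_mono[OF _ pp_in_add[OF Q1 add rmQ] rmQ]) simp_all

lemma pp_cok: "k \<le> n \<Longrightarrow> pp (Suc k) (cok k) Q"
proof (induction k)
  case 0
  have "pp 0 reg Q" by (simp add: in_add_self[OF fg_regular])
  then show ?case by (rule pp_cokernel[OF ses_0 _ pp_Q' rmQ minD(3)[OF min0]]) simp_all
next
  case (Suc k)
  show ?case
    by (rule pp_cokernel[OF ses_S Suc.IH pp_Q' rmQ minD(3)[OF minS]]) (use Suc.prems in simp_all)
qed

lemma submodule_I: "k \<le> n \<Longrightarrow> submodule (image_into reg Q' f0 f k) A (Q' k)"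
  by (rule submodule_image_into[OF ex rm_regular rmQ'])

lemma cproj_hom: "k \<le> n \<Longrightarrow> cproj k \<in> Hom (Q' k) (cok k)"
  unfolding cokernel_Suc by (rule hom_quotient[OF rmQ' submodule_I])

lemma rm_cok: "k \<le> n \<Longrightarrow> rm (cok k)"
  unfolding cokernel_Suc by (rule rm_quotient[OF rmQ' submodule_I])

lemma fac_cok: "k \<le> n \<Longrightarrow> fac Q (Suc k) (cok k) (\<lambda>i. Q' (k - i)) (cproj k) (\<lambda>i. f (Suc k - i))"
  by (rule fac_of_exact_right[OF ex _ add cproj_hom _ rm_cok])
     (simp_all only: cokernel_Suc quotient_surj quotient_kernel[OF rmQ' submodule_I])

text \<open>For \<open>k = n\<close> this is the assumption that the last map is not onto. For
  smaller \<open>k\<close>, the minimal approximation of a zero module would have target zero,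
  against the assumption on the next term.\<close>

lemma cok_nonzero:
  assumes k: "k \<le> n"
  shows "\<not> zero_module (cok k)"
proof
  assume z: "zero_module (cok k)"
  show False
  proof (cases "k = n")
    case True
    have "y \<in> image_into reg Q' f0 f n" if y: "y \<in> carrier (Q' n)" for y
    proof -
      have "cproj n y = \<zero>\<^bsub>cok n\<^esub>"
        using homD(1)[OF cproj_hom y] z True by (simp add: zero_module_def)
      then show ?thesis using quotient_eq_zero_iff[OF rmQ' submodule_I y] by (simp add: cokernel_Suc)
    qed
    then show False using submoduleD(1)[OF rmQ' submodule_I, of n] nsurj by blast
  next
    case False
    then have "Suc k \<le> n" using k by simp
    then show False
      using minimal_zero[OF minD(2)[OF minS] z rm_cok rmQ'] nz[of "Suc k"] k by simp
  qed
qed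

lemma cok_pd:
  assumes k: "k \<le> n"
  shows "\<not> pp k (cok k) zm"
proof
  assume "pp k (cok k) zm"
  then have pk: "pp k (cok k) Q" by (rule pp_reduce[OF pp_cok[OF k] _ rmQ rm_zm])
  have "zero_module (cok k)"
  proof (cases k)
    case 0
    \<comment> \<open>At level 0 \<open>pp\<close> only asserts projectivity, so A^1 projective
      already yields Ext^1(A^1, A) = 0.\<close>
    have "pp 0 (cok 0) reg" using pk 0 by simp
    from minimal_nonsplit[OF ses_0 minD(2)[OF min0] this] show ?thesis using 0 by simp
  next
    case (Suc j)
    have j: "Suc j \<le> n" "j \<le> n" using k Suc by simp_all
    have "pp (Suc j) (cok (Suc j)) (cok j)"
      using pp_fac[OF pk[unfolded Suc] rmQ fac_cok[OF j(2)]] .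
    from minimal_nonsplit[OF ses_S[OF j(1)] minD(2)[OF minS] this] show ?thesis using j Suc by simp
  qed
  then show False using cok_nonzero[OF k] by simp
qed

abbreviation "TT k \<equiv> direct_sum (cok k) Q"

lemma fac_TT:
  assumes k: "k \<le> n"
  shows "\<exists>(P :: nat \<Rightarrow> ('a, nat \<Rightarrow> 'q) module) e d. fac Q (Suc k) (TT k) P e d"
  by (rule fac_direct_sum[OF fac_cok[OF k] rmQ in_add_self[OF Q]])

lemma pp_TT:
  assumes k: "k \<le> n"
  shows "pp (Suc k) (TT k) (TT k)"
proof -
  have "pp (Suc k) Q Q" by (rule pp_mono[OF _ Q1 rmQ]) simp
  then have 1: "pp (Suc k) (TT k) Q"
    by (rule pp_middle[OF ses_direct_sum[OF rm_cok[OF k] rmQ] pp_cok[OF k] _ rmQ])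
  from fac_TT[OF k] obtain P :: "nat \<Rightarrow> ('a, nat \<Rightarrow> 'q) module" and e d
    where "fac Q (Suc k) (TT k) P e d" by blast
  from pp_fac[OF 1 rmQ this] show ?thesis .
qed

lemma fg_TT: "k \<le> n \<Longrightarrow> fg_module A (TT k)"
  by (rule pp_fg[OF pp_TT])

lemma in_Fac_TT:
  assumes k: "k \<le> n"
  shows "in_Fac A Q (Suc k) (TT k)"
  using fac_TT[OF k] fg_TT[OF k] by (simp add: in_Fac_def fac_def)

lemma in_add_TT:
  assumes k: "k \<le> n"
  shows "in_add A (TT k) (cok k)" and "in_add A (TT k) Q"
proof -
  note r = rm_cok[OF k] and T = in_add_self[OF fg_TT[OF k]] and rT = fg_moduleD[OF fg_TT[OF k]]
  show "in_add A (TT k) (cok k)"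
    by (rule in_add_retract[OF T rT r hom_inl[OF rmQ] hom_fst]) simp
  show "in_add A (TT k) Q"
    by (rule in_add_retract[OF T rT rmQ hom_inr[OF r] hom_snd]) simp
qed

lemma pd_TT:
  assumes k: "k \<le> n"
  shows "pd A (TT k) = enat (Suc k)"
proof -
  note rT = fg_moduleD[OF fg_TT[OF k]]
  have le: "pd A (TT k) \<le> enat (Suc k)" by (rule pd_of_pp[OF pp_TT[OF k] rT])
  have "\<not> pd A (TT k) \<le> enat k"
  proof
    assume "pd A (TT k) \<le> enat k"
    then have "pp k (TT k) zm" by (rule pp_of_pd[OF _ rT])
    then have "pp k (cok k) zm" by (rule pp_in_add[OF _ in_add_TT(1)[OF k] rm_zm])
    then show False using cok_pd[OF k] by simp
  qed
  then show ?thesis using le by (cases "pd A (TT k)") auto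
qed

text \<open>The required coresolution of A is the given one, cut after \<open>Q' k\<close> and
  completed by \<open>cok k\<close>. Most of the work is moving it to the carrier type that
  \<open>tilting\<close> asks for.\<close>

lemma tilting_TT:
  assumes k: "k \<le> n"
  shows "d_tilting A (Suc k) (TT k)"
proof -
  note rT = fg_moduleD[OF fg_TT[OF k]]
  have exk: "exact_right A reg Q' f0 f k" using ex k by (simp add: exact_right_def)
  have addT: "in_add A (TT k) (Q' i)" if "i < Suc k" for i
    by (rule in_add_trans[OF in_add_TT(2)[OF k] add rT]) (use k that in simp)
  obtain Y :: "nat \<Rightarrow> ('a, nat \<Rightarrow> 'm set \<times> 'q) module" and \<phi> \<psi>
    where iso: "\<And>i. i < Suc k \<Longrightarrow> iso_pair (Q' i) (Y i) (\<phi> i) (\<psi> i)"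
    by (rule in_add_iso_copies[OF addT rT]) (auto intro: that)
  obtain Z :: "('a, nat \<Rightarrow> 'm set \<times> 'q) module" and \<phi>' \<psi>' where isoZ: "iso_pair (cok k) Z \<phi>' \<psi>'"
    by (rule in_add_iso_copy[OF in_add_TT(1)[OF k] rT])
  have iso': "iso_pair (Q' i) (Y i) (\<phi> i) (\<psi> i)" if "i \<le> k" for i using iso that by simp
  define g0 where "g0 = (\<lambda>x. \<phi> 0 (f0 x))"
  define g where "g = (\<lambda>i y. \<phi> i (f i (\<psi> (i - 1) y)))"
  have exY: "exact_right A reg Y g0 g k"
    unfolding g0_def g_def by (rule exact_right_copy(1)[OF exk rm_regular iso'])
  have imY: "image_into reg Y g0 g k = \<phi> k ` image_into reg Q' f0 f k"
    unfolding g0_def g_def by (rule exact_right_copy(2)[OF exk rm_regular iso']) simp_all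
  note Ik = iso_pairD[OF iso'[OF order_refl]] and IZ = iso_pairD[OF isoZ]
  let ?p = "\<lambda>y. \<phi>' (cproj k (\<psi> k y))"
  have p: "?p \<in> Hom (Y k) Z"
    by (rule hom_comp[OF hom_comp[OF Ik(4) cproj_hom[OF k]] IZ(3)])
  have z: "?p y = \<zero>\<^bsub>Z\<^esub> \<longleftrightarrow> \<psi> k y \<in> image_into reg Q' f0 f k" if y: "y \<in> carrier (Y k)" for y
  proof -
    have py: "\<psi> k y \<in> carrier (Q' k)" by (rule homD(1)[OF Ik(4) y])
    show ?thesis
      using IZ(9)[OF homD(1)[OF cproj_hom[OF k] py]] quotient_eq_zero_iff[OF rmQ' submodule_I py] k
      by (simp add: cokernel_Suc)
  qed
  have "image_into reg Y g0 g k = a_kernel (Y k) Z ?p"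
    unfolding imY a_kernel_eq
  proof (intro equalityI subsetI)
    fix y assume "y \<in> \<phi> k ` image_into reg Q' f0 f k"
    then obtain x where x: "x \<in> image_into reg Q' f0 f k" "y = \<phi> k x" by auto
    have xc: "x \<in> carrier (Q' k)" by (rule submoduleD(1)[OF rmQ'[OF k] submodule_I[OF k] x(1)])
    show "y \<in> {y \<in> carrier (Y k). ?p y = \<zero>\<^bsub>Z\<^esub>}"
      using homD(1)[OF Ik(3) xc] z[of y] x Ik(5)[OF xc] by simp
  next
    fix y assume "y \<in> {y \<in> carrier (Y k). ?p y = \<zero>\<^bsub>Z\<^esub>}"
    then have y: "y \<in> carrier (Y k)" and y0: "?p y = \<zero>\<^bsub>Z\<^esub>" by simp_all
    have "\<psi> k y \<in> image_into reg Q' f0 f k" using z[OF y] y0 by blast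
    note y = y this
    show "y \<in> \<phi> k ` image_into reg Q' f0 f k"
      by (rule image_eqI[of _ _ "\<psi> k y"]) (use y Ik(6) in simp_all)
  qed
  note E = exact_right_extend[OF exY p this]
  have "?p ` carrier (Y k) = \<phi>' ` cproj k ` \<psi> k ` carrier (Y k)" by (simp only: image_image)
  also have "\<dots> = \<phi>' ` carrier (cok k)" by (simp only: Ik(8) cokernel_Suc quotient_surj)
  finally have surj: "?p ` carrier (Y k) = carrier Z" by (simp only: IZ(7))
  have "in_add A (TT k) ((Y(Suc k := Z)) i)" if "i \<le> Suc k" for i
  proof (cases "i = Suc k")
    case True
    then show ?thesis using in_add_iso[OF in_add_TT(1)[OF k] rT isoZ] by simp
  next
    case False
    then have "i < Suc k" using that by simp
    then show ?thesis using in_add_iso[OF addT rT iso] by simp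
  qed
  then have "\<exists>r (Y :: nat \<Rightarrow> ('a, nat \<Rightarrow> 'm set \<times> 'q) module) g0 g.
      (\<forall>i\<le>r. in_add A (TT k) (Y i)) \<and> exact_right A reg Y g0 g r \<and>
      image_into reg Y g0 g r = carrier (Y r)"
    using E(1,2) surj
    by (intro exI[of _ "Suc k"] exI[of _ "Y(Suc k := Z)"] exI[of _ g0] exI[of _ "g(Suc k := ?p)"])
       (simp del: image_into.simps)
  moreover have "\<forall>i\<ge>1. trivial_group (Ext A i (TT k) (TT k))"
    using Ext_of_pp[OF pp_TT[OF k] rT] by simp
  ultimately show ?thesis
    unfolding d_tilting_def tilting_def using fg_TT[OF k] pd_TT[OF k] by simp
qed

text \<open>The exchange sequence is the given minimal approximation of \<open>cok k\<close>, whose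
  cokernel is \<open>cok (Suc k)\<close>. Only its target has to be copied to the carrier type in
  \<open>is_mutation\<close>, and the cokernel follows.\<close>

lemma mutation_TT:
  assumes k: "Suc k \<le> n"
  shows "is_mutation A (TT k) (cok k) Q (TT (Suc k))"
proof -
  have k': "k \<le> n" using k by simp
  obtain V :: "('a, nat \<Rightarrow> 'q) module" and \<phi> \<psi> where iso: "iso_pair (Q' (Suc k)) V \<phi> \<psi>"
    by (rule in_add_iso_copy[OF add[OF k] rmQ])
  note I = iso_pairD[OF iso] and S = sesD[OF ses_S[OF k]]
  let ?g = "\<lambda>x. \<phi> (cinc (Suc k) x)"
  have mi: "minimal_left_approx A Q (cok k) V ?g"
    by (rule minimal_left_approx_iso[OF minS rmQ iso]) (use k in simp_all)
  have inj: "inj_on ?g (carrier (cok k))"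
    unfolding hom_inj_iff[OF S(1) I(2) minD(1)[OF mi]]
    using S(10) I(9) homD(1)[OF S(4)] by simp
  obtain a b where ab: "iso_pair (cok (Suc k)) (quotient_module V (?g ` carrier (cok k))) a b"
    by (rule cokernel_iso[OF ses_S[OF k] ses_quotient[OF S(1) I(2) minD(1)[OF mi] inj] iso])
  note AB = iso_pairD[OF ab]
  let ?D = "direct_sum (quotient_module V (?g ` carrier (cok k))) Q"
  have "iso_pair (TT (Suc k)) ?D (\<lambda>u. (a (fst u), snd u)) (\<lambda>u. (b (fst u), snd u))"
    unfolding iso_pair_def
    using rm_direct_sum[OF AB(1) rmQ] rm_direct_sum[OF AB(2) rmQ]
      hom_pair[OF hom_comp[OF hom_fst AB(3)] hom_snd] hom_pair[OF hom_comp[OF hom_fst AB(4)] hom_snd]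
    by (auto simp: AB(5,6))
  then have "mod_iso A (TT (Suc k)) ?D"
    unfolding mod_iso_def using iso_pair_bij iso_pairD(3) by blast
  moreover have "mod_iso A (TT k) (TT k)"
    unfolding mod_iso_def by (rule bexI[OF _ hom_id]) (simp add: bij_betw_def)
  ultimately show ?thesis
    unfolding is_mutation_def using cok_nonzero[OF k'] mi by blast
qed

end

section \<open>Approximating a tilting coresolution\<close>

lemma zero_moduleI:
  assumes "rm M" "\<And>x. x \<in> carrier M \<Longrightarrow> x = \<zero>\<^bsub>M\<^esub>"
  shows "zero_module M"
  unfolding zero_module_def by (intro equalityI subsetI) (use rm_closed(1)[OF assms(1)] assms(2) in blast)+

lemma thru_zero_module:
  assumes "thru Q M N h" "zero_module Q" "rm Q" "rm N" "x \<in> carrier M"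
  shows "h x = \<zero>\<^bsub>N\<^esub>"
  using assms(1)
proof induction
  case (thru_step h f g)
  have "f x = \<zero>\<^bsub>Q\<^esub>" using homD(1)[OF thru_step.hyps(2) assms(5)] assms(2) by (simp add: zero_module_def)
  then show ?case using thru_step.IH hom_zero[OF thru_step.hyps(3) assms(3,4)] assms(4) by simp
next
  case (thru_cong h h')
  then show ?case using assms(5) by simp
qed simp

text \<open>In each summand X -> T -> W the first map is replaced by a sum of maps through
  \<open>Q\<close>.\<close>

lemma thru_swap:
  assumes "thru T X W u" and T: "\<And>f. f \<in> Hom X T \<Longrightarrow> thru Q X T f" and rm: "rm T" "rm X" "rm W"
  shows "thru Q X W u"
  using assms(1)
proof induction
  case thru_zero
  show ?case by (rule thru.thru_zero)
next
  case (thru_step h f g)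
  have "thru Q X W (\<lambda>x. g (f x))" by (rule thru_comp_left[OF T[OF thru_step.hyps(2)] thru_step.hyps(3) rm(2,1,3)])
  then show ?case by (rule thru_add[OF _ thru_step.IH rm(2,3)])
next
  case (thru_cong h h')
  show ?case by (rule thru.thru_cong[OF thru_cong.IH thru_cong.hyps(2)])
qed

lemma thru_pair:
  assumes "thru T X M f" "thru T X N g" "rm X" "rm M" "rm N"
  shows "thru T X (direct_sum M N) (\<lambda>x. (f x, g x))"
proof -
  note D = rm_direct_sum[OF assms(4,5)]
  have 1: "thru T X (direct_sum M N) (\<lambda>x. (f x, \<zero>\<^bsub>N\<^esub>))"
    by (rule thru_comp_left[OF assms(1) hom_inl[OF assms(5)] assms(3,4) D])
  have 2: "thru T X (direct_sum M N) (\<lambda>x. (\<zero>\<^bsub>M\<^esub>, g x))"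
    by (rule thru_comp_left[OF assms(2) hom_inr[OF assms(4)] assms(3,5) D])
  show ?thesis
    by (rule thru.thru_cong[OF thru_add[OF 2 1 assms(3) D]])
       (use homD(1)[OF thru_hom[OF assms(1,3,4)]] homD(1)[OF thru_hom[OF assms(2,3,5)]] assms(4,5) in simp)
qed

lemma in_add_thru_hom:
  assumes "in_add A Q N" "rm Q" "f \<in> Hom M N"
  shows "thru Q M N f"
  using thru_comp_right[OF in_add_thru[OF assms(1,2)] assms(3)] .

text \<open>Zero terms are appended because the length of the coresolution is unrelated to the
  number of stages to be built; afterwards there is a cosyzygy in every degree.\<close>

lemma coresolution_prolong:
  fixes Y :: "nat \<Rightarrow> ('a, 'y) module"
  assumes ex: "exact_right A reg Y g0 g r" and add: "\<And>i. i \<le> r \<Longrightarrow> in_add A T (Y i)" and T: "rm T"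
    and surj: "image_into reg Y g0 g r = carrier (Y r)"
  obtains Y' g' where "\<And>m. exact_right A reg Y' g0 g' m" "\<And>i. in_add A T (Y' i)"
    "\<And>i. r < i \<Longrightarrow> zero_module (Y' i)"
proof -
  \<comment> \<open>As a submodule, \<open>Z\<close> has the same zero as \<open>Y r\<close>, so the
    constant map to it is a homomorphism between any two of the later terms.\<close>
  define Z where "Z = (Y r)\<lparr>carrier := {\<zero>\<^bsub>Y r\<^esub>}\<rparr>"
  have rY: "rm (Y i)" if "i \<le> r" for i by (rule in_add_rm[OF add[OF that]])
  have Z: "rm Z" "zero_module Z" "\<zero>\<^bsub>Z\<^esub> = \<zero>\<^bsub>Y r\<^esub>" "carrier Z = {\<zero>\<^bsub>Y r\<^esub>}"
    unfolding Z_def using zero_carrier_rm[OF rY[OF order_refl]] by simp_all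
  define Y' where "Y' = (\<lambda>i. if i \<le> r then Y i else Z)"
  define g' where "g' = (\<lambda>i. if i \<le> r then g i else (\<lambda>_. \<zero>\<^bsub>Y r\<^esub>))"
  have rY': "rm (Y' i)" for i using rY Z(1) by (simp add: Y'_def)
  have im: "image_into reg Y' g0 g' i = image_into reg Y g0 g i" if "i \<le> r" for i
    by (rule image_into_cong) (use that in \<open>simp_all add: Y'_def g'_def\<close>)
  have im_zero: "image_into reg Y' g0 g' (Suc i) = {\<zero>\<^bsub>Y r\<^esub>}" if "r \<le> i" for i
  proof -
    have "carrier (Y' i) \<noteq> {}" using rm_closed(1)[OF rY'] by blast
    then show ?thesis using that by (auto simp: g'_def)
  qed
  note E = ex[unfolded exact_right_def]
  have hom: "g' (Suc i) \<in> Hom (Y' i) (Y' (Suc i))" for i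
  proof (cases "i < r")
    case True
    then show ?thesis using E by (simp add: g'_def Y'_def)
  next
    case False
    then have "g' (Suc i) = (\<lambda>_. \<zero>\<^bsub>Y' (Suc i)\<^esub>)" using Z(3) by (simp add: g'_def Y'_def)
    then show ?thesis using hom_const_zero[OF rY'] by simp
  qed
  have ker: "image_into reg Y' g0 g' i = a_kernel (Y' i) (Y' (Suc i)) (g' (Suc i))" for i
  proof (cases "i < r")
    case True
    then have "image_into reg Y g0 g i = a_kernel (Y i) (Y (Suc i)) (g (Suc i))" using E by blast
    then show ?thesis using True im[of i] by (simp add: Y'_def g'_def)
  next
    case False
    then have "a_kernel (Y' i) (Y' (Suc i)) (g' (Suc i)) = carrier (Y' i)" using Z(3) by (simp add: Y'_def g'_def)
    moreover have "image_into reg Y' g0 g' i = carrier (Y' i)"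
    proof (cases "i = r")
      case True
      then show ?thesis using im[of i] surj by (simp add: Y'_def)
    next
      case neq: False
      then obtain j where j: "i = Suc j" "r \<le> j" using False by (cases i) auto
      have "image_into reg Y' g0 g' (Suc j) = {\<zero>\<^bsub>Y r\<^esub>}" by (rule im_zero[OF j(2)])
      then show ?thesis using j Z(4) by (simp add: Y'_def del: image_into.simps)
    qed
    ultimately show ?thesis by (simp only:)
  qed
  show thesis
  proof (rule that[of Y' g'])
    show "exact_right A reg Y' g0 g' m" for m
      unfolding exact_right_def using hom ker E by (simp add: Y'_def del: image_into.simps a_kernel_eq)
    show "in_add A T (Y' i)" for i using add in_add_zero[OF T Z(1,2)] by (simp add: Y'_def)
    show "zero_module (Y' i)" if "r < i" for i using Z(2) that by (simp add: Y'_def)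
  qed
qed

section \<open>The setting of the second statement, with \<open>D\<close> = d - 1\<close>

context
  fixes Q :: "('a, 'q) module" and T :: "('a, 't) module" and D :: nat
    and P :: "nat \<Rightarrow> ('a, 'p) module" and e dd
    and Y :: "nat \<Rightarrow> ('a, 'y) module" and g0 g r
  assumes Q: "fg_module A Q" and Q1: "pp 1 Q Q"
    and T: "fg_module A T" and TT: "pp (Suc D) T T" and Tpd: "\<not> pp D T zm"
    and F: "fac Q (Suc D) T P e dd" and QT: "in_add A T Q"
    and ex: "\<And>m. exact_right A reg Y g0 g m" and Yadd: "\<And>i. in_add A T (Y i)"
    and Yzero: "\<And>i. r < i \<Longrightarrow> zero_module (Y i)"
begin

text \<open>The cosyzygies are realised as images, so \<open>BB 0\<close> is the copy of A inside
  \<open>Y 0\<close> and each \<open>BB i\<close> is a submodule of \<open>Y i\<close>.\<close>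

abbreviation BB :: "nat \<Rightarrow> ('a, 'y) module" where
  "BB i \<equiv> (Y i)\<lparr>carrier := image_into reg Y g0 g i\<rparr>"

lemma rm_QTY: "rm Q" "rm T" "rm (Y i)"
  using fg_moduleD[OF Q] fg_moduleD[OF T] in_add_rm[OF Yadd] by simp_all

lemma submodule_Y: "submodule (image_into reg Y g0 g i) A (Y i)"
  by (rule submodule_image_into[OF ex rm_regular rm_QTY(3) order_refl])

lemma rm_BB: "rm (BB i)"
  by (rule rm_submodule[OF rm_QTY(3) submodule_Y])

lemma ses_BB: "ses (BB i) (Y i) (BB (Suc i)) (\<lambda>x. x) (g (Suc i))"
proof -
  have g: "g (Suc i) \<in> Hom (Y i) (Y (Suc i))"
    and I: "image_into reg Y g0 g i = {y \<in> carrier (Y i). g (Suc i) y = \<zero>\<^bsub>Y (Suc i)\<^esub>}"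
    using ex[of "Suc i"] by (simp_all add: exact_right_def)
  have "g (Suc i) \<in> Hom (Y i) (BB (Suc i))" by (rule hom_corestrict[OF g]) simp
  moreover have "(\<lambda>x. x) \<in> Hom (BB i) (Y i)"
    by (rule hom_restrict[OF hom_id]) (use submoduleD(1)[OF rm_QTY(3) submodule_Y] in blast)
  moreover have "\<forall>y\<in>carrier (Y i). g (Suc i) y = \<zero>\<^bsub>BB (Suc i)\<^esub> \<longleftrightarrow> y \<in> (\<lambda>x. x) ` carrier (BB i)"
    unfolding I by simp
  moreover have "g (Suc i) ` carrier (Y i) = carrier (BB (Suc i))" by simp
  ultimately show ?thesis
    unfolding ses_def using rm_BB rm_QTY(3) by (simp only: inj_on_id2 simp_thms)
qed

lemma pp_BB: "pp (Suc D) (BB i) T"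
proof -
  have zero: "pp (Suc D) (BB i) T" if "r < i" for i
  proof -
    have "zero_module (BB i)"
    proof (rule zero_moduleI[OF rm_BB])
      fix x assume "x \<in> carrier (BB i)"
      then have "x \<in> carrier (Y i)" by (intro submoduleD(1)[OF rm_QTY(3) submodule_Y]) simp
      then show "x = \<zero>\<^bsub>BB i\<^esub>" using Yzero[OF that] by (simp add: zero_module_def)
    qed
    then have "pp 0 (BB i) T" using in_add_zero[OF rm_regular rm_BB] by simp
    then show ?thesis by (rule pp_mono[OF _ _ rm_QTY(2), rotated]) simp
  qed
  \<comment> \<open>Descending induction from the cosyzygies that are zero, with \<open>k\<close>
    counting the steps down from \<open>Suc r\<close>; for \<open>k\<close> beyond \<open>r\<close>
    the subtraction truncates and the claim repeats itself. In each step the rule for kernels keeps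
    the bound at \<open>Suc D\<close>, once that of the cokernel has been raised by one.\<close>
  have "pp (Suc D) (BB (Suc r - k)) T" for k
  proof (induction k)
    case 0
    show ?case by (rule zero) simp
  next
    case (Suc k)
    show ?case
    proof (cases "k \<le> r")
      case True
      then have eq: "Suc r - k = Suc (Suc r - Suc k)" by simp
      have "pp (Suc (Suc D)) (BB (Suc (Suc r - Suc k))) T"
        using Suc.IH unfolding eq by (rule pp_Suc_mono[OF _ rm_QTY(2)])
      then show ?thesis by (rule pp_kernel[OF ses_BB pp_in_add[OF TT Yadd rm_QTY(2)] _ rm_QTY(2)])
    next
      case False
      then have "Suc r - Suc k = Suc r - k" by simp
      then show ?thesis using Suc.IH by (simp only:)
    qed
  qed
  from this[of "Suc r - i"] zero[of i] show ?thesis by (cases "r < i") simp_all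
qed

lemma pp_BB_add: "in_add A T W \<Longrightarrow> pp (Suc D) (BB i) W"
  by (rule pp_second[OF pp_BB rm_QTY(2) in_add_rm in_add_thru[OF _ rm_QTY(2)]])

text \<open>The coresolution splits at this cosyzygy, because the latter belongs to \<open>Fac\<^sub>D\<^sub>+\<^sub>1(T)\<close>.\<close>

lemma BB_in_add: "in_add A T (BB (Suc D))"
proof -
  note S = sesD[OF ses_BB]
  have "fac T (Suc D) (BB (Suc D)) (\<lambda>i. Y (D - i)) (g (Suc D)) (\<lambda>i. g (Suc D - i))"
  proof (rule fac_of_exact_right[OF ex order_refl Yadd S(6,7) rm_BB])
    show "{y \<in> carrier (Y D). g (Suc D) y = \<zero>\<^bsub>BB (Suc D)\<^esub>} = image_into reg Y g0 g D"
      using ex[of "Suc D"] by (simp add: exact_right_def)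
  qed
  from pp_fac[OF pp_BB rm_QTY(2) this] have "pp (Suc D) (BB (Suc (Suc D))) (BB (Suc D))" .
  then obtain r where r: "r \<in> Hom (Y (Suc D)) (BB (Suc D))"
    "\<And>x. x \<in> carrier (BB (Suc D)) \<Longrightarrow> r x = x"
    by (rule pp_extend[OF ses_BB _ hom_id rm_BB]) (rule that)
  show ?thesis
    by (rule in_add_retract[OF Yadd rm_QTY(2) rm_BB S(4) r(1)]) (erule r(2))
qed

text \<open>If \<open>Q\<close> were zero, then so would be \<open>T\<close>, a quotient of a module
  in add Q; this contradicts the lower bound on its projective dimension.\<close>

lemma Q_nonzero: "\<not> zero_module Q"
proof
  assume z: "zero_module Q"
  note FS = fac_Suc[OF F]
  note S = sesD[OF FS(2)]
  have "x = \<zero>\<^bsub>P 0\<^esub>" if "x \<in> carrier (P 0)" for x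
    using thru_zero_module[OF in_add_thru[OF FS(1) rm_QTY(1)] z rm_QTY(1) S(2) that] .
  then have P0: "carrier (P 0) \<subseteq> {\<zero>\<^bsub>P 0\<^esub>}" by blast
  have "carrier T \<subseteq> {\<zero>\<^bsub>T\<^esub>}"
    unfolding S(7)[symmetric] using P0 hom_zero[OF S(6,2,3)] by auto
  then have "zero_module T" using rm_closed(1)[OF rm_QTY(2)] by (auto simp: zero_module_def)
  then have "pp 0 T zm" using in_add_zero[OF rm_regular rm_QTY(2)] by simp
  then have "pp D T zm" by (rule pp_mono[OF _ _ rm_zm, rotated]) simp
  then show False using Tpd by simp
qed

lemma power_nonzero: "\<not> zero_module (power_module Q (Suc k))"
proof
  assume z: "zero_module (power_module Q (Suc k))"
  have "q = \<zero>\<^bsub>Q\<^esub>" if q: "q \<in> carrier Q" for q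
  proof -
    have "(\<lambda>i\<in>{..<Suc k}. q) \<in> carrier (power_module Q (Suc k))" using q by simp
    then have "(\<lambda>i\<in>{..<Suc k}. q) = \<zero>\<^bsub>power_module Q (Suc k)\<^esub>" using z by (simp only: zero_module_def singleton_iff)
    then have "(\<lambda>i\<in>{..<Suc k}. q) k = (\<lambda>i\<in>{..<Suc k}. \<zero>\<^bsub>Q\<^esub>) k" by (simp only: power_simps)
    then show ?thesis by simp
  qed
  then have "zero_module Q" by (rule zero_moduleI[OF rm_QTY(1)])
  then show False using Q_nonzero by simp
qed

text \<open>\<open>stably i X\<close>: modulo maps that factor through \<open>add T\<close>, the identity of \<open>X\<close> factors through
  the \<open>i\<close>-th cosyzygy of \<open>A\<close>.\<close>

definition stably :: "nat \<Rightarrow> ('a, 'x) module \<Rightarrow> bool" where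
  "stably i X \<longleftrightarrow> (\<exists>a b h. a \<in> Hom X (BB i) \<and> b \<in> Hom (BB i) X \<and> thru T X X h \<and>
     (\<forall>x\<in>carrier X. b (a x) \<oplus>\<^bsub>X\<^esub> h x = x))"

text \<open>The kernel of \<open>P 0\<close> -> \<open>T\<close> has a presentation with only
  \<open>D\<close> terms. Since \<open>i\<close> is at most \<open>D\<close>, Ext^1 from
  \<open>X\<close> into this kernel vanishes and the map lifts to \<open>P 0\<close>.\<close>

lemma thru_of_hom_T:
  assumes X: "pp i X Q" and i: "i \<le> D" and f: "f \<in> Hom X T"
  shows "thru Q X T f"
proof -
  note FS = fac_Suc[OF F]
  note S = sesD[OF FS(2)]
  have "pp D X Q" by (rule pp_mono[OF i X rm_QTY(1)])
  from pp_fac[OF this rm_QTY(1) FS(3)] have ext: "pp D X (Ker (P 0) T e)" .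
  obtain f' where f': "f' \<in> Hom X (P 0)" "\<And>x. x \<in> carrier X \<Longrightarrow> e (f' x) = f x"
    by (rule pp_lift[OF FS(2) ext f]) (rule that)
  have "thru Q X T (\<lambda>x. e (f' x))"
    by (rule thru_comp_left[OF in_add_thru_hom[OF FS(1) rm_QTY(1) f'(1)] S(6) pp_rm[OF X] S(2,3)])
  then show ?thesis by (rule thru.thru_cong) (simp add: f'(2))
qed

text \<open>Write the identity of \<open>X\<close> as b a + h. The pair (a, h) is injective and
  passes through add T, hence through a power R of \<open>Q\<close>, which gives the monomorphism
  \<open>\<iota>\<close> and a map \<open>v\<close> back. What makes \<open>\<iota>\<close> a left
  approximation is that maps to \<open>Q\<close> extend along the inclusion of \<open>BB i\<close>
  into \<open>Y i\<close>, by the vanishing of Ext^1(BB (Suc i), Q).\<close>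

lemma approximation_step:
  fixes X :: "('a, 'x) module"
  assumes X: "pp i X Q" and i: "i \<le> D" and st: "stably i X"
  obtains k \<iota> where "\<iota> \<in> Hom X (power_module Q (Suc k))" "inj_on \<iota> (carrier X)"
    "pp (Suc i) (quotient_module (power_module Q (Suc k)) (\<iota> ` carrier X)) Q"
    "\<not> zero_module (quotient_module (power_module Q (Suc k)) (\<iota> ` carrier X))"
    "stably (Suc i) (quotient_module (power_module Q (Suc k)) (\<iota> ` carrier X))"
proof -
  note rQ = rm_QTY(1) and rT = rm_QTY(2) and rY = rm_QTY(3) and rX = pp_rm[OF X]
  obtain a b h where a: "a \<in> Hom X (BB i)" and b: "b \<in> Hom (BB i) X" and h: "thru T X X h"
    and sum: "\<And>x. x \<in> carrier X \<Longrightarrow> b (a x) \<oplus>\<^bsub>X\<^esub> h x = x"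
    using st unfolding stably_def by auto
  note hX = thru_hom[OF h rX rX] and SB = sesD[OF ses_BB]
  have aY: "a \<in> Hom X (Y i)" using hom_comp[OF a SB(4)] .
  \<comment> \<open>The map \<open>a\<close> is taken into \<open>Y i\<close> and not into
    \<open>BB i\<close>, because \<open>Y i\<close> lies in add T.\<close>
  let ?W = "direct_sum (Y i) X"
  note W = rm_direct_sum[OF rY rX, of i]
  have "thru T X ?W (\<lambda>x. (a x, h x))"
    by (rule thru_pair[OF in_add_thru_hom[OF Yadd rT aY] h rX rY rX])
  then have u: "thru Q X ?W (\<lambda>x. (a x, h x))"
    by (rule thru_swap[OF _ thru_of_hom_T[OF X i] rT rX W])
  obtain k \<iota> v where \<iota>: "\<iota> \<in> Hom X (power_module Q (Suc k))" and v: "v \<in> Hom (power_module Q (Suc k)) ?W"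
    and v\<iota>: "\<And>x. x \<in> carrier X \<Longrightarrow> v (\<iota> x) = (a x, h x)" and spare: "\<And>x. x \<in> carrier X \<Longrightarrow> \<iota> x k = \<zero>\<^bsub>Q\<^esub>"
    by (rule thru_power_spare[OF u rQ rX W]) (rule that)
  define R where "R = power_module Q (Suc k)"
  have R: "rm R" "in_add A Q R" unfolding R_def using rm_power[OF rQ] in_add_power[OF Q] by simp_all
  note \<iota>R = \<iota>[folded R_def] and vR = v[folded R_def]
  have inj: "inj_on \<iota> (carrier X)"
    unfolding hom_inj_iff[OF rX R(1) \<iota>R]
  proof (intro ballI impI)
    fix x assume x: "x \<in> carrier X" "\<iota> x = \<zero>\<^bsub>R\<^esub>"
    have "(a x, h x) = \<zero>\<^bsub>?W\<^esub>" using v\<iota>[OF x(1)] hom_zero[OF vR R(1) W] x(2) by simp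
    then have "a x = \<zero>\<^bsub>BB i\<^esub>" "h x = \<zero>\<^bsub>X\<^esub>" by simp_all
    then show "x = \<zero>\<^bsub>X\<^esub>" using sum[OF x(1)] hom_zero[OF b rm_BB rX] rX by simp
  qed
  let ?Z = "quotient_module R (\<iota> ` carrier X)" and ?\<pi> = "\<lambda>y. \<iota> ` carrier X +>\<^bsub>R\<^esub> y"
  have s: "ses X R ?Z \<iota> ?\<pi>" by (rule ses_quotient[OF rX R(1) \<iota>R inj])
  note S = sesD[OF s]
  have ppZ: "pp (Suc i) ?Z Q"
  proof (rule pp_cokernel[OF s X _ rQ])
    show "pp (Suc i) R Q" by (rule pp_mono[OF _ pp_in_add[OF Q1 R(2) rQ] rQ]) simp
    fix w assume w: "w \<in> Hom X Q"
    \<comment> \<open>Since w = w b a + w h, extending w b from \<open>BB i\<close> to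
      \<open>Y i\<close> expresses \<open>w\<close> through the pair (a, h), and thus through
      \<open>\<iota>\<close>.\<close>
    obtain y where y: "y \<in> Hom (Y i) Q" "\<And>x. x \<in> carrier (BB i) \<Longrightarrow> y x = w (b x)"
      by (rule pp_extend[OF ses_BB pp_BB_add[OF QT] hom_comp[OF b w] rQ]) (rule that)
    have "(\<lambda>q. y (fst (v q)) \<oplus>\<^bsub>Q\<^esub> w (snd (v q))) \<in> Hom R Q"
      by (rule hom_add[OF hom_comp[OF hom_comp[OF vR hom_fst] y(1)] hom_comp[OF hom_comp[OF vR hom_snd] w] rQ])
    moreover have "y (fst (v (\<iota> x))) \<oplus>\<^bsub>Q\<^esub> w (snd (v (\<iota> x))) = w x" if x: "x \<in> carrier X" for x
    proof -
      have "w (b (a x) \<oplus>\<^bsub>X\<^esub> h x) = w (b (a x)) \<oplus>\<^bsub>Q\<^esub> w (h x)"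
        by (rule homD(2)[OF w homD(1)[OF hom_comp[OF a b] x] homD(1)[OF hX x]])
      then show ?thesis using v\<iota>[OF x] y(2)[OF homD(1)[OF a x]] sum[OF x] by simp
    qed
    ultimately show "\<exists>h\<in>Hom R Q. \<forall>x\<in>carrier X. h (\<iota> x) = w x"
      by (intro bexI[of _ "\<lambda>q. y (fst (v q)) \<oplus>\<^bsub>Q\<^esub> w (snd (v q))"] ballI)
  qed
  have Znz: "\<not> zero_module ?Z"
  proof
    assume z: "zero_module ?Z"
    have "q = \<zero>\<^bsub>Q\<^esub>" if q: "q \<in> carrier Q" for q
    proof -
      have m: "(\<lambda>i\<in>{..<Suc k}. q) \<in> carrier R" using q by (simp add: R_def)
      have "?\<pi> (\<lambda>i\<in>{..<Suc k}. q) = \<zero>\<^bsub>?Z\<^esub>" using homD(1)[OF S(6) m] z by (simp only: zero_module_def singleton_iff)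
      \<comment> \<open>A zero cokernel would put every constant tuple into the image of
        \<open>\<iota>\<close>, where the spare last coordinate is zero.\<close>
      then have "(\<lambda>i\<in>{..<Suc k}. q) \<in> \<iota> ` carrier X" by (rule S(8)[OF m])
      then obtain x where x: "x \<in> carrier X" "(\<lambda>i\<in>{..<Suc k}. q) = \<iota> x" by (elim imageE)
      from fun_cong[OF x(2), of k] show ?thesis using spare[OF x(1)] by simp
    qed
    then have "zero_module Q" by (rule zero_moduleI[OF rQ])
    then show False using Q_nonzero by simp
  qed
  have RT: "in_add A T R" by (rule in_add_trans[OF QT R(2) rT])
  obtain b1 where b1: "b1 \<in> Hom (Y i) R" "\<And>x. x \<in> carrier (BB i) \<Longrightarrow> b1 x = \<iota> (b x)"
    by (rule pp_extend[OF ses_BB pp_BB_add[OF RT] hom_comp[OF b \<iota>R] R(1)]) (rule that)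
  \<comment> \<open>\<open>?A1\<close> and \<open>?H1\<close> extend \<open>a\<close> and
    \<open>h\<close> along \<open>\<iota>\<close>, while \<open>b1\<close> extends
    \<open>\<iota>\<close> after \<open>b\<close>. On cokernels \<open>?A1\<close> and
    \<open>b1\<close> induce the new pair \<open>a'\<close> and \<open>b'\<close>.\<close>
  let ?A1 = "\<lambda>q. fst (v q)" and ?H1 = "\<lambda>q. snd (v q)"
  have A1: "?A1 \<in> Hom R (Y i)" and H1: "?H1 \<in> Hom R X"
    using hom_comp[OF vR hom_fst] hom_comp[OF vR hom_snd] .
  have z1: "g (Suc i) (?A1 (\<iota> x)) = \<zero>\<^bsub>BB (Suc i)\<^esub>" if x: "x \<in> carrier X" for x
    using SB(9)[OF homD(1)[OF a x]] v\<iota>[OF x] by simp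
  obtain a' where a': "a' \<in> Hom ?Z (BB (Suc i))" "\<And>q. q \<in> carrier R \<Longrightarrow> a' (?\<pi> q) = g (Suc i) (?A1 q)"
    by (rule ses_factor_out[where f = "\<lambda>q. g (Suc i) (?A1 q)", OF s hom_comp[OF A1 SB(6)] z1 rm_BB]) (auto intro: that)
  have z2: "?\<pi> (b1 x) = \<zero>\<^bsub>?Z\<^esub>" if x: "x \<in> carrier (BB i)" for x
    using b1(2)[OF x] S(9)[OF homD(1)[OF b x]] by simp
  obtain b' where b': "b' \<in> Hom (BB (Suc i)) ?Z" "\<And>y. y \<in> carrier (Y i) \<Longrightarrow> b' (g (Suc i) y) = ?\<pi> (b1 y)"
    by (rule ses_factor_out[where f = "\<lambda>y. ?\<pi> (b1 y)", OF ses_BB hom_comp[OF b1(1) S(6)] z2 S(3)]) (auto intro: that)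
  \<comment> \<open>The defect of these lifts. It vanishes on \<open>X\<close>, where b a + h is the
    identity, so it induces a map from the cokernel to \<open>R\<close>; as \<open>R\<close> is in
    add T, the new error term passes through add T.\<close>
  let ?c = "\<lambda>q. q \<oplus>\<^bsub>R\<^esub> neg R (b1 (?A1 q) \<oplus>\<^bsub>R\<^esub> \<iota> (?H1 q))"
  have c: "?c \<in> Hom R R"
    by (rule hom_sub[OF hom_id hom_add[OF hom_comp[OF A1 b1(1)] hom_comp[OF H1 \<iota>R] R(1)] R(1)])
  have z3: "?c (\<iota> x) = \<zero>\<^bsub>R\<^esub>" if x: "x \<in> carrier X" for x
  proof -
    have "\<iota> (b (a x) \<oplus>\<^bsub>X\<^esub> h x) = \<iota> (b (a x)) \<oplus>\<^bsub>R\<^esub> \<iota> (h x)"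
      by (rule homD(2)[OF \<iota>R homD(1)[OF hom_comp[OF a b] x] homD(1)[OF hX x]])
    then have "b1 (?A1 (\<iota> x)) \<oplus>\<^bsub>R\<^esub> \<iota> (?H1 (\<iota> x)) = \<iota> x"
      using v\<iota>[OF x] b1(2)[OF homD(1)[OF a x]] sum[OF x] by simp
    then show ?thesis using homD(1)[OF \<iota>R x] R(1) by (simp del: rm_neg_add)
  qed
  obtain c' where c': "c' \<in> Hom ?Z R" "\<And>q. q \<in> carrier R \<Longrightarrow> c' (?\<pi> q) = ?c q"
    by (rule ses_factor_out[where f = ?c, OF s c z3 R(1)]) (auto intro: that)
  have h': "thru T ?Z ?Z (\<lambda>z. ?\<pi> (c' z))"
    by (rule thru_comp_left[OF in_add_thru_hom[OF RT rT c'(1)] S(6,3) R(1) S(3)])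
  have "b' (a' z) \<oplus>\<^bsub>?Z\<^esub> ?\<pi> (c' z) = z" if z: "z \<in> carrier ?Z" for z
  proof -
    have "z \<in> ?\<pi> ` carrier R" using z S(7) by simp
    then obtain q where q: "q \<in> carrier R" "z = ?\<pi> q" by (elim imageE)
    note car = homD(1)[OF A1 q(1)] homD(1)[OF H1 q(1)] homD(1)[OF b1(1) homD(1)[OF A1 q(1)]]
      homD(1)[OF \<iota>R homD(1)[OF H1 q(1)]] homD(1)[OF c q(1)]
    have e1: "b' (a' z) = ?\<pi> (b1 (?A1 q))" using a'(2)[OF q(1)] b'(2)[OF car(1)] q(2) by simp
    have e2: "?\<pi> (c' z) = ?\<pi> (?c q)" using c'(2)[OF q(1)] q(2) by simp
    have e3: "q = (b1 (?A1 q) \<oplus>\<^bsub>R\<^esub> ?c q) \<oplus>\<^bsub>R\<^esub> \<iota> (?H1 q)"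
    proof -
      let ?s = "b1 (?A1 q) \<oplus>\<^bsub>R\<^esub> \<iota> (?H1 q)"
      have s: "?s \<in> carrier R" using car(3,4) R(1) by simp
      have "(b1 (?A1 q) \<oplus>\<^bsub>R\<^esub> ?c q) \<oplus>\<^bsub>R\<^esub> \<iota> (?H1 q) = ?c q \<oplus>\<^bsub>R\<^esub> ?s"
        using car(3,4,5) R(1) by (simp only: rm_ac rm_closed)
      also have "\<dots> = q \<oplus>\<^bsub>R\<^esub> (neg R ?s \<oplus>\<^bsub>R\<^esub> ?s)"
        by (rule rm_add(4)[OF R(1) q(1) rm_closed(4)[OF R(1) s] s])
      also have "\<dots> = q" unfolding rm_neg(2)[OF R(1) s] by (rule rm_add(2)[OF R(1) q(1)])
      finally show ?thesis ..
    qed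
    have "?\<pi> q = ?\<pi> ((b1 (?A1 q) \<oplus>\<^bsub>R\<^esub> ?c q) \<oplus>\<^bsub>R\<^esub> \<iota> (?H1 q))"
      by (rule arg_cong[OF e3])
    also have "\<dots> = ?\<pi> (b1 (?A1 q) \<oplus>\<^bsub>R\<^esub> ?c q) \<oplus>\<^bsub>?Z\<^esub> ?\<pi> (\<iota> (?H1 q))"
      by (rule homD(2)[OF S(6) rm_closed(2)[OF R(1) car(3,5)] car(4)])
    also have "\<dots> = ?\<pi> (b1 (?A1 q) \<oplus>\<^bsub>R\<^esub> ?c q)"
      unfolding S(9)[OF car(2)]
      by (rule rm_add(2)[OF S(3) homD(1)[OF S(6) rm_closed(2)[OF R(1) car(3,5)]]])
    also have "\<dots> = ?\<pi> (b1 (?A1 q)) \<oplus>\<^bsub>?Z\<^esub> ?\<pi> (?c q)"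
      by (rule homD(2)[OF S(6) car(3,5)])
    finally have e4: "?\<pi> q = ?\<pi> (b1 (?A1 q)) \<oplus>\<^bsub>?Z\<^esub> ?\<pi> (?c q)" .
    show ?thesis unfolding e1 e2 by (rule trans[OF e4[symmetric] q(2)[symmetric]])
  qed
  then have stZ: "stably (Suc i) ?Z" unfolding stably_def using a'(1) b'(1) h' by blast
  show thesis by (rule that[OF \<iota> inj ppZ[unfolded R_def] Znz[unfolded R_def] stZ[unfolded R_def]])
qed

text \<open>Besides the sequence itself it records what \<open>approximation_step\<close> asks of
  the last cokernel. The terms are kept as powers with at least one factor, from which membership in
  add Q and nonvanishing are read off at the end.\<close>

definition stage :: "nat \<Rightarrow> (nat \<Rightarrow> ('a, nat \<Rightarrow> 'q) module) \<Rightarrow> ('a \<Rightarrow> (nat \<Rightarrow> 'q)) \<Rightarrow>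
    (nat \<Rightarrow> (nat \<Rightarrow> 'q) \<Rightarrow> (nat \<Rightarrow> 'q)) \<Rightarrow> bool" where
  "stage i Q' f0 f \<longleftrightarrow> exact_right A reg Q' f0 f i \<and> (\<forall>j\<le>i. \<exists>k. Q' j = power_module Q (Suc k)) \<and>
     pp (Suc i) (cokernel reg Q' f0 f (Suc i)) Q \<and> \<not> zero_module (cokernel reg Q' f0 f (Suc i)) \<and>
     stably (Suc i) (cokernel reg Q' f0 f (Suc i))"

lemma stage_0: "\<exists>Q' f0 f. stage 0 Q' f0 f"
proof -
  have g0: "g0 \<in> Hom reg (Y 0)" "inj_on g0 (carrier reg)" using ex[of 0] by (simp_all add: exact_right_def)
  have a: "g0 \<in> Hom reg (BB 0)" by (rule hom_corestrict[OF g0(1)]) simp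
  have bij: "bij_betw g0 (carrier reg) (carrier (BB 0))" using g0(2) by (simp add: bij_betw_def)
  obtain b where b: "b \<in> Hom (BB 0) reg" "\<And>x. x \<in> carrier reg \<Longrightarrow> b (g0 x) = x"
    by (rule mod_iso_inverse[OF rm_regular rm_BB a bij]) (rule that)
  \<comment> \<open>A is isomorphic to \<open>BB 0\<close> by \<open>g0\<close>, so no correction
    through add T is needed.\<close>
  have st0: "stably 0 reg"
    unfolding stably_def
    using a b thru.thru_zero[of T reg reg]
    by (intro exI[of _ g0] exI[of _ b] exI[of _ "\<lambda>_. \<zero>\<^bsub>reg\<^esub>"]) (simp add: rm_zero_add[OF rm_regular, simplified])
  have pp0: "pp 0 reg Q" by (simp add: in_add_self[OF fg_regular])
  obtain k \<iota> where k: "\<iota> \<in> Hom reg (power_module Q (Suc k))" "inj_on \<iota> (carrier reg)"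
    "pp (Suc 0) (quotient_module (power_module Q (Suc k)) (\<iota> ` carrier reg)) Q"
    "\<not> zero_module (quotient_module (power_module Q (Suc k)) (\<iota> ` carrier reg))"
    "stably (Suc 0) (quotient_module (power_module Q (Suc k)) (\<iota> ` carrier reg))"
    by (rule approximation_step[OF pp0 le0 st0]) (rule that)
  \<comment> \<open>Only the augmentation is read at stage 0, so the differentials may be
    \<open>undefined\<close>.\<close>
  have "cokernel reg (\<lambda>_. power_module Q (Suc k)) \<iota> undefined (Suc 0) =
      quotient_module (power_module Q (Suc k)) (\<iota> ` carrier reg)" by (simp only: cokernel_Suc image_into.simps)
  moreover have "exact_right A reg (\<lambda>_. power_module Q (Suc k)) \<iota> undefined 0"
    using k(1,2) by (simp add: exact_right_def)
  ultimately have "stage 0 (\<lambda>_. power_module Q (Suc k)) \<iota> undefined"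
    unfolding stage_def using k(3-5) by auto
  then show ?thesis by blast
qed

lemma stage_rm: "stage i Q' f0 f \<Longrightarrow> j \<le> i \<Longrightarrow> rm (Q' j)"
  unfolding stage_def using rm_power[OF rm_QTY(1)] by metis

lemma stage_submodule:
  assumes "stage i Q' f0 f"
  shows "submodule (image_into reg Q' f0 f i) A (Q' i)"
proof -
  have "exact_right A reg Q' f0 f i" using assms by (simp add: stage_def)
  then show ?thesis by (rule submodule_image_into[OF _ rm_regular stage_rm[OF assms] order_refl])
qed

lemma stage_Suc:
  assumes st: "stage i Q' f0 f" and i: "Suc i \<le> D"
  shows "\<exists>Q' f0 f. stage (Suc i) Q' f0 f"
proof -
  note stD = st[unfolded stage_def]
  let ?C = "cokernel reg Q' f0 f (Suc i)" and ?\<pi> = "\<lambda>y. image_into reg Q' f0 f i +>\<^bsub>Q' i\<^esub> y"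
  note rQ = stage_rm[OF st order_refl] and sub = stage_submodule[OF st]
  have ppC: "pp (Suc i) ?C Q" and stC: "stably (Suc i) ?C" and exC: "exact_right A reg Q' f0 f i"
    using stD by simp_all
  have \<pi>: "?\<pi> \<in> Hom (Q' i) ?C" unfolding cokernel_Suc by (rule hom_quotient[OF rQ sub])
  obtain k \<iota> where k: "\<iota> \<in> Hom ?C (power_module Q (Suc k))" "inj_on \<iota> (carrier ?C)"
    "pp (Suc (Suc i)) (quotient_module (power_module Q (Suc k)) (\<iota> ` carrier ?C)) Q"
    "\<not> zero_module (quotient_module (power_module Q (Suc k)) (\<iota> ` carrier ?C))"
    "stably (Suc (Suc i)) (quotient_module (power_module Q (Suc k)) (\<iota> ` carrier ?C))"
    by (rule approximation_step[OF ppC i stC]) (rule that)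
  \<comment> \<open>The new differential is the projection to the cokernel followed by
    \<open>\<iota>\<close>. Injectivity of \<open>\<iota>\<close> keeps the kernel, and the image is
    that of \<open>\<iota>\<close>, so the next cokernel is the one provided by the approximation
    step.\<close>
  let ?R = "power_module Q (Suc k)" and ?p = "\<lambda>y. \<iota> (?\<pi> y)"
  have rR: "rm ?R" by (rule rm_power[OF rm_QTY(1)])
  have p: "?p \<in> Hom (Q' i) ?R" by (rule hom_comp[OF \<pi> k(1)])
  have "?p y = \<zero>\<^bsub>?R\<^esub> \<longleftrightarrow> y \<in> image_into reg Q' f0 f i" if y: "y \<in> carrier (Q' i)" for y
  proof -
    have "?p y = \<zero>\<^bsub>?R\<^esub> \<longleftrightarrow> ?\<pi> y = \<zero>\<^bsub>?C\<^esub>"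
      using k(2)[unfolded hom_inj_iff[OF pp_rm[OF ppC] rR k(1)]] homD(1)[OF \<pi> y]
        hom_zero[OF k(1) pp_rm[OF ppC] rR] by metis
    also have "\<dots> \<longleftrightarrow> y \<in> image_into reg Q' f0 f i"
      unfolding cokernel_Suc by (rule quotient_eq_zero_iff[OF rQ sub y])
    finally show ?thesis .
  qed
  then have ker: "image_into reg Q' f0 f i = a_kernel (Q' i) ?R ?p"
    unfolding a_kernel_eq using submoduleD(1)[OF rQ sub] by blast
  note E = exact_right_extend[OF exC p ker]
  let ?Q' = "Q'(Suc i := ?R)" and ?f = "f(Suc i := ?p)"
  have "?p ` carrier (Q' i) = \<iota> ` ?\<pi> ` carrier (Q' i)" by (simp only: image_image)
  then have "?p ` carrier (Q' i) = \<iota> ` carrier ?C" by (simp only: cokernel_Suc quotient_surj)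
  then have im: "image_into reg ?Q' f0 ?f (Suc i) = \<iota> ` carrier ?C" using E(2) by (rule trans[rotated])
  have cok: "cokernel reg ?Q' f0 ?f (Suc (Suc i)) = quotient_module ?R (\<iota> ` carrier ?C)"
    unfolding cokernel_Suc im by simp
  have "stage (Suc i) ?Q' f0 ?f"
    unfolding stage_def cok using E(1) k(3-5) stD by (auto simp: le_Suc_eq)
  then show ?thesis by blast
qed

lemma stage_D: "\<exists>Q' f0 f. stage D Q' f0 f"
proof -
  have "i \<le> D \<Longrightarrow> \<exists>Q' f0 f. stage i Q' f0 f" for i
    by (induction i) (use stage_0 stage_Suc in auto)
  then show ?thesis by simp
qed

lemma second_statement:
  "\<exists>(Q' :: nat \<Rightarrow> ('a, nat \<Rightarrow> 'q) module) f0 f (T' :: ('a, nat \<Rightarrow> 't) module) p.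
     exact_right A reg Q' f0 f D \<and> p \<in> Hom (Q' D) T' \<and>
     image_into reg Q' f0 f D = a_kernel (Q' D) T' p \<and> p ` carrier (Q' D) = carrier T' \<and>
     (\<forall>i\<le>D. in_add A Q (Q' i) \<and> \<not> zero_module (Q' i)) \<and> in_add A T T' \<and> \<not> zero_module T'"
proof -
  obtain Q' f0 f where st: "stage D Q' f0 f" using stage_D by blast
  note stD = st[unfolded stage_def]
  let ?C = "cokernel reg Q' f0 f (Suc D)" and ?\<pi> = "\<lambda>y. image_into reg Q' f0 f D +>\<^bsub>Q' D\<^esub> y"
  note rQ = stage_rm[OF st order_refl] and sub = stage_submodule[OF st]
  have ppC: "pp (Suc D) ?C Q" and exC: "exact_right A reg Q' f0 f D" and nzC: "\<not> zero_module ?C"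
    using stD by simp_all
  note rC = pp_rm[OF ppC]
  have \<pi>: "?\<pi> \<in> Hom (Q' D) ?C" unfolding cokernel_Suc by (rule hom_quotient[OF rQ sub])
  obtain a b h where a: "a \<in> Hom ?C (BB (Suc D))" and b: "b \<in> Hom (BB (Suc D)) ?C" and h: "thru T ?C ?C h"
    and sum: "\<And>x. x \<in> carrier ?C \<Longrightarrow> b (a x) \<oplus>\<^bsub>?C\<^esub> h x = x"
    using stD unfolding stably_def by auto
  have "thru T ?C ?C (\<lambda>x. b (a x))"
    by (rule thru_comp_left[OF in_add_thru_hom[OF BB_in_add rm_QTY(2) a] b rC rm_BB rC])
  then have "thru T ?C ?C (\<lambda>x. b (a x) \<oplus>\<^bsub>?C\<^esub> h x)" by (rule thru_add[OF h _ rC rC])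
  then have "thru T ?C ?C (\<lambda>x. x)" by (rule thru.thru_cong) (simp only: sum)
  then have CT: "in_add A T ?C" using pp_fg[OF ppC] in_add_iff[OF rm_QTY(2)] by blast
  obtain T' :: "('a, nat \<Rightarrow> 't) module" and \<phi> \<psi> where iso: "iso_pair ?C T' \<phi> \<psi>"
    by (rule in_add_iso_copy[OF CT rm_QTY(2)])
  note I = iso_pairD[OF iso]
  let ?p = "\<lambda>y. \<phi> (?\<pi> y)"
  have p: "?p \<in> Hom (Q' D) T'" by (rule hom_comp[OF \<pi> I(3)])
  have "?p y = \<zero>\<^bsub>T'\<^esub> \<longleftrightarrow> y \<in> image_into reg Q' f0 f D" if y: "y \<in> carrier (Q' D)" for y
  proof -
    have "?p y = \<zero>\<^bsub>T'\<^esub> \<longleftrightarrow> ?\<pi> y = \<zero>\<^bsub>?C\<^esub>" by (rule I(9)[OF homD(1)[OF \<pi> y]])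
    also have "\<dots> \<longleftrightarrow> y \<in> image_into reg Q' f0 f D"
      unfolding cokernel_Suc by (rule quotient_eq_zero_iff[OF rQ sub y])
    finally show ?thesis .
  qed
  then have ker: "image_into reg Q' f0 f D = a_kernel (Q' D) T' ?p"
    unfolding a_kernel_eq using submoduleD(1)[OF rQ sub] by blast
  have "?p ` carrier (Q' D) = \<phi> ` ?\<pi> ` carrier (Q' D)" by (simp only: image_image)
  then have surj: "?p ` carrier (Q' D) = carrier T'"
    unfolding quotient_surj cokernel_Suc[symmetric] I(7) .
  have "in_add A Q (Q' i) \<and> \<not> zero_module (Q' i)" if i: "i \<le> D" for i
  proof -
    obtain k where "Q' i = power_module Q (Suc k)" using stD i by blast
    then show ?thesis using in_add_power[OF Q] power_nonzero by simp
  qed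
  moreover have "in_add A T T'" by (rule in_add_iso[OF CT rm_QTY(2) iso])
  moreover have "\<not> zero_module T'" using zero_module_iso[OF iso] nzC by blast
  ultimately show ?thesis using exC p ker surj by blast
qed

end

end

theorem proposition3p5:
  fixes R :: "('r, 's) ring_scheme" and A :: "('a, 'b) ring_scheme" and \<phi> :: "'r \<Rightarrow> 'a"
    and Q :: "('a, 'q) module" and n :: nat
  assumes "artin_algebra R A \<phi>" and "basic_algebra A" and "\<not> semisimple_algebra A"
    and "fg_module A Q" and "pd A Q \<le> 1" and "trivial_group (Ext A 1 Q Q)"
  shows
    "(\<forall>(Q' :: nat \<Rightarrow> ('a, 'm) module) f0 f.
        let A' = cokernel (regular_module A) Q' f0 f;
            T = (\<lambda>d. direct_sum (A' d) Q)
        in exact_right A (regular_module A) Q' f0 f n \<longrightarrow>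
           (\<forall>i\<le>n. in_add A Q (Q' i) \<and> \<not> zero_module (Q' i)) \<longrightarrow>
           minimal_left_approx A Q (regular_module A) (Q' 0) f0 \<longrightarrow>
           (\<forall>i\<in>{1..n}. minimal_left_approx A Q (A' i) (Q' i) (\<lambda>C. the_elem (f i ` C))) \<longrightarrow>
           image_into (regular_module A) Q' f0 f n \<noteq> carrier (Q' n) \<longrightarrow>
           (\<forall>d\<in>{1..n + 1}. d_tilting A d (T d) \<and> in_Fac A Q d (T d)) \<and>
           (\<forall>d\<in>{1..n}. is_mutation A (T d) (A' d) Q (T (d + 1))))
     \<and>
     (\<forall>(T :: ('a, 't) module) d.
        1 \<le> d \<longrightarrow> d \<le> n + 1 \<longrightarrow> d_tilting A d T \<longrightarrow> in_Fac A Q d T \<longrightarrow> in_add A T Q \<longrightarrow>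
        (\<exists>(Q' :: nat \<Rightarrow> ('a, nat \<Rightarrow> 'q) module) f0 f (T' :: ('a, nat \<Rightarrow> 't) module) p.
           exact_right A (regular_module A) Q' f0 f (d - 1) \<and>
           p \<in> mod_hom A (Q' (d - 1)) T' \<and>
           image_into (regular_module A) Q' f0 f (d - 1) = a_kernel (Q' (d - 1)) T' p \<and>
           p ` carrier (Q' (d - 1)) = carrier T' \<and>
           (\<forall>i\<le>d - 1. in_add A Q (Q' i) \<and> \<not> zero_module (Q' i)) \<and>
           in_add A T T' \<and> \<not> zero_module T') \<and>
        in_Sub A Q d (regular_module A))"
proof -
  interpret artin_algebra R A \<phi> by fact
  interpret ring_modules A by unfold_locales
  note Q = \<open>fg_module A Q\<close>
  \<comment> \<open>Since pd Q is at most 1, the vanishing of Ext^1 is all that has to be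
    tested.\<close>
  have Q1: "pp 1 Q Q"
  proof (rule pp_of_Ext[OF _ _ fg_moduleD[OF Q] fg_moduleD[OF Q]])
    show "pd A Q \<le> enat 1" using assms(5) by (simp add: one_enat_def)
    show "trivial_group (Ext A i Q Q)" if "1 \<le> i" "i \<le> 1" for i
      using assms(6) that by (simp add: le_antisym)
  qed
  show ?thesis
  proof (intro conjI, goal_cases)
    case 1
    show ?case
      unfolding Let_def
    proof (intro allI impI, goal_cases)
      case (1 Q' f0 f)
      let ?C = "cokernel reg Q' f0 f"
      have add: "in_add A Q (Q' i)" "\<not> zero_module (Q' i)" if "i \<le> n" for i
        using 1(2) that by blast+
      have min: "minimal_left_approx A Q (?C i) (Q' i) (\<lambda>C. the_elem (f i ` C))" if "1 \<le> i" "i \<le> n" for i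
        using 1(4) that by simp
      note hyps = Q Q1 1(1) add 1(3) min 1(5)
      have "d_tilting A d (direct_sum (?C d) Q) \<and> in_Fac A Q d (direct_sum (?C d) Q)"
        if d: "d \<in> {1..n + 1}" for d
      proof -
        obtain k where k: "d = Suc k" "k \<le> n" using d by (cases d) auto
        show ?thesis unfolding k(1) by (intro conjI tilting_TT[OF hyps k(2)] in_Fac_TT[OF hyps k(2)])
      qed
      moreover have "is_mutation A (direct_sum (?C d) Q) (?C d) Q (direct_sum (?C (d + 1)) Q)"
        if d: "d \<in> {1..n}" for d
      proof -
        obtain k where k: "d = Suc k" "Suc k \<le> n" using d by (cases d) auto
        show ?thesis using mutation_TT[OF hyps k(2)] k(1) by simp
      qed
      ultimately show ?case by blast
    qed
  next
    case 2
    show ?case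
    proof (intro allI impI, goal_cases)
      case (1 T d)
      then have d: "1 \<le> d" and tilt: "d_tilting A d T" and Fac: "in_Fac A Q d T" and QT: "in_add A T Q"
        by simp_all
      obtain D where D: "d = Suc D" using d by (cases d) auto
      have T: "fg_module A T" and pdT: "pd A T = enat (Suc D)"
        and ExtT: "\<And>i. 1 \<le> i \<Longrightarrow> trivial_group (Ext A i T T)"
        using tilt D by (simp_all add: d_tilting_def tilting_def)
      note rT = fg_moduleD[OF T]
      have TT: "pp (Suc D) T T"
        by (rule pp_of_Ext[OF _ ExtT rT rT]) (simp_all add: pdT)
      have Tpd: "\<not> pp D T zm"
      proof
        assume "pp D T zm"
        from pd_of_pp[OF this rm_zm] show False by (simp add: pdT)
      qed
      obtain P :: "nat \<Rightarrow> ('a, nat \<Rightarrow> 'q) module" and e dd where F: "fac Q (Suc D) T P e dd"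
        using Fac rT D by (auto simp: in_Fac_def fac_def)
      obtain r and Y :: "nat \<Rightarrow> ('a, nat \<Rightarrow> 't) module" and g0 g where Y:
        "\<And>i. i \<le> r \<Longrightarrow> in_add A T (Y i)" "exact_right A reg Y g0 g r"
        "image_into reg Y g0 g r = carrier (Y r)"
        using tilt unfolding d_tilting_def tilting_def by blast
      obtain Y' g' where Y': "\<And>m. exact_right A reg Y' g0 g' m" "\<And>i. in_add A T (Y' i)"
        "\<And>i. r < i \<Longrightarrow> zero_module (Y' i)"
        by (rule coresolution_prolong[OF Y(2) Y(1) rT Y(3)]) (assumption, rule that)
      note second = second_statement[OF Q Q1 T TT Tpd F QT Y']
      then obtain Q' :: "nat \<Rightarrow> ('a, nat \<Rightarrow> 'q) module" and f0 f
        where Q': "exact_right A reg Q' f0 f D" "\<forall>i\<le>D. in_add A Q (Q' i) \<and> \<not> zero_module (Q' i)"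
        by blast
      have "\<forall>i<Suc D. in_add A Q (Q' i)" using Q'(2) by simp
      then have "in_Sub A Q (Suc D) reg"
        unfolding in_Sub_def diff_Suc_1 using Q'(1) fg_regular by auto
      with second show ?case unfolding D diff_Suc_1 by (rule conjI)
    qed
  qed
qed

end
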